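(* There exist an infinite dimensional separable Hilbert space $\mathcal{E}$ and a function $B\in H^\infty_1(L(\mathcal{E}))$ such that for every $\alpha>-1$, $$\mathcal{A}_\alpha(B)\approx\mathcal{A}_\alpha(B^* )\approx A^2_{\alpha-1,\mathcal{E}},$$ while $B$ is not a finite Blaschke-Potapov product. Here $X\approx Y$ means that $X$ and $Y$ are equal as sets (of $\mathcal{E}$-valued analytic functions on the unit disk).
   Context: Hilbert spaces are complex; $\mathbb{D}$ is the open unit disk. $L(\mathcal{E})$ is the algebra of bounded linear operators on $\mathcal{E}$, and $H^\infty_1(L(\mathcal{E}))$ is the set of analytic functions $B:\mathbb{D}\to L(\mathcal{E})$ with $\|B(z)\|\le 1$ for all $z\in\mathbb{D}$. For $\beta>-2$, $A^2_{\beta,\mathcal{E}}$ is the reproducing kernel Hilbert space of $\mathcal{E}$-valued analytic functions on $\mathbb{D}$ with kernel $\frac{I_{\mathcal{E}}}{(1-z\overline{w})^{\beta+2}}$. Explicitly, with $c_{n,\beta}=\frac{\Gamma(n+\beta+2)}{n!\,\Gamma(\beta+2)}$, it consists of all $f(z)=\sum_{n\ge0}f_nz^n$, $f_n\in\mathcal{E}$, with $\sum_{n\ge 0}\|f_n\|^2/c_{n,\beta}<\infty$. For a contraction $A$ from a Hilbert space $\mathcal{H}$ to a Hilbert space $\mathcal{K}$, $\mathcal{M}(A)$ denotes the range of $A$ with the Hilbert space structure $\langle Ah_1,Ah_2\rangle_{\mathcal{M}(A)}=\langle h_1,h_2\rangle_{\mathcal{H}}$ for $h_1\in(\ker A)^\perp$,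 $h_2\in\mathcal{H}$. For $\alpha>-1$, $T_B$ is the operator of multiplication by $B$ on $A^2_{\alpha,\mathcal{E}}$; it is a contraction. Define $$\mathcal{A}_\alpha(B)=\mathcal{M}\bigl((I-T_BT_B^* )^{1/2}\bigr),\qquad \mathcal{A}_\alpha(B^* )=\mathcal{M}\bigl((I-T_B^*T_B)^{1/2}\bigr).$$ For $a\in\mathbb{D}$ and a closed subspace $\mathcal{F}\subsetneq\mathcal{E}$ with orthogonal projection $P_{\mathcal{F}}$, the Blaschke-Potapov factor is $Q(z,a,\mathcal{F},\mathcal{E})=\varphi_a(z)(I_{\mathcal{E}}-P_{\mathcal{F}})+P_{\mathcal{F}}$, where $\varphi_a(z)=\frac{z-a}{1-\overline{a}z}$. $B$ is a finite Blaschke-Potapov product if there are finitely many closed subspaces $\mathcal{F}_i\subsetneq\mathcal{E}$, points $a_i\in\mathbb{D}$, $i=1,\dots,n$, and a unitary operator $U\in L(\mathcal{E})$ such that $B(z)=U\prod_{i=1}^nQ(z,a_i,\mathcal{F}_i,\mathcal{E})$. *)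

theory Defs
  imports "HOL-Analysis.Analysis" "HOL-Library.Function_Algebras"
begin

section \<open>Complex Hilbert spaces with explicit carrier\<close>

text \<open>
  The spaces \<open>A\<^sup>2\<^sub>\<beta>\<close> below depend on a real parameter, so Hilbert spaces are given by an explicit
  carrier. Addition is that of the ambient type; for function types it is pointwise
  (\<open>HOL-Library.Function_Algebras\<close>). The inner product is linear in its first argument.
\<close>

record 'v hspace =
  hcarrier :: "'v set"
  hscale :: "complex \<Rightarrow> 'v \<Rightarrow> 'v"
  hinner :: "'v \<Rightarrow> 'v \<Rightarrow> complex"

definition hnorm :: "'v hspace \<Rightarrow> 'v \<Rightarrow> real" where
  "hnorm H x = sqrt (Re (hinner H x x))"

text \<open>The locale \<open>Metric_space\<close> asks for a nonnegative symmetric distance on the whole type, hence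
  the value \<open>0\<close> off the carrier.\<close>

definition hdist :: "'v::ab_group_add hspace \<Rightarrow> 'v \<Rightarrow> 'v \<Rightarrow> real" where
  "hdist H x y = (if x \<in> hcarrier H \<and> y \<in> hcarrier H then hnorm H (x - y) else 0)"

abbreviation htop :: "'v::ab_group_add hspace \<Rightarrow> 'v topology" where
  "htop H \<equiv> Metric_space.mtopology (hcarrier H) (hdist H)"

locale complex_hilbert_space = vector_space "hscale H"
  for H :: "'v::ab_group_add hspace" +
  assumes carrier_subspace: "subspace (hcarrier H)"
    and inner_add: "\<lbrakk>x \<in> hcarrier H; y \<in> hcarrier H; z \<in> hcarrier H\<rbrakk>
      \<Longrightarrow> hinner H (x + y) z = hinner H x z + hinner H y z"
    and inner_scale: "\<lbrakk>x \<in> hcarrier H; y \<in> hcarrier H\<rbrakk>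
      \<Longrightarrow> hinner H (hscale H c x) y = c * hinner H x y"
    and inner_cnj: "\<lbrakk>x \<in> hcarrier H; y \<in> hcarrier H\<rbrakk> \<Longrightarrow> hinner H x y = cnj (hinner H y x)"
    and inner_nonneg: "x \<in> hcarrier H \<Longrightarrow> hinner H x x \<in> \<real>\<^sub>\<ge>\<^sub>0"
    and inner_definite: "\<lbrakk>x \<in> hcarrier H; hinner H x x = 0\<rbrakk> \<Longrightarrow> x = 0"
    and complete: "Metric_space.mcomplete (hcarrier H) (hdist H)"

definition infinite_dimensional :: "'v::ab_group_add hspace \<Rightarrow> bool" where
  "infinite_dimensional H \<longleftrightarrow> \<not> (\<exists>S. finite S \<and> module.span (hscale H) S = hcarrier H)"

definition hsums :: "'v::ab_group_add hspace \<Rightarrow> (nat \<Rightarrow> 'v) \<Rightarrow> 'v \<Rightarrow> bool" where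
  "hsums H u s \<longleftrightarrow> limitin (htop H) (\<lambda>N. \<Sum>n<N. u n) s sequentially"


section \<open>Bounded operators\<close>

text \<open>Operators are \<open>undefined\<close> outside the carrier of their domain, so that equality of operators
  is equality of functions.\<close>

definition bounded_ops ::
    "'v::ab_group_add hspace \<Rightarrow> 'w::ab_group_add hspace \<Rightarrow> ('v \<Rightarrow> 'w) set" where
  "bounded_ops H K = {T \<in> hcarrier H \<rightarrow>\<^sub>E hcarrier K.
     (\<forall>x\<in>hcarrier H. \<forall>y\<in>hcarrier H. T (x + y) = T x + T y) \<and>
     (\<forall>c. \<forall>x\<in>hcarrier H. T (hscale H c x) = hscale K c (T x)) \<and>
     (\<exists>C. \<forall>x\<in>hcarrier H. hnorm K (T x) \<le> C * hnorm H x)}"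

definition op_norm :: "'v hspace \<Rightarrow> 'w hspace \<Rightarrow> ('v \<Rightarrow> 'w) \<Rightarrow> real" where
  "op_norm H K T = (SUP x\<in>hcarrier H. hnorm K (T x) / hnorm H x)"

definition op_id :: "'v hspace \<Rightarrow> 'v \<Rightarrow> 'v" where
  "op_id H = (\<lambda>x\<in>hcarrier H. x)"

definition op_diff :: "'v hspace \<Rightarrow> ('v \<Rightarrow> 'w::ab_group_add) \<Rightarrow> ('v \<Rightarrow> 'w) \<Rightarrow> 'v \<Rightarrow> 'w" where
  "op_diff H S T = (\<lambda>x\<in>hcarrier H. S x - T x)"

definition adjoint_op ::
    "'v::ab_group_add hspace \<Rightarrow> 'w::ab_group_add hspace \<Rightarrow> ('v \<Rightarrow> 'w) \<Rightarrow> 'w \<Rightarrow> 'v" where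
  "adjoint_op H K T = (THE S. S \<in> bounded_ops K H \<and>
     (\<forall>x\<in>hcarrier H. \<forall>y\<in>hcarrier K. hinner K (T x) y = hinner H x (S y)))"

definition positive_op :: "'v::ab_group_add hspace \<Rightarrow> ('v \<Rightarrow> 'v) \<Rightarrow> bool" where
  "positive_op H T \<longleftrightarrow> T \<in> bounded_ops H H \<and> (\<forall>x\<in>hcarrier H. hinner H (T x) x \<in> \<real>\<^sub>\<ge>\<^sub>0)"

definition sqrt_op :: "'v::ab_group_add hspace \<Rightarrow> ('v \<Rightarrow> 'v) \<Rightarrow> 'v \<Rightarrow> 'v" where
  "sqrt_op H T = (THE R. positive_op H R \<and> compose (hcarrier H) R R = T)"

definition unitary_op :: "'v::ab_group_add hspace \<Rightarrow> ('v \<Rightarrow> 'v) \<Rightarrow> bool" where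
  "unitary_op H U \<longleftrightarrow> U \<in> bounded_ops H H \<and>
     compose (hcarrier H) (adjoint_op H H U) U = op_id H \<and>
     compose (hcarrier H) U (adjoint_op H H U) = op_id H"

definition closed_subspace :: "'v::ab_group_add hspace \<Rightarrow> 'v set \<Rightarrow> bool" where
  "closed_subspace H F \<longleftrightarrow> module.subspace (hscale H) F \<and> closedin (htop H) F"

definition orth_proj :: "'v::ab_group_add hspace \<Rightarrow> 'v set \<Rightarrow> 'v \<Rightarrow> 'v" where
  "orth_proj H F = (\<lambda>x\<in>hcarrier H. THE y. y \<in> F \<and> (\<forall>v\<in>F. hinner H (x - y) v = 0))"

text \<open>\<open>ker_perp_preimage H A u\<close> is the \<open>h\<close> in the orthogonal complement of \<open>ker A\<close> with \<open>A h = u\<close>;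
  in \<open>range_space\<close> this gives \<open>\<langle>A h\<^sub>1, A h\<^sub>2\<rangle> = \<langle>h\<^sub>1, h\<^sub>2\<rangle>\<close> whenever \<open>h\<^sub>1\<close> is orthogonal to \<open>ker A\<close>.\<close>

definition ker_perp_preimage ::
    "'v hspace \<Rightarrow> ('v \<Rightarrow> 'w::zero) \<Rightarrow> 'w \<Rightarrow> 'v" where
  "ker_perp_preimage H A u = (THE h. h \<in> hcarrier H \<and> A h = u \<and>
     (\<forall>k\<in>hcarrier H. A k = 0 \<longrightarrow> hinner H h k = 0))"

definition range_space ::
    "'v hspace \<Rightarrow> 'w::zero hspace \<Rightarrow> ('v \<Rightarrow> 'w) \<Rightarrow> 'w hspace" where
  "range_space H K A =
     \<lparr>hcarrier = A ` hcarrier H,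
      hscale = hscale K,
      hinner = (\<lambda>u v. hinner H (ker_perp_preimage H A u) (ker_perp_preimage H A v))\<rparr>"


section \<open>Weighted Bergman spaces\<close>

definition bergman_weight :: "real \<Rightarrow> nat \<Rightarrow> real" where
  "bergman_weight \<beta> n = Gamma (real n + \<beta> + 2) / (fact n * Gamma (\<beta> + 2))"

definition has_coeffs ::
    "'v::ab_group_add hspace \<Rightarrow> (complex \<Rightarrow> 'v) \<Rightarrow> (nat \<Rightarrow> 'v) \<Rightarrow> bool" where
  "has_coeffs E f a \<longleftrightarrow> (\<forall>n. a n \<in> hcarrier E) \<and>
     (\<forall>z\<in>ball 0 1. hsums E (\<lambda>n. hscale E (z ^ n) (a n)) (f z))"

definition coeffs :: "'v::ab_group_add hspace \<Rightarrow> (complex \<Rightarrow> 'v) \<Rightarrow> nat \<Rightarrow> 'v" where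
  "coeffs E f = (THE a. has_coeffs E f a)"

text \<open>A function on the unit disk is represented by its extension by \<open>0\<close> to \<open>\<complex>\<close>.\<close>

definition bergman_space :: "real \<Rightarrow> 'v::ab_group_add hspace \<Rightarrow> (complex \<Rightarrow> 'v) hspace" where
  "bergman_space \<beta> E =
     \<lparr>hcarrier = {f. (\<forall>z. z \<notin> ball 0 1 \<longrightarrow> f z = 0) \<and>
        (\<exists>a. has_coeffs E f a \<and> summable (\<lambda>n. (hnorm E (a n))\<^sup>2 / bergman_weight \<beta> n))},
      hscale = (\<lambda>c f z. hscale E c (f z)),
      hinner = (\<lambda>f g. \<Sum>n. hinner E (coeffs E f n) (coeffs E g n) / of_real (bergman_weight \<beta> n))\<rparr>"


section \<open>The spaces of a contractive operator-valued function\<close>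

definition op_analytic :: "'v::ab_group_add hspace \<Rightarrow> (complex \<Rightarrow> 'v \<Rightarrow> 'v) \<Rightarrow> bool" where
  "op_analytic E B \<longleftrightarrow> (\<forall>z\<in>ball 0 1. \<exists>D\<in>bounded_ops E E.
     ((\<lambda>w. op_norm E E (\<lambda>x\<in>hcarrier E. hscale E (1 / (w - z)) (B w x - B z x) - D x))
        \<longlongrightarrow> 0) (at z))"

definition Hinf_unit_ball :: "'v::ab_group_add hspace \<Rightarrow> (complex \<Rightarrow> 'v \<Rightarrow> 'v) set" where
  "Hinf_unit_ball E = {B. (\<forall>z\<in>ball 0 1. B z \<in> bounded_ops E E \<and> op_norm E E (B z) \<le> 1) \<and>
     op_analytic E B}"

definition mult_op ::
    "real \<Rightarrow> 'v::ab_group_add hspace \<Rightarrow> (complex \<Rightarrow> 'v \<Rightarrow> 'v) \<Rightarrow> (complex \<Rightarrow> 'v) \<Rightarrow> complex \<Rightarrow> 'v" where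
  "mult_op \<alpha> E B = (\<lambda>f\<in>hcarrier (bergman_space \<alpha> E). \<lambda>z. if z \<in> ball 0 1 then B z (f z) else 0)"

definition sub_bergman ::
    "real \<Rightarrow> 'v::ab_group_add hspace \<Rightarrow> (complex \<Rightarrow> 'v \<Rightarrow> 'v) \<Rightarrow> (complex \<Rightarrow> 'v) hspace" where
  "sub_bergman \<alpha> E B = (let H = bergman_space \<alpha> E; T = mult_op \<alpha> E B in
     range_space H H
       (sqrt_op H (op_diff H (op_id H) (compose (hcarrier H) T (adjoint_op H H T)))))"

definition sub_bergman_star ::
    "real \<Rightarrow> 'v::ab_group_add hspace \<Rightarrow> (complex \<Rightarrow> 'v \<Rightarrow> 'v) \<Rightarrow> (complex \<Rightarrow> 'v) hspace" where
  "sub_bergman_star \<alpha> E B = (let H = bergman_space \<alpha> E; T = mult_op \<alpha> E B in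
     range_space H H
       (sqrt_op H (op_diff H (op_id H) (compose (hcarrier H) (adjoint_op H H T) T))))"

definition same_elements :: "'v hspace \<Rightarrow> 'v hspace \<Rightarrow> bool" where
  "same_elements X Y \<longleftrightarrow> hcarrier X = hcarrier Y"


section \<open>Blaschke-Potapov products\<close>

definition blaschke_factor :: "complex \<Rightarrow> complex \<Rightarrow> complex" where
  "blaschke_factor a z = (z - a) / (1 - cnj a * z)"

definition bp_factor ::
    "'v::ab_group_add hspace \<Rightarrow> complex \<Rightarrow> 'v set \<Rightarrow> complex \<Rightarrow> 'v \<Rightarrow> 'v" where
  "bp_factor E a F z = (\<lambda>x\<in>hcarrier E.
     hscale E (blaschke_factor a z) (x - orth_proj E F x) + orth_proj E F x)"

text \<open>The factors are multiplied in the order of the list; the empty product is the identity.\<close>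

definition bp_prod ::
    "'v::ab_group_add hspace \<Rightarrow> (complex \<times> 'v set) list \<Rightarrow> complex \<Rightarrow> 'v \<Rightarrow> 'v" where
  "bp_prod E ps z = foldr (\<lambda>(a, F) T. compose (hcarrier E) (bp_factor E a F z) T) ps (op_id E)"

definition finite_blaschke_potapov ::
    "'v::ab_group_add hspace \<Rightarrow> (complex \<Rightarrow> 'v \<Rightarrow> 'v) \<Rightarrow> bool" where
  "finite_blaschke_potapov E B \<longleftrightarrow> (\<exists>U ps. unitary_op E U \<and>
     (\<forall>(a, F)\<in>set ps. a \<in> ball 0 1 \<and> closed_subspace E F \<and> F \<subset> hcarrier E) \<and>
     (\<forall>z\<in>ball 0 1. B z = compose (hcarrier E) U (bp_prod E ps z)))"

end

theory Submission
  imports Defs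
begin

text \<open>
  The example is diagonal: \<open>\<E> = \<ell>\<^sup>2\<close> and \<open>B(z) = diag (\<phi>\<^bsub>a\<^esub>(z))\<close> over
  the infinitely many distinct real points \<open>a = a\<^sub>k = 1/(k + 4)\<close>. It is not a finite
  Blaschke-Potapov product, since such a product is injective away from its finitely many points,
  whereas \<open>B(a\<^sub>k)\<close> kills the \<open>k\<close>-th basis vector for every \<open>k\<close>
  (\<open>diag_blaschke_not_bp\<close>).

  For one scalar Blaschke factor the two ranges are known to be \<open>A\<^sup>2\<^bsub>\<alpha>-1\<^esub>\<close>, with
  constants that stay bounded as long as \<open>a\<close> stays in a compact subset of the disk. This
  uniformity is what survives the infinite direct sum, and it has a short operator proof. Let
  \<open>S\<close> be the shift \<open>M\<^sub>z\<close> on \<open>A\<^sup>2\<^sub>\<alpha>\<close> and \<open>A\<close> the diagonal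
  operator of the points \<open>a\<^sub>k\<close>, which is self-adjoint, has norm at most \<open>1/4\<close> and commutes
  with \<open>S\<close> and \<open>S\<^sup>*\<close>. Then \<open>T\<^sub>B = (S - A)(1 - AS)\<^sup>-\<^sup>1\<close> and
  \<open>T\<^sub>B\<^sup>* = (S\<^sup>* - A)(1 - AS\<^sup>*)\<^sup>-\<^sup>1\<close>, and for
  \<open>x = (1 - AS)y\<close> the cross terms cancel:
  \<open>\<parallel>x\<parallel>\<^sup>2 - \<parallel>T\<^sub>B x\<parallel>\<^sup>2 = Q(y) - Q(Ay)\<close> with \<open>Q(y) = \<parallel>y\<parallel>\<^sup>2 - \<parallel>Sy\<parallel>\<^sup>2\<close>; the same
  holds for \<open>T\<^sub>B\<^sup>*\<close> with \<open>S\<^sup>*\<close> in place of \<open>S\<close>. Both forms \<open>Q\<close> are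
  diagonal in the monomials and comparable to the square of the norm \<open>\<parallel>\<cdot>\<parallel>\<^sub>v\<close> that has
  the weights of \<open>A\<^sup>2\<^sub>\<alpha>\<close> divided by \<open>n + 1\<close>. In this norm \<open>\<parallel>AS\<parallel>\<close> and
  \<open>\<parallel>AS\<^sup>*\<parallel>\<close> are at most \<open>1/2\<close>, for every \<open>\<alpha> > -1\<close>, so \<open>\<parallel>x\<parallel>\<^sub>v\<close> and \<open>\<parallel>y\<parallel>\<^sub>v\<close> are
  comparable and the two defect forms \<open>\<langle>(1 - T\<^sup>*T)x, x\<rangle>\<close> and
  \<open>\<langle>(1 - TT\<^sup>*)x, x\<rangle>\<close> are both comparable to \<open>\<parallel>x\<parallel>\<^sub>v\<^sup>2\<close>
  (\<open>mobius_defect_bounds\<close>).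

  By Douglas' argument, \<open>u\<close> lies in the range of the square root of a positive operator \<open>D\<close> iff
  \<open>|\<langle>u, x\<rangle>|\<^sup>2 \<le> c \<langle>Dx, x\<rangle>\<close> for some \<open>c\<close> and all \<open>x\<close>
  (\<open>range_sqrt_defect\<close>). So only the size of the defect forms matters, and \<open>u\<close> belongs to either
  range iff it is bounded against \<open>\<parallel>\<cdot>\<parallel>\<^sub>v\<close>, that is, iff its coefficients are
  square summable with the weights of \<open>A\<^sup>2\<^sub>\<alpha>\<close> multiplied by \<open>n + 1\<close>. Those
  are, up to bounded factors, the weights of \<open>A\<^sup>2\<^bsub>\<alpha>-1\<^esub>\<close>
  (\<open>bounded_against_form_iff\<close>).

  The spaces \<open>A\<^sup>2\<^sub>\<beta>\<close> are handled through their double arrays of coefficients, as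
  weighted \<open>\<ell>\<^sup>2\<close> spaces over \<open>\<nat> \<times> \<nat>\<close>: an index \<open>(n, k)\<close> stands for the \<open>k\<close>-th coordinate
  of the \<open>n\<close>-th coefficient.
\<close>


section \<open>Geometry of complex Hilbert spaces\<close>

text \<open>The first-order condition at a minimum, for the variation argument below.\<close>

lemma quadratic_nonneg_linear_coeff:
  fixes a b :: real
  assumes "\<And>t. 0 \<le> 2 * t * a + t\<^sup>2 * b"
  shows "a = 0"
proof (rule ccontr)
  assume "a \<noteq> 0"
  show False
  proof (cases "b \<le> 0")
    case True
    have "0 \<le> - 2 * a\<^sup>2 + a\<^sup>2 * b" using assms[of "-a"] by (simp add: power2_eq_square)
    moreover have "a\<^sup>2 > 0" "a\<^sup>2 * b \<le> 0" using \<open>a \<noteq> 0\<close> True by (auto simp: mult_nonneg_nonpos)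
    ultimately show False by linarith
  next
    case False
    have "0 \<le> 2 * (- a / b) * a + (- a / b)\<^sup>2 * b" by (rule assms)
    also have "\<dots> = - (a\<^sup>2 / b)" using False by (simp add: field_simps power2_eq_square)
    finally show False using False \<open>a \<noteq> 0\<close> by (simp add: divide_le_0_iff)
  qed
qed

text \<open>The axioms of \<open>complex_hilbert_space\<close> other than completeness, so that norm estimates are at
  hand while completeness is being proved.\<close>

locale complex_inner_space = vector_space "hscale H"
  for H :: "'v::ab_group_add hspace" +
  assumes carrier_subspace: "subspace (hcarrier H)"
    and inner_add: "\<lbrakk>x \<in> hcarrier H; y \<in> hcarrier H; z \<in> hcarrier H\<rbrakk>
      \<Longrightarrow> hinner H (x + y) z = hinner H x z + hinner H y z"
    and inner_scale: "\<lbrakk>x \<in> hcarrier H; y \<in> hcarrier H\<rbrakk>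
      \<Longrightarrow> hinner H (hscale H c x) y = c * hinner H x y"
    and inner_cnj: "\<lbrakk>x \<in> hcarrier H; y \<in> hcarrier H\<rbrakk> \<Longrightarrow> hinner H x y = cnj (hinner H y x)"
    and inner_nonneg: "x \<in> hcarrier H \<Longrightarrow> hinner H x x \<in> \<real>\<^sub>\<ge>\<^sub>0"
    and inner_definite: "\<lbrakk>x \<in> hcarrier H; hinner H x x = 0\<rbrakk> \<Longrightarrow> x = 0"
begin

abbreviation "carr \<equiv> hcarrier H"
abbreviation "sc \<equiv> hscale H"
abbreviation "ip \<equiv> hinner H"
abbreviation "nrm \<equiv> hnorm H"

lemma mem_zero [simp]: "0 \<in> carr"
  using carrier_subspace by (rule subspace_0)

lemma mem_add [simp]: "x \<in> carr \<Longrightarrow> y \<in> carr \<Longrightarrow> x + y \<in> carr"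
  using carrier_subspace by (rule subspace_add)

lemma mem_scale [simp]: "x \<in> carr \<Longrightarrow> sc c x \<in> carr"
  using carrier_subspace by (rule subspace_scale)

lemma mem_diff [simp]: "x \<in> carr \<Longrightarrow> y \<in> carr \<Longrightarrow> x - y \<in> carr"
  using carrier_subspace by (rule subspace_diff)

lemma mem_sum [simp]: "(\<And>i. i \<in> I \<Longrightarrow> u i \<in> carr) \<Longrightarrow> sum u I \<in> carr"
  using carrier_subspace by (rule subspace_sum)

lemma inner_add_right:
  assumes "x \<in> carr" "y \<in> carr" "z \<in> carr"
  shows "ip x (y + z) = ip x y + ip x z"
  using inner_cnj[of x "y + z"] inner_cnj[of x y] inner_cnj[of x z] inner_add[of y z x] assms
  by simp

lemma inner_scale_right:
  assumes "x \<in> carr" "y \<in> carr"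
  shows "ip x (sc c y) = cnj c * ip x y"
  using inner_cnj[of x "sc c y"] inner_cnj[of x y] inner_scale[of y x c] assms by simp

lemma inner_diff:
  assumes "x \<in> carr" "y \<in> carr" "z \<in> carr"
  shows "ip (x - y) z = ip x z - ip y z"
  using inner_add[of "x - y" y z] assms by simp

lemma inner_diff_right:
  assumes "x \<in> carr" "y \<in> carr" "z \<in> carr"
  shows "ip x (y - z) = ip x y - ip x z"
  using inner_add_right[of x "y - z" z] assms by simp

lemma inner_zero [simp]: "x \<in> carr \<Longrightarrow> ip 0 x = 0"
  using inner_diff[of x x x] by simp

lemma Re_inner_commute: "x \<in> carr \<Longrightarrow> y \<in> carr \<Longrightarrow> Re (ip y x) = Re (ip x y)"
  using inner_cnj[of x y] by simp

lemma Re_inner_self: "x \<in> carr \<Longrightarrow> 0 \<le> Re (ip x x)"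
  using inner_nonneg[of x] by (auto simp: nonneg_Reals_def)

lemma inner_self: "x \<in> carr \<Longrightarrow> ip x x = of_real ((nrm x)\<^sup>2)"
proof -
  assume "x \<in> carr"
  then obtain r where "0 \<le> r" "ip x x = of_real r"
    using inner_nonneg[of x] by (auto simp: nonneg_Reals_def)
  then show ?thesis by (simp add: hnorm_def)
qed

lemma norm_squared: "x \<in> carr \<Longrightarrow> (nrm x)\<^sup>2 = Re (ip x x)"
  by (simp add: inner_self)

lemma norm_nonneg [simp]: "x \<in> carr \<Longrightarrow> 0 \<le> nrm x"
  using Re_inner_self by (simp add: hnorm_def)

lemma norm_zero [simp]: "nrm 0 = 0"
  by (simp add: hnorm_def)

lemma norm_eq_0 [simp]: "x \<in> carr \<Longrightarrow> nrm x = 0 \<longleftrightarrow> x = 0"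
  using inner_self[of x] inner_definite[of x] by auto

lemma norm_scale:
  assumes "x \<in> carr"
  shows "nrm (sc c x) = cmod c * nrm x"
proof -
  have "ip (sc c x) (sc c x) = of_real ((cmod c * nrm x)\<^sup>2)"
    using assms inner_self[OF assms]
    by (simp add: inner_scale inner_scale_right power_mult_distrib complex_norm_square
        del: of_real_power)
  then show ?thesis
    using assms by (simp add: hnorm_def[of H "sc c x"] real_sqrt_abs)
qed

lemma norm_squared_diff:
  assumes "x \<in> carr" "y \<in> carr"
  shows "(nrm (x - y))\<^sup>2 = (nrm x)\<^sup>2 + (nrm y)\<^sup>2 - 2 * Re (ip x y)"
  using assms by (simp add: norm_squared inner_diff inner_diff_right Re_inner_commute)

lemma norm_squared_add:
  assumes "x \<in> carr" "y \<in> carr"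
  shows "(nrm (x + y))\<^sup>2 = (nrm x)\<^sup>2 + (nrm y)\<^sup>2 + 2 * Re (ip x y)"
  using assms by (simp add: norm_squared inner_add inner_add_right Re_inner_commute)

text \<open>Stated for semidefinite forms: besides the inner product it is applied to \<open>\<langle>T x, y\<rangle>\<close> for a
  positive operator \<open>T\<close>, where it shows that \<open>\<langle>T x, x\<rangle> = 0\<close> forces \<open>T x = 0\<close>.\<close>

lemma psd_form_Cauchy_Schwarz:
  fixes b :: "'v \<Rightarrow> 'v \<Rightarrow> complex"
  assumes add: "\<And>x y z. \<lbrakk>x \<in> carr; y \<in> carr; z \<in> carr\<rbrakk> \<Longrightarrow> b (x + y) z = b x z + b y z"
    and scale: "\<And>x y c. \<lbrakk>x \<in> carr; y \<in> carr\<rbrakk> \<Longrightarrow> b (sc c x) y = c * b x y"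
    and herm: "\<And>x y. \<lbrakk>x \<in> carr; y \<in> carr\<rbrakk> \<Longrightarrow> b x y = cnj (b y x)"
    and psd: "\<And>x. x \<in> carr \<Longrightarrow> 0 \<le> Re (b x x)"
    and x: "x \<in> carr" and y: "y \<in> carr"
  shows "(cmod (b x y))\<^sup>2 \<le> Re (b x x) * Re (b y y)"
proof -
  define m where "m = cmod (b x y)"
  have quad: "0 \<le> Re (b x x) + 2 * t * m + t\<^sup>2 * Re (b y y)" for t :: real
  proof -
    \<comment> \<open>The phase of \<open>c\<close> makes \<open>cnj c * b x y\<close> real.\<close>
    define c where "c = of_real t * sgn (b x y)"
    have 1: "cnj c * b x y = of_real (t * m)"
    proof -
      have "cnj (sgn (b x y)) * b x y = of_real m"
      proof -
        have "cnj (sgn (b x y)) * b x y = (b x y * cnj (b x y)) / of_real m"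
          by (simp add: m_def sgn_eq)
        also have "\<dots> = of_real m"
          unfolding complex_norm_square[symmetric] by (simp add: m_def power2_eq_square)
        finally show ?thesis .
      qed
      then show ?thesis by (simp add: c_def mult.assoc)
    qed
    have 2: "c * cnj c * b y y = of_real (t\<^sup>2 * Re (b y y))" if "b x y \<noteq> 0"
    proof -
      have "Im (b y y) = 0" using herm[OF y y] by (simp add: complex_eq_iff)
      then have "b y y = of_real (Re (b y y))" by (simp add: complex_eq_iff)
      moreover have "c * cnj c = of_real (t\<^sup>2)"
        using that complex_norm_square[of c] by (simp add: c_def norm_mult norm_sgn)
      ultimately show ?thesis by (metis of_real_mult)
    qed
    have "b (x + sc c y) (x + sc c y) = b x x + cnj c * b x y + c * b y x + c * cnj c * b y y"
    proof -
      have right: "b u (x + sc c y) = b u x + cnj c * b u y" if u: "u \<in> carr" for u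
        unfolding herm[OF u mem_add[OF x mem_scale[OF y]]] herm[OF u x] herm[OF u y]
        using x y u by (simp add: add scale)
      show ?thesis using x y by (simp add: add scale right algebra_simps)
    qed
    moreover have "c * b y x = cnj (cnj c * b x y)"
      using herm[OF y x] by simp
    ultimately have "Re (b (x + sc c y) (x + sc c y)) =
        Re (b x x) + 2 * t * m + Re (c * cnj c * b y y)"
      using 1 by simp
    moreover have "Re (c * cnj c * b y y) \<le> t\<^sup>2 * Re (b y y)"
    proof (cases "b x y = 0")
      case True
      then show ?thesis using psd[OF y] by (simp add: c_def)
    next
      case False
      then show ?thesis using 2 by simp
    qed
    ultimately show ?thesis using psd[of "x + sc c y"] x y by simp
  qed
  have nx: "0 \<le> Re (b x x)" and ny: "0 \<le> Re (b y y)" using psd x y by auto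
  have m: "0 \<le> m" by (simp add: m_def)
  show ?thesis
  proof (cases "Re (b y y) = 0")
    case True
    have "m = 0"
    proof (rule ccontr)
      assume "m \<noteq> 0"
      then have "m > 0" using m by simp
      have "2 * (- (Re (b x x) + 1) / m) * m = - 2 * (Re (b x x) + 1)"
        using \<open>m > 0\<close> by simp
      then show False using quad[of "- (Re (b x x) + 1) / m"] True nx by simp
    qed
    then show ?thesis using nx ny by (simp add: m_def)
  next
    case False
    then have pos: "Re (b y y) > 0" using ny by simp
    have "0 \<le> Re (b x x) - m\<^sup>2 / Re (b y y)"
      using quad[of "- m / Re (b y y)"] pos by (simp add: field_simps power2_eq_square)
    then show ?thesis using pos by (simp add: m_def field_simps)
  qed
qed

lemma Cauchy_Schwarz:
  assumes "x \<in> carr" "y \<in> carr"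
  shows "cmod (ip x y) \<le> nrm x * nrm y"
proof -
  have "(cmod (ip x y))\<^sup>2 \<le> Re (ip x x) * Re (ip y y)"
    by (rule psd_form_Cauchy_Schwarz)
      (use assms in \<open>auto intro: inner_add inner_scale inner_cnj Re_inner_self\<close>)
  then have "(cmod (ip x y))\<^sup>2 \<le> (nrm x * nrm y)\<^sup>2"
    using assms by (simp add: norm_squared power_mult_distrib)
  then show ?thesis
    using assms by (metis norm_nonneg mult_nonneg_nonneg power2_le_imp_le)
qed

lemma norm_triangle:
  assumes "x \<in> carr" "y \<in> carr"
  shows "nrm (x + y) \<le> nrm x + nrm y"
proof -
  have "Re (ip x y) \<le> nrm x * nrm y"
    using Cauchy_Schwarz[OF assms] complex_Re_le_cmod order_trans by blast
  then have "(nrm (x + y))\<^sup>2 \<le> (nrm x + nrm y)\<^sup>2"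
    using assms by (simp add: norm_squared_add power2_sum)
  then show ?thesis
    using assms by (meson norm_nonneg add_nonneg_nonneg power2_le_imp_le)
qed

lemma norm_minus_commute: "x \<in> carr \<Longrightarrow> y \<in> carr \<Longrightarrow> nrm (x - y) = nrm (y - x)"
  using norm_squared_diff[of x y] norm_squared_diff[of y x]
  by (smt (verit) Re_inner_commute norm_nonneg mem_diff power2_eq_iff_nonneg)

lemma norm_triangle_diff:
  assumes "x \<in> carr" "y \<in> carr"
  shows "nrm (x - y) \<le> nrm x + nrm y"
  using norm_triangle[of x "0 - y"] norm_minus_commute[of 0 y] mem_diff[of 0 y] assms by simp

lemma norm_triangle_diff2:
  assumes "x \<in> carr" "y \<in> carr"
  shows "nrm x \<le> nrm (x - y) + nrm y"
  using norm_triangle[of "x - y" y] assms by simp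

lemma inner_eqI:
  assumes "x \<in> carr" "x' \<in> carr" "\<And>y. y \<in> carr \<Longrightarrow> ip x y = ip x' y"
  shows "x = x'"
  using assms inner_definite[of "x - x'"] by (simp add: inner_diff)

lemma is_metric_space: "Metric_space carr (hdist H)"
proof
  fix x y z
  show "0 \<le> hdist H x y" by (simp add: hdist_def)
  show "hdist H x y = hdist H y x" by (simp add: hdist_def norm_minus_commute)
  assume "x \<in> carr" "y \<in> carr"
  then show "hdist H x y = 0 \<longleftrightarrow> x = y" by (simp add: hdist_def)
  assume "z \<in> carr"
  then show "hdist H x z \<le> hdist H x y + hdist H y z"
    using norm_triangle[of "x - y" "y - z"] \<open>x \<in> carr\<close> \<open>y \<in> carr\<close> by (simp add: hdist_def)
qed

lemma limitin_iff:
  assumes "\<And>n. u n \<in> carr"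
  shows "limitin (htop H) u s sequentially \<longleftrightarrow> s \<in> carr \<and> (\<lambda>n. nrm (u n - s)) \<longlonglongrightarrow> 0"
proof -
  interpret Metric_space carr "hdist H" by (rule is_metric_space)
  show ?thesis
    using assms unfolding limitin_metric
    by (auto simp: tendsto_iff hdist_def)
qed

lemma complex_hilbert_spaceI:
  assumes conv: "\<And>u. \<lbrakk>\<And>n. u n \<in> carr;
      \<And>\<epsilon>. \<epsilon> > 0 \<Longrightarrow> \<exists>N. \<forall>m\<ge>N. \<forall>n\<ge>N. nrm (u m - u n) < \<epsilon>\<rbrakk>
    \<Longrightarrow> \<exists>s\<in>carr. (\<lambda>n. nrm (u n - s)) \<longlonglongrightarrow> 0"
  shows "complex_hilbert_space H"
proof unfold_locales
  interpret Metric_space carr "hdist H" by (rule is_metric_space)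
  show "Metric_space.mcomplete carr (hdist H)"
    unfolding mcomplete_def
  proof (intro allI impI)
    fix u assume u: "MCauchy u"
    then have mem: "u n \<in> carr" for n by (auto simp: MCauchy_def)
    have "\<exists>N. \<forall>m\<ge>N. \<forall>n\<ge>N. nrm (u m - u n) < \<epsilon>" if "\<epsilon> > 0" for \<epsilon>
      using u that mem unfolding MCauchy_def hdist_def by auto
    then show "\<exists>s. limitin (htop H) u s sequentially"
      using conv[of u] mem by (auto simp: limitin_iff)
  qed
qed (use carrier_subspace in \<open>auto intro: inner_add inner_scale inner_cnj inner_nonneg inner_definite\<close>)

end

sublocale complex_hilbert_space \<subseteq> inner?: complex_inner_space
  by unfold_locales
    (use carrier_subspace in \<open>auto intro: inner_add inner_scale inner_cnj inner_nonneg inner_definite\<close>)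

context complex_hilbert_space
begin

lemma Cauchy_convergent:
  assumes u: "\<And>n. u n \<in> carr"
    and C: "\<And>\<epsilon>. \<epsilon> > 0 \<Longrightarrow> \<exists>N. \<forall>m\<ge>N. \<forall>n\<ge>N. nrm (u m - u n) < \<epsilon>"
  shows "\<exists>s\<in>carr. (\<lambda>n. nrm (u n - s)) \<longlonglongrightarrow> 0"
proof -
  interpret Metric_space carr "hdist H" by (rule is_metric_space)
  have "MCauchy u"
    unfolding MCauchy_def
  proof (intro conjI allI impI)
    show "range u \<subseteq> carr" using u by auto
    fix \<epsilon> :: real assume "\<epsilon> > 0"
    then obtain N where "\<forall>m\<ge>N. \<forall>n\<ge>N. nrm (u m - u n) < \<epsilon>" using C by blast
    then show "\<exists>N. \<forall>n n'. N \<le> n \<longrightarrow> N \<le> n' \<longrightarrow> hdist H (u n) (u n') < \<epsilon>"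
      using u by (auto simp: hdist_def intro!: exI[of _ N])
  qed
  then have "\<exists>s. limitin (htop H) u s sequentially"
    using complete by (simp add: mcomplete_def)
  then show ?thesis using limitin_iff[of u] u by blast
qed

lemma norm_sum_le:
  assumes "\<And>i. i \<in> I \<Longrightarrow> u i \<in> carr"
  shows "nrm (sum u I) \<le> (\<Sum>i\<in>I. nrm (u i))"
proof (cases "finite I")
  case True
  then show ?thesis using assms
  proof (induction I rule: finite_induct)
    case (insert i I)
    have "nrm (sum u (insert i I)) \<le> nrm (u i) + nrm (sum u I)"
      using insert by (simp add: norm_triangle)
    then show ?case using insert by (auto intro: order_trans)
  qed simp
qed simp

lemma abs_convergent:
  assumes u: "\<And>n. u n \<in> carr" and S: "summable (\<lambda>n. nrm (u n))"
  shows "\<exists>s\<in>carr. (\<lambda>N. nrm ((\<Sum>n<N. u n) - s)) \<longlonglongrightarrow> 0"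
proof (rule Cauchy_convergent)
  show "(\<Sum>n<N. u n) \<in> carr" for N using u by simp
  fix \<epsilon> :: real assume "\<epsilon> > 0"
  then obtain N where N: "\<And>m n. m \<ge> N \<Longrightarrow> norm (\<Sum>i=m..<n. nrm (u i)) < \<epsilon>"
    using S unfolding summable_Cauchy by blast
  have *: "nrm ((\<Sum>i<n. u i) - (\<Sum>i<m. u i)) < \<epsilon>" if "m \<ge> N" "n \<ge> m" for m n
  proof -
    have "(\<Sum>i<n. u i) - (\<Sum>i<m. u i) = (\<Sum>i=m..<n. u i)"
      using that sum_diff_nat_ivl[of 0 m n u] by (simp add: lessThan_atLeast0)
    then have "nrm ((\<Sum>i<n. u i) - (\<Sum>i<m. u i)) \<le> (\<Sum>i=m..<n. nrm (u i))"
      using norm_sum_le[of "{m..<n}" u] u by simp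
    then show ?thesis using N[OF that(1), of n] by simp
  qed
  show "\<exists>N. \<forall>m\<ge>N. \<forall>n\<ge>N. nrm ((\<Sum>i<m. u i) - (\<Sum>i<n. u i)) < \<epsilon>"
  proof (intro exI allI impI)
    fix m n assume "N \<le> m" "N \<le> n"
    then show "nrm ((\<Sum>i<m. u i) - (\<Sum>i<n. u i)) < \<epsilon>"
      using *[of m n] *[of n m] norm_minus_commute u by (cases "m \<le> n") (auto simp: norm_minus_commute)
  qed
qed

lemma inner_tendsto:
  assumes "\<And>n. u n \<in> carr" "s \<in> carr" "y \<in> carr" "(\<lambda>n. nrm (u n - s)) \<longlonglongrightarrow> 0"
  shows "(\<lambda>n. ip (u n) y) \<longlonglongrightarrow> ip s y"
proof -
  have "(\<lambda>n. ip (u n) y - ip s y) \<longlonglongrightarrow> 0"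
  proof (rule Lim_null_comparison)
    show "eventually (\<lambda>n. norm (ip (u n) y - ip s y) \<le> nrm (u n - s) * nrm y) sequentially"
      using assms Cauchy_Schwarz[of "_ - s" y] by (auto simp: inner_diff[symmetric])
    show "(\<lambda>n. nrm (u n - s) * nrm y) \<longlonglongrightarrow> 0"
      using tendsto_mult_right[OF assms(4), of "nrm y"] by simp
  qed
  then show ?thesis by (simp add: LIM_zero_iff)
qed

lemma limit_unique:
  assumes "\<And>n. u n \<in> carr" "s \<in> carr" "t \<in> carr"
    "(\<lambda>n. nrm (u n - s)) \<longlonglongrightarrow> 0" "(\<lambda>n. nrm (u n - t)) \<longlonglongrightarrow> 0"
  shows "s = t"
  using assms by (intro inner_eqI) (auto intro: LIMSEQ_unique inner_tendsto)

text \<open>A functional \<open>L\<close> dominated by \<open>\<parallel>R x\<parallel>\<close> factors through the closure of the range of \<open>R\<close>, where it is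
  represented by a vector \<open>h\<close>. The proof minimises \<open>\<parallel>R x\<parallel>\<^sup>2 - 2 Re (L x)\<close>: by the parallelogram
  law the images of a minimising sequence converge, and the limit satisfies the first-order condition.
  For \<open>R = id\<close> this is the Riesz representation theorem, for the inclusion of a closed subspace the
  projection theorem, and for the square root of a positive operator Douglas' range criterion.\<close>

lemma functional_through_map_represented:
  fixes R :: "'v \<Rightarrow> 'v" and L :: "'v \<Rightarrow> complex"
  assumes D: "subspace D"
    and Rm: "\<And>x. x \<in> D \<Longrightarrow> R x \<in> carr"
    and Ra: "\<And>x y. x \<in> D \<Longrightarrow> y \<in> D \<Longrightarrow> R (x + y) = R x + R y"
    and Rs: "\<And>c x. x \<in> D \<Longrightarrow> R (sc c x) = sc c (R x)"
    and La: "\<And>x y. x \<in> D \<Longrightarrow> y \<in> D \<Longrightarrow> L (x + y) = L x + L y"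
    and Ls: "\<And>c x. x \<in> D \<Longrightarrow> L (sc c x) = c * L x"
    and bd: "\<And>x. x \<in> D \<Longrightarrow> cmod (L x) \<le> K * nrm (R x)"
  obtains h \<xi> where "h \<in> carr" "\<And>n. \<xi> n \<in> D" "(\<lambda>n. nrm (R (\<xi> n) - h)) \<longlonglongrightarrow> 0"
    "\<And>x. x \<in> D \<Longrightarrow> L x = ip (R x) h"
proof -
  define J where "J x = (nrm (R x))\<^sup>2 - 2 * Re (L x)" for x
  have Dadd: "x + y \<in> D" if "x \<in> D" "y \<in> D" for x y
    using D that by (rule subspace_add)
  have Dsc: "sc c x \<in> D" if "x \<in> D" for x c
    using D that by (rule subspace_scale)
  have D0: "0 \<in> D" using D by (rule subspace_0)
  have lower: "- (K\<^sup>2) \<le> J x" if "x \<in> D" for x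
  proof -
    have "Re (L x) \<le> K * nrm (R x)" using bd[OF that] complex_Re_le_cmod[of "L x"] by linarith
    moreover have "0 \<le> (nrm (R x) - K)\<^sup>2" by simp
    ultimately show ?thesis by (simp add: J_def power2_diff algebra_simps)
  qed
  define m where "m = Inf (J ` D)"
  have bb: "bdd_below (J ` D)" using lower by (meson bdd_belowI2)
  have m: "m \<le> J x" if "x \<in> D" for x
    unfolding m_def using bb that by (intro cInf_lower) auto
  have "\<exists>x\<in>D. J x < m + 1 / real (Suc n)" for n
  proof -
    have "Inf (J ` D) < m + 1 / real (Suc n)" by (simp add: m_def)
    then show ?thesis using cInf_less_iff[of "J ` D"] bb D0 by auto
  qed
  then obtain \<xi> where \<xi>: "\<And>n. \<xi> n \<in> D" and J\<xi>: "\<And>n. J (\<xi> n) < m + 1 / real (Suc n)"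
    by metis
  \<comment> \<open>Parallelogram law: near-minimisers have nearby images.\<close>
  have par: "(nrm (R x - R y))\<^sup>2 \<le> 2 * (J x - m) + 2 * (J y - m)" if "x \<in> D" "y \<in> D" for x y
  proof -
    have "J (sc (1/2) (x + y)) = (1/4) * (nrm (R x + R y))\<^sup>2 - Re (L x) - Re (L y)"
    proof -
      have "R (sc (1/2) (x + y)) = sc (1/2) (R x + R y)" "L (sc (1/2) (x + y)) = (L x + L y) / 2"
        using that by (simp_all only: Rs Ls Ra La Dadd times_divide_eq_left mult_1)
      moreover from arg_cong[OF this(2), of Re] have "2 * Re (L (sc (1/2) (x + y))) = Re (L x) + Re (L y)"
        by simp
      ultimately show ?thesis
        unfolding J_def using that by (simp add: norm_scale Rm power_mult_distrib power2_eq_square)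
    qed
    then have "m \<le> (1/4) * (nrm (R x + R y))\<^sup>2 - Re (L x) - Re (L y)"
      using m[OF Dsc[OF Dadd[OF that]], of "1/2"] by simp
    then show ?thesis
      using norm_squared_add[OF Rm Rm, OF that] norm_squared_diff[OF Rm Rm, OF that]
      by (simp add: J_def) argo
  qed
  have "\<exists>h\<in>carr. (\<lambda>n. nrm (R (\<xi> n) - h)) \<longlonglongrightarrow> 0"
  proof (rule Cauchy_convergent)
    show "R (\<xi> n) \<in> carr" for n using \<xi> Rm by blast
    fix \<epsilon> :: real assume "\<epsilon> > 0"
    then obtain N where N: "1 / real (Suc N) < \<epsilon>\<^sup>2 / 4"
      by (metis nat_approx_posE zero_less_divide_iff zero_less_numeral zero_less_power)
    show "\<exists>N. \<forall>m\<ge>N. \<forall>n\<ge>N. nrm (R (\<xi> m) - R (\<xi> n)) < \<epsilon>"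
    proof (intro exI allI impI)
      fix p q assume pq: "N \<le> p" "N \<le> q"
      have "1 / real (Suc p) \<le> 1 / real (Suc N)" "1 / real (Suc q) \<le> 1 / real (Suc N)"
        using pq by (auto simp: frac_le)
      then have "(nrm (R (\<xi> p) - R (\<xi> q)))\<^sup>2 < \<epsilon>\<^sup>2"
        using par[OF \<xi> \<xi>, of p q] J\<xi>[of p] J\<xi>[of q] N by argo
      then show "nrm (R (\<xi> p) - R (\<xi> q)) < \<epsilon>"
        using \<open>\<epsilon> > 0\<close> by (simp add: power_less_imp_less_base)
    qed
  qed
  then obtain h where h: "h \<in> carr" and lim: "(\<lambda>n. nrm (R (\<xi> n) - h)) \<longlonglongrightarrow> 0" by blast
  have Jlim: "(\<lambda>n. J (\<xi> n)) \<longlonglongrightarrow> m"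
  proof (rule real_tendsto_sandwich)
    show "eventually (\<lambda>n. m \<le> J (\<xi> n)) sequentially" using m \<xi> by simp
    show "eventually (\<lambda>n. J (\<xi> n) \<le> m + 1 / real (Suc n)) sequentially"
      by (intro always_eventually allI less_imp_le J\<xi>)
    show "(\<lambda>n. m + 1 / real (Suc n)) \<longlonglongrightarrow> m"
      using tendsto_add[OF tendsto_const[of m] LIMSEQ_inverse_real_of_nat]
      by (simp add: inverse_eq_divide)
  qed simp
  have re: "Re (ip h (R y)) = Re (L y)" if y: "y \<in> D" for y
  proof -
    have "0 \<le> 2 * t * (Re (ip h (R y)) - Re (L y)) + t\<^sup>2 * (nrm (R y))\<^sup>2" for t :: real
    proof -
      have "m \<le> J (\<xi> n) + 2 * t * (Re (ip (R (\<xi> n)) (R y)) - Re (L y)) + t\<^sup>2 * (nrm (R y))\<^sup>2" for n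
        using m[OF Dadd[OF \<xi>[of n] Dsc[OF y, of "of_real t"]]] y \<xi>[of n]
        by (simp add: J_def Ra La Rs Ls Rm Dsc norm_squared_add inner_scale_right norm_scale
            power_mult_distrib algebra_simps)
      moreover have "(\<lambda>n. J (\<xi> n) + 2 * t * (Re (ip (R (\<xi> n)) (R y)) - Re (L y))
          + t\<^sup>2 * (nrm (R y))\<^sup>2)
        \<longlonglongrightarrow> m + 2 * t * (Re (ip h (R y)) - Re (L y)) + t\<^sup>2 * (nrm (R y))\<^sup>2"
        by (intro tendsto_intros Jlim inner_tendsto lim h Rm \<xi> y)
      ultimately have "m \<le> m + 2 * t * (Re (ip h (R y)) - Re (L y)) + t\<^sup>2 * (nrm (R y))\<^sup>2"
        by (intro LIMSEQ_le_const) auto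
      then show ?thesis by simp
    qed
    then show ?thesis using quadratic_nonneg_linear_coeff by fastforce
  qed
  have "L y = ip (R y) h" if y: "y \<in> D" for y
  proof -
    have "Im (ip h (R y)) = - Im (L y)"
      \<comment> \<open>The real parts at \<open>\<i> y\<close> are the imaginary parts at \<open>y\<close>.\<close>
      using re[OF Dsc[OF y, of \<i>]] y h by (simp add: Rs Ls Rm inner_scale_right)
    then show ?thesis
      using re[OF y] inner_cnj[OF Rm[OF y] h] by (simp add: complex_eq_iff)
  qed
  then show thesis using that h \<xi> lim by blast
qed

lemma Riesz_representation:
  fixes L :: "'v \<Rightarrow> complex"
  assumes "\<And>x y. x \<in> carr \<Longrightarrow> y \<in> carr \<Longrightarrow> L (x + y) = L x + L y"
    and "\<And>c x. x \<in> carr \<Longrightarrow> L (sc c x) = c * L x"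
    and "\<And>x. x \<in> carr \<Longrightarrow> cmod (L x) \<le> K * nrm x"
  shows "\<exists>h\<in>carr. \<forall>x\<in>carr. L x = ip x h"
  by (rule functional_through_map_represented[of carr "\<lambda>x. x" L K])
    (use assms carrier_subspace in auto)

lemma orth_proj_works:
  assumes F: "closed_subspace H F" and x: "x \<in> carr"
  shows "orth_proj H F x \<in> F" "\<And>v. v \<in> F \<Longrightarrow> ip (x - orth_proj H F x) v = 0"
proof -
  interpret M: Metric_space carr "hdist H" by (rule is_metric_space)
  have sub: "subspace F" and cl: "closedin (htop H) F"
    using F by (auto simp: closed_subspace_def)
  have Fc: "F \<subseteq> carr" using closedin_subset[OF cl] by simp
  obtain h \<xi> where h: "h \<in> carr" "\<And>n. \<xi> n \<in> F" "(\<lambda>n. nrm (\<xi> n - h)) \<longlonglongrightarrow> 0"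
    and rep: "\<And>v. v \<in> F \<Longrightarrow> ip v x = ip v h"
  proof (rule functional_through_map_represented[of F "\<lambda>v. v" "\<lambda>v. ip v x" "nrm x"])
    fix v assume "v \<in> F"
    then show "cmod (ip v x) \<le> nrm x * nrm v"
      using Cauchy_Schwarz[of v x] x Fc by (auto simp: mult.commute)
  qed (use sub Fc x in \<open>auto simp: inner_add inner_scale subset_iff\<close>)
  have "limitin (htop H) \<xi> h sequentially"
    using h Fc by (subst limitin_iff) auto
  then have hF: "h \<in> F"
    using cl h unfolding M.metric_closedin_iff_sequentially_closed by blast
  have orth: "ip (x - h) v = 0" if "v \<in> F" for v
    using rep[OF that] that Fc x h inner_cnj[of x v] inner_cnj[of h v]
    by (auto simp: inner_diff)
  have "\<exists>!y. y \<in> F \<and> (\<forall>v\<in>F. ip (x - y) v = 0)"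
  proof (rule ex1I[of _ h])
    show "h \<in> F \<and> (\<forall>v\<in>F. ip (x - h) v = 0)" using hF orth by blast
    fix y assume y: "y \<in> F \<and> (\<forall>v\<in>F. ip (x - y) v = 0)"
    then have yF: "y - h \<in> F" using hF sub subspace_diff by blast
    have "ip (x - y) (y - h) = 0" "ip (x - h) (y - h) = 0" using y yF orth by blast+
    then have "ip (y - h) (y - h) = 0"
      using inner_diff[of "x - h" "x - y" "y - h"] y x h Fc by auto
    then show "y = h" using inner_definite[of "y - h"] y h Fc by auto
  qed
  then have "orth_proj H F x \<in> F \<and> (\<forall>v\<in>F. ip (x - orth_proj H F x) v = 0)"
    unfolding orth_proj_def using x theI'[where P = "\<lambda>y. y \<in> F \<and> (\<forall>v\<in>F. ip (x - y) v = 0)"]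
    by simp
  then show "orth_proj H F x \<in> F" "\<And>v. v \<in> F \<Longrightarrow> ip (x - orth_proj H F x) v = 0" by auto
qed

lemma bounded_opsD:
  assumes "T \<in> bounded_ops H H"
  shows "\<And>x. x \<in> carr \<Longrightarrow> T x \<in> carr"
    "\<And>x y. \<lbrakk>x \<in> carr; y \<in> carr\<rbrakk> \<Longrightarrow> T (x + y) = T x + T y"
    "\<And>c x. x \<in> carr \<Longrightarrow> T (sc c x) = sc c (T x)"
    "\<And>x y. \<lbrakk>x \<in> carr; y \<in> carr\<rbrakk> \<Longrightarrow> T (x - y) = T x - T y"
    "T 0 = 0"
proof -
  show m: "\<And>x. x \<in> carr \<Longrightarrow> T x \<in> carr"
    and a: "\<And>x y. \<lbrakk>x \<in> carr; y \<in> carr\<rbrakk> \<Longrightarrow> T (x + y) = T x + T y"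
    and "\<And>c x. x \<in> carr \<Longrightarrow> T (sc c x) = sc c (T x)"
    using assms by (auto simp: bounded_ops_def)
  show d: "\<And>x y. \<lbrakk>x \<in> carr; y \<in> carr\<rbrakk> \<Longrightarrow> T (x - y) = T x - T y"
    using a by (metis mem_diff diff_add_cancel eq_diff_eq)
  show "T 0 = 0" using d[of 0 0] by simp
qed

lemma bounded_ops_bound:
  assumes "T \<in> bounded_ops H H"
  obtains K where "K \<ge> 0" "\<And>x. x \<in> carr \<Longrightarrow> nrm (T x) \<le> K * nrm x"
proof -
  obtain K where K: "\<And>x. x \<in> carr \<Longrightarrow> nrm (T x) \<le> K * nrm x"
    using assms unfolding bounded_ops_def by blast
  have "nrm (T x) \<le> \<bar>K\<bar> * nrm x" if "x \<in> carr" for x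
    using K[OF that] that norm_nonneg[OF that]
    by (meson abs_ge_self mult_right_mono order_trans)
  then show thesis using that[of "\<bar>K\<bar>"] abs_ge_zero by blast
qed

lemma bounded_ops_eqI:
  assumes "S \<in> bounded_ops H H" "T \<in> bounded_ops H H" "\<And>x. x \<in> carr \<Longrightarrow> S x = T x"
  shows "S = T"
  using assms PiE_ext[of S carr "\<lambda>_. carr" T] unfolding bounded_ops_def by auto

text \<open>Adjoints and square roots are both obtained from their sesquilinear forms, which avoids
  convergence of series of operators.\<close>

lemma bounded_form_represented:
  fixes b :: "'v \<Rightarrow> 'v \<Rightarrow> complex"
  assumes a1: "\<And>x y z. \<lbrakk>x \<in> carr; y \<in> carr; z \<in> carr\<rbrakk> \<Longrightarrow> b (x + y) z = b x z + b y z"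
    and s1: "\<And>x y c. \<lbrakk>x \<in> carr; y \<in> carr\<rbrakk> \<Longrightarrow> b (sc c x) y = c * b x y"
    and a2: "\<And>x y z. \<lbrakk>x \<in> carr; y \<in> carr; z \<in> carr\<rbrakk> \<Longrightarrow> b x (y + z) = b x y + b x z"
    and s2: "\<And>x y c. \<lbrakk>x \<in> carr; y \<in> carr\<rbrakk> \<Longrightarrow> b x (sc c y) = cnj c * b x y"
    and bd: "\<And>x y. \<lbrakk>x \<in> carr; y \<in> carr\<rbrakk> \<Longrightarrow> cmod (b x y) \<le> K * nrm x * nrm y"
  shows "\<exists>T\<in>bounded_ops H H. \<forall>x\<in>carr. \<forall>y\<in>carr. ip (T x) y = b x y"
proof -
  have "\<exists>h\<in>carr. \<forall>y\<in>carr. ip h y = b x y" if x: "x \<in> carr" for x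
  proof -
    have "\<exists>h\<in>carr. \<forall>y\<in>carr. cnj (b x y) = ip y h"
      by (rule Riesz_representation[of "\<lambda>y. cnj (b x y)" "K * nrm x"])
        (use x in \<open>auto simp: a2 s2 bd\<close>)
    then obtain h where h: "h \<in> carr" "\<And>y. y \<in> carr \<Longrightarrow> cnj (b x y) = ip y h" by blast
    then have "ip h y = b x y" if "y \<in> carr" for y
      using inner_cnj[OF h(1) that] that by (metis complex_cnj_cnj)
    then show ?thesis using h(1) by blast
  qed
  then obtain T0 where T0: "\<And>x. x \<in> carr \<Longrightarrow> T0 x \<in> carr"
    "\<And>x y. x \<in> carr \<Longrightarrow> y \<in> carr \<Longrightarrow> ip (T0 x) y = b x y"
    by metis
  define T where "T = restrict T0 carr"
  have T: "\<And>x. x \<in> carr \<Longrightarrow> T x \<in> carr"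
    "\<And>x y. x \<in> carr \<Longrightarrow> y \<in> carr \<Longrightarrow> ip (T x) y = b x y"
    using T0 by (auto simp: T_def)
  have "T \<in> bounded_ops H H"
    unfolding bounded_ops_def
  proof (intro CollectI conjI ballI allI)
    show "T \<in> carr \<rightarrow>\<^sub>E carr" using T0 by (auto simp: T_def)
    show "T (x + y) = T x + T y" if "x \<in> carr" "y \<in> carr" for x y
      using that T by (intro inner_eqI) (auto simp: inner_add a1)
    show "T (sc c x) = sc c (T x)" if "x \<in> carr" for x c
      using that T by (intro inner_eqI) (auto simp: inner_scale s1)
    show "\<exists>K. \<forall>x\<in>carr. nrm (T x) \<le> K * nrm x"
    proof (intro exI ballI)
      fix x assume x: "x \<in> carr"
      have "nrm (T x) * nrm (T x) \<le> (K * nrm x) * nrm (T x)"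
        using bd[OF x T(1)[OF x]] T(2)[OF x T(1)[OF x]] inner_self[OF T(1)[OF x]]
        by (metis norm_of_real abs_of_nonneg zero_le_power2 power2_eq_square)
      then have "nrm (T x) \<le> K * nrm x \<or> nrm (T x) = 0"
        using norm_nonneg[OF T(1)[OF x]] by (metis mult_right_le_imp_le order_le_less)
      moreover have "0 \<le> \<bar>K\<bar> * nrm x" "K * nrm x \<le> \<bar>K\<bar> * nrm x"
        using x by (auto intro: mult_right_mono)
      ultimately show "nrm (T x) \<le> \<bar>K\<bar> * nrm x" by linarith
    qed
  qed
  then show ?thesis using T by blast
qed

lemma adjoint_op_works:
  assumes T: "T \<in> bounded_ops H H"
  shows "adjoint_op H H T \<in> bounded_ops H H"
    "\<And>x y. \<lbrakk>x \<in> carr; y \<in> carr\<rbrakk> \<Longrightarrow> ip (T x) y = ip x (adjoint_op H H T y)"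
proof -
  note TD [simp] = bounded_opsD[OF T]
  obtain K where K: "K \<ge> 0" "\<And>x. x \<in> carr \<Longrightarrow> nrm (T x) \<le> K * nrm x"
    using bounded_ops_bound[OF T] by blast
  let ?P = "\<lambda>S. S \<in> bounded_ops H H \<and> (\<forall>x\<in>carr. \<forall>y\<in>carr. ip (T x) y = ip x (S y))"
  have "\<exists>S\<in>bounded_ops H H. \<forall>y\<in>carr. \<forall>x\<in>carr. ip (S y) x = ip y (T x)"
  proof (rule bounded_form_represented)
    fix y x assume "y \<in> carr" "x \<in> carr"
    then have "cmod (ip y (T x)) \<le> nrm y * nrm (T x)" by (simp add: Cauchy_Schwarz)
    also have "\<dots> \<le> nrm y * (K * nrm x)"
      using \<open>y \<in> carr\<close> \<open>x \<in> carr\<close> by (intro mult_left_mono K) auto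
    finally show "cmod (ip y (T x)) \<le> K * nrm y * nrm x" by (simp add: mult_ac)
  qed (auto simp: inner_add inner_scale inner_add_right inner_scale_right)
  then obtain S where S: "S \<in> bounded_ops H H"
    and adj: "\<And>x y. x \<in> carr \<Longrightarrow> y \<in> carr \<Longrightarrow> ip (S y) x = ip y (T x)" by blast
  have PS: "?P S"
  proof (intro conjI ballI S)
    fix x y assume "x \<in> carr" "y \<in> carr"
    then show "ip (T x) y = ip x (S y)"
      using adj inner_cnj[of "T x" y] inner_cnj[of x "S y"] bounded_opsD(1)[OF S] by simp
  qed
  have "\<exists>!S. ?P S"
  proof (rule ex1I[where P = ?P, OF PS])
    fix S' assume P': "?P S'"
    show "S' = S"
    proof (rule bounded_ops_eqI)
      fix y assume y: "y \<in> carr"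
      show "S' y = S y"
      proof (rule inner_eqI)
        fix x assume x: "x \<in> carr"
        have "ip x (S' y) = ip x (S y)"
          using P' PS x y by auto
        then show "ip (S' y) x = ip (S y) x"
          using x y P' S inner_cnj[of "S' y" x] inner_cnj[of "S y" x]
          by (auto simp: bounded_opsD(1))
      qed (use y P' S in \<open>auto simp: bounded_opsD(1)\<close>)
    qed (use P' S in auto)
  qed
  then have "?P (adjoint_op H H T)"
    unfolding adjoint_op_def by (rule theI')
  then show "adjoint_op H H T \<in> bounded_ops H H"
    "\<And>x y. \<lbrakk>x \<in> carr; y \<in> carr\<rbrakk> \<Longrightarrow> ip (T x) y = ip x (adjoint_op H H T y)" by auto
qed

lemma adjoint_op_eqI:
  assumes T: "T \<in> bounded_ops H H" and "y \<in> carr" "z \<in> carr"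
    and "\<And>x. x \<in> carr \<Longrightarrow> ip (T x) y = ip x z"
  shows "adjoint_op H H T y = z"
proof (rule inner_eqI)
  have m: "adjoint_op H H T y \<in> carr"
    using adjoint_op_works(1)[OF T] \<open>y \<in> carr\<close> by (simp add: bounded_opsD(1))
  then show "adjoint_op H H T y \<in> carr" .
  fix x assume "x \<in> carr"
  then show "ip (adjoint_op H H T y) x = ip z x"
    using assms(4)[of x] adjoint_op_works(2)[OF T _ \<open>y \<in> carr\<close>, of x] m \<open>z \<in> carr\<close>
      inner_cnj[of "adjoint_op H H T y" x] inner_cnj[of z x] by simp
qed (use assms in auto)

lemma adjoint_op_inner_left:
  assumes T: "T \<in> bounded_ops H H" and "x \<in> carr" "y \<in> carr"
  shows "ip (adjoint_op H H T y) x = ip y (T x)"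
  using adjoint_op_works(2)[OF T, of x y] assms(2,3) inner_cnj[of "adjoint_op H H T y" x]
    inner_cnj[of y "T x"] bounded_opsD(1)[OF T] bounded_opsD(1)[OF adjoint_op_works(1)[OF T]]
  by simp

lemma adjoint_op_contraction:
  assumes T: "T \<in> bounded_ops H H" and c: "\<And>x. x \<in> carr \<Longrightarrow> nrm (T x) \<le> nrm x"
    and y: "y \<in> carr"
  shows "nrm (adjoint_op H H T y) \<le> nrm y"
proof -
  let ?z = "adjoint_op H H T y"
  have z: "?z \<in> carr" using adjoint_op_works(1)[OF T] y by (simp add: bounded_opsD(1))
  have "(nrm ?z)\<^sup>2 = Re (ip (T ?z) y)"
    using adjoint_op_works(2)[OF T z y] z by (simp add: norm_squared)
  also have "\<dots> \<le> cmod (ip (T ?z) y)" by (rule complex_Re_le_cmod)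
  also have "\<dots> \<le> nrm (T ?z) * nrm y"
    using z y T by (simp add: Cauchy_Schwarz bounded_opsD(1))
  also have "\<dots> \<le> nrm ?z * nrm y" using c[OF z] y by (intro mult_right_mono) auto
  finally have "nrm ?z * nrm ?z \<le> nrm ?z * nrm y" by (simp add: power2_eq_square)
  then show ?thesis using norm_nonneg[OF z] norm_nonneg[OF y]
    by (metis mult_left_le_imp_le order_le_less)
qed

end


section \<open>Square roots of defect operators and their ranges\<close>

text \<open>The Taylor coefficients of \<open>\<surd>(1 - t)\<close> at \<open>0\<close>.\<close>

definition sqrt_coeff :: "nat \<Rightarrow> real" where
  "sqrt_coeff j = ((1/2) gchoose j) * (-1) ^ j"

lemma sqrt_coeff_pochhammer: "sqrt_coeff j = pochhammer (- (1/2)) j / fact j"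
proof -
  have "sqrt_coeff j = ((-1) ^ j * (-1) ^ j) * pochhammer (- (1/2)) j / fact j"
    unfolding sqrt_coeff_def gbinomial_pochhammer
    by (simp only: mult_ac times_divide_eq_right times_divide_eq_left)
  then show ?thesis by (simp only: minus_one_mult_self mult_1)
qed

lemma sqrt_coeff_0 [simp]: "sqrt_coeff 0 = 1"
  by (simp add: sqrt_coeff_def)

lemma sqrt_coeff_nonpos: "0 < j \<Longrightarrow> sqrt_coeff j \<le> 0"
proof -
  assume "0 < j"
  then obtain i where j: "j = Suc i" by (cases j) auto
  have "pochhammer (1/2 :: real) i \<ge> 0" by (rule pochhammer_nonneg) simp
  then show ?thesis by (simp add: sqrt_coeff_pochhammer j pochhammer_rec)
qed

text \<open>The partial sums are the Taylor coefficients of \<open>\<surd>(1 - t) / (1 - t) = 1 / \<surd>(1 - t)\<close>.\<close>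

lemma sqrt_coeff_sum_nonneg: "0 \<le> (\<Sum>j\<le>n. sqrt_coeff j)"
proof -
  have "(\<Sum>j\<le>n. sqrt_coeff j) = (-1) ^ n * ((1/2 - 1 :: real) gchoose n)"
    unfolding sqrt_coeff_def by (rule gbinomial_sum_lower_neg)
  also have "\<dots> = pochhammer (1/2) n / fact n"
    unfolding gbinomial_pochhammer times_divide_eq_right mult.assoc[symmetric] minus_one_mult_self
    by simp
  finally show ?thesis by (simp add: pochhammer_nonneg)
qed

text \<open>All coefficients but the first are nonpositive while the partial sums stay nonnegative; so the
  series converges absolutely even at \<open>t = 1\<close>, as is needed for contractions of norm one.\<close>

lemma sqrt_coeff_abs_sum: "(\<Sum>j<n. \<bar>sqrt_coeff j\<bar>) \<le> 2"
proof (cases n)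
  case (Suc m)
  \<comment> \<open>The term \<open>2\<close> at \<open>j = 0\<close> corrects the sign of the only positive coefficient.\<close>
  have "(\<Sum>j\<le>m. \<bar>sqrt_coeff j\<bar>) = (\<Sum>j\<le>m. (if j = 0 then 2 else 0) - sqrt_coeff j)"
    by (rule sum.cong) (use sqrt_coeff_nonpos in \<open>auto simp: abs_if order.order_iff_strict\<close>)
  also have "\<dots> = 2 - (\<Sum>j\<le>m. sqrt_coeff j)"
    by (simp add: sum_subtractf)
  finally show ?thesis using sqrt_coeff_sum_nonneg[of m] Suc by (simp add: lessThan_Suc_atMost)
qed simp

lemma summable_abs_sqrt_coeff: "summable (\<lambda>j. \<bar>sqrt_coeff j\<bar>)"
  by (rule summableI_nonneg_bounded[where x = 2]) (use sqrt_coeff_abs_sum in auto)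

lemma suminf_abs_sqrt_coeff: "(\<Sum>j. \<bar>sqrt_coeff j\<bar>) \<le> 2"
  by (rule suminf_le_const[OF summable_abs_sqrt_coeff]) (rule sqrt_coeff_abs_sum)

text \<open>Vandermonde's identity; in terms of power series, \<open>\<surd>(1 - t)\<close> squares to \<open>1 - t\<close>.\<close>

lemma sqrt_coeff_convolution:
  "(\<Sum>j\<le>n. sqrt_coeff j * sqrt_coeff (n - j)) = (if n = 0 then 1 else if n = 1 then -1 else 0)"
proof -
  have "(\<Sum>j\<le>n. sqrt_coeff j * sqrt_coeff (n - j))
      = (\<Sum>j\<le>n. ((1/2) gchoose j) * ((1/2) gchoose (n - j)) * (-1) ^ n)"
  proof (rule sum.cong)
    fix j assume "j \<in> {..n}"
    then have "(-1 :: real) ^ j * (-1) ^ (n - j) = (-1) ^ n"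
      by (metis atMost_iff le_add_diff_inverse power_add)
    then show "sqrt_coeff j * sqrt_coeff (n - j)
        = ((1/2) gchoose j) * ((1/2) gchoose (n - j)) * (-1) ^ n"
      unfolding sqrt_coeff_def by (simp add: mult_ac)
  qed simp
  also have "\<dots> = ((1 :: real) gchoose n) * (-1) ^ n"
    using gbinomial_Vandermonde[of "1/2 :: real" "1/2" n]
    by (simp add: sum_distrib_right[symmetric] atMost_atLeast0)
  also have "\<dots> = (if n = 0 then 1 else if n = 1 then -1 else 0)"
    using binomial_gbinomial[of 1 n, where ?'a = real]
    by (auto simp: binomial_eq_0)
  finally show ?thesis .
qed

text \<open>Rearranged by the value of \<open>i + j\<close>, the double series for
  \<open>(\<Sum>j. \<beta>\<^sub>j X\<^sup>j)\<^sup>2\<close> collapses to \<open>1 - X\<close>.\<close>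

lemma sqrt_coeff_double_series:
  fixes g :: "nat \<Rightarrow> complex"
  assumes g: "\<And>n. cmod (g n) \<le> K"
  shows "(\<Sum>j. of_real (sqrt_coeff j) * (\<Sum>i. of_real (sqrt_coeff i) * g (i + j))) = g 0 - g 1"
proof -
  define F :: "nat \<times> nat \<Rightarrow> complex" where
    "F = (\<lambda>(j, i). of_real (sqrt_coeff j * sqrt_coeff i) * g (i + j))"
  have abs1: "(\<lambda>j. \<bar>sqrt_coeff j\<bar>) summable_on UNIV"
    using summable_abs_sqrt_coeff
    by (simp add: summable_on_UNIV_nonneg_real_iff)
  have "(\<lambda>p. norm (F p)) summable_on UNIV \<times> UNIV"
  proof (rule abs_summable_iff_bdd_above[THEN iffD2])
    show "bdd_above (sum (\<lambda>p. norm (F p)) ` {A. A \<subseteq> UNIV \<times> UNIV \<and> finite A})"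
    proof (rule bdd_aboveI2)
      fix A :: "(nat \<times> nat) set" assume "A \<in> {A. A \<subseteq> UNIV \<times> UNIV \<and> finite A}"
      then have fA: "finite A" by simp
      obtain n where n: "fst ` A \<union> snd ` A \<subseteq> {..<n}"
        using fA by (metis finite_Un finite_imageI finite_nat_iff_bounded)
      then have "A \<subseteq> {..<n} \<times> {..<n}" by force
      then have "sum (\<lambda>p. norm (F p)) A \<le> sum (\<lambda>p. norm (F p)) ({..<n} \<times> {..<n})"
        by (intro sum_mono2) auto
      also have "\<dots> \<le> (\<Sum>(j, i)\<in>{..<n} \<times> {..<n}. \<bar>sqrt_coeff j\<bar> * \<bar>sqrt_coeff i\<bar> * K)"
        by (rule sum_mono) (use g in \<open>auto simp: F_def norm_mult mult_left_mono\<close>)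
      also have "\<dots> = (\<Sum>j<n. \<bar>sqrt_coeff j\<bar>) * (\<Sum>i<n. \<bar>sqrt_coeff i\<bar>) * K"
        by (subst sum_product) (simp only: sum_distrib_right sum.cartesian_product split_def)
      also have "\<dots> \<le> 2 * 2 * K"
        using order_trans[OF norm_ge_zero g[of 0]]
        by (intro mult_right_mono mult_mono sqrt_coeff_abs_sum) (auto intro: sum_nonneg)
      finally show "sum (\<lambda>p. norm (F p)) A \<le> 2 * 2 * K" .
    qed
  qed
  then have F: "F summable_on UNIV \<times> UNIV" by (rule abs_summable_summable)
  have inner: "(\<lambda>i. norm (of_real (sqrt_coeff i) * g (i + j))) summable_on UNIV" for j
  proof (rule summable_on_comparison_test)
    show "(\<lambda>i. K * \<bar>sqrt_coeff i\<bar>) summable_on UNIV"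
      using abs1 by (intro summable_on_cmult_right) simp
    show "norm (of_real (sqrt_coeff i) * g (i + j)) \<le> K * \<bar>sqrt_coeff i\<bar>" for i
      using mult_right_mono[OF g[of "i + j"], of "\<bar>sqrt_coeff i\<bar>"]
      by (simp add: norm_mult mult.commute)
  qed simp
  have suminf_inner: "(\<Sum>i. of_real (sqrt_coeff i) * g (i + j))
      = (\<Sum>\<^sub>\<infinity>i. of_real (sqrt_coeff i) * g (i + j))" for j
    using has_sum_imp_sums[OF has_sum_infsum[OF abs_summable_summable[OF inner]]]
    by (simp add: sums_iff)
  define G where "G j = of_real (sqrt_coeff j) * (\<Sum>i. of_real (sqrt_coeff i) * g (i + j))" for j
  have G: "G j = (\<Sum>\<^sub>\<infinity>i. F (j, i))" for j
    by (simp add: G_def suminf_inner F_def infsum_cmult_right' mult.assoc)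
  have "(G has_sum infsum F (UNIV \<times> UNIV)) UNIV"
  proof (rule has_sum_SigmaD[where f = F and B = "\<lambda>_. UNIV"])
    show "(F has_sum infsum F (UNIV \<times> UNIV)) (UNIV \<times> UNIV)" using F by (rule has_sum_infsum)
    fix j
    have "(\<lambda>i. F (j, i)) summable_on UNIV"
      using summable_on_cmult_right[OF abs_summable_summable[OF inner]]
      by (simp add: F_def mult.assoc)
    then show "((\<lambda>i. F (j, i)) has_sum G j) UNIV"
      by (simp add: G)
  qed
  then have suminf_G: "(\<Sum>j. G j) = infsum F (UNIV \<times> UNIV)"
    using has_sum_imp_sums sums_unique by metis
  let ?D = "SIGMA n : (UNIV :: nat set). {..n}"
  let ?F = "\<lambda>(n, j). F (j, n - j)"
  have reidx: "(?F has_sum infsum F (UNIV \<times> UNIV)) ?D"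
  proof -
    have "(?F has_sum infsum F (UNIV \<times> UNIV)) ?D
        \<longleftrightarrow> (F has_sum infsum F (UNIV \<times> UNIV)) (UNIV \<times> UNIV)"
      by (rule has_sum_reindex_bij_witness[where
            i = "\<lambda>(j, i). (i + j, j)" and j = "\<lambda>(n, j). (j, n - j)"]) auto
    then show ?thesis using F by simp
  qed
  define h :: "nat \<Rightarrow> complex" where
    "h n = of_real (if n = 0 then 1 else if n = 1 then -1 else 0) * g n" for n
  have "(h has_sum infsum F (UNIV \<times> UNIV)) UNIV"
  proof (rule has_sum_SigmaD[OF reidx])
    fix n :: nat
    have "(\<Sum>j\<le>n. F (j, n - j)) = (\<Sum>j\<le>n. of_real (sqrt_coeff j * sqrt_coeff (n - j)) * g n)"
      by (rule sum.cong) (auto simp: F_def)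
    also have "\<dots> = h n"
      by (simp only: sum_distrib_right[symmetric] of_real_sum[symmetric] sqrt_coeff_convolution h_def)
    finally show "((\<lambda>j. ?F (n, j)) has_sum h n) {..n}"
      by (intro has_sum_finiteI) auto
  qed
  moreover have "(h has_sum sum h {0, 1}) UNIV"
    by (rule has_sum_finite_neutralI[where B = "{0, 1}"]) (auto simp: h_def)
  ultimately have "infsum F (UNIV \<times> UNIV) = sum h {0, 1}"
    by (rule has_sum_unique)
  then show ?thesis using suminf_G by (simp add: G_def h_def)
qed

context complex_hilbert_space
begin

text \<open>By polarization, which needs complex scalars.\<close>

lemma self_adjoint_if_real_form:
  assumes T: "T \<in> bounded_ops H H" and re: "\<And>x. x \<in> carr \<Longrightarrow> Im (ip (T x) x) = 0"
    and x: "x \<in> carr" and y: "y \<in> carr"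
  shows "ip (T x) y = ip x (T y)"
proof -
  note TD [simp] = bounded_opsD[OF T]
  define b where "b u v = ip (T u) v - ip u (T v)" for u v
  have b0: "b u u = 0" if "u \<in> carr" for u
  proof -
    have "ip u (T u) = cnj (ip (T u) u)" using that by (intro inner_cnj) auto
    then show ?thesis using re[OF that] by (simp add: b_def complex_eq_iff)
  qed
  have "b (x + sc c y) (x + sc c y) = b x x + cnj c * b x y + c * b y x + c * cnj c * b y y" for c
    using x y by (simp add: b_def inner_add inner_add_right inner_scale inner_scale_right
        algebra_simps)
  then have *: "cnj c * b x y + c * b y x = 0" for c
    using b0[of "x + sc c y"] b0[OF x] b0[OF y] x y by simp
  have "b x y = 0"
    using *[of 1] *[of \<i>] by (simp add: complex_eq_iff)
  then show ?thesis by (simp add: b_def)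
qed

lemma positive_op_self_adjoint:
  assumes "positive_op H T" "x \<in> carr" "y \<in> carr"
  shows "ip (T x) y = ip x (T y)"
  using assms by (intro self_adjoint_if_real_form)
    (auto simp: positive_op_def nonneg_Reals_def complex_is_Real_iff)

lemma positive_opD:
  assumes "positive_op H T"
  shows "T \<in> bounded_ops H H" "\<And>x. x \<in> carr \<Longrightarrow> 0 \<le> Re (ip (T x) x)"
  using assms by (auto simp: positive_op_def nonneg_Reals_def)

lemma positive_op_kernel:
  assumes T: "positive_op H T" and x: "x \<in> carr" and z: "Re (ip (T x) x) = 0"
  shows "T x = 0"
proof -
  note TD [simp] = bounded_opsD[OF positive_opD(1)[OF T]]
  have "(cmod (ip (T x) y))\<^sup>2 \<le> Re (ip (T x) x) * Re (ip (T y) y)" if y: "y \<in> carr" for y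
  proof (rule psd_form_Cauchy_Schwarz[of "\<lambda>x y. ip (T x) y"])
    show "ip (T u) v = cnj (ip (T v) u)" if "u \<in> carr" "v \<in> carr" for u v
      using positive_op_self_adjoint[OF T] that inner_cnj[of u "T v"] by simp
  qed (use x y positive_opD(2)[OF T] in \<open>auto simp: inner_add inner_scale\<close>)
  then have "ip (T x) y = ip 0 y" if "y \<in> carr" for y
    using that z by simp
  then show ?thesis using x by (intro inner_eqI) auto
qed

end

text \<open>Square roots are needed only for \<open>I - X\<close> with a positive contraction \<open>X\<close>, where the binomial
  series applies.\<close>

locale positive_contraction = complex_hilbert_space H
  for H :: "'v::ab_group_add hspace" +
  fixes X :: "'v \<Rightarrow> 'v"
  assumes positive: "positive_op H X"
    and contraction: "x \<in> hcarrier H \<Longrightarrow> hnorm H (X x) \<le> hnorm H x"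
begin

abbreviation "defect \<equiv> op_diff H (op_id H) X"

lemmas X_bounded = positive_opD(1)[OF positive]
lemmas X_simps [simp] = bounded_opsD[OF X_bounded]

lemma defect_apply: "x \<in> carr \<Longrightarrow> defect x = x - X x"
  by (simp add: op_diff_def op_id_def)

lemma power_mem [simp]: "x \<in> carr \<Longrightarrow> (X ^^ j) x \<in> carr"
  by (induction j) auto

lemma power_add: "x \<in> carr \<Longrightarrow> y \<in> carr \<Longrightarrow> (X ^^ j) (x + y) = (X ^^ j) x + (X ^^ j) y"
  by (induction j) auto

lemma power_scale: "x \<in> carr \<Longrightarrow> (X ^^ j) (sc c x) = sc c ((X ^^ j) x)"
  by (induction j) auto

lemma power_contraction: "x \<in> carr \<Longrightarrow> nrm ((X ^^ j) x) \<le> nrm x"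
  by (induction j) (auto intro: order_trans[OF contraction])

lemma power_self_adjoint: "x \<in> carr \<Longrightarrow> y \<in> carr \<Longrightarrow> ip ((X ^^ j) x) y = ip x ((X ^^ j) y)"
  by (induction j arbitrary: x y)
    (auto simp: positive_op_self_adjoint[OF positive] funpow_swap1)

lemma power_inner_bound:
  assumes "x \<in> carr" "y \<in> carr"
  shows "cmod (ip ((X ^^ j) x) y) \<le> nrm x * nrm y"
  using Cauchy_Schwarz[of "(X ^^ j) x" y] power_contraction[of x j] assms
  by (meson norm_nonneg mult_right_mono order_trans power_mem)

text \<open>The form \<open>\<langle>R x, y\<rangle>\<close> of the operator \<open>R = (\<Sum>j. \<beta>\<^sub>j X\<^sup>j)\<close>, with
  \<open>\<beta>\<^sub>j\<close> the coefficients of \<open>\<surd>(1 - t)\<close>; see \<open>sqrt_of_defect_exists\<close>.\<close>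

definition sqrt_form :: "'v \<Rightarrow> 'v \<Rightarrow> complex" where
  "sqrt_form x y = (\<Sum>j. of_real (sqrt_coeff j) * ip ((X ^^ j) x) y)"

lemma sqrt_form_term_bound:
  assumes "x \<in> carr" "y \<in> carr"
  shows "norm (of_real (sqrt_coeff j) * ip ((X ^^ j) x) y) \<le> \<bar>sqrt_coeff j\<bar> * (nrm x * nrm y)"
  using power_inner_bound[OF assms, of j] by (simp add: norm_mult mult_left_mono)

lemma sqrt_form_abs_summable:
  assumes "x \<in> carr" "y \<in> carr"
  shows "summable (\<lambda>j. norm (of_real (sqrt_coeff j) * ip ((X ^^ j) x) y))"
  by (rule summable_comparison_test'[where g = "\<lambda>j. \<bar>sqrt_coeff j\<bar> * (nrm x * nrm y)" and N = 0])
    (use sqrt_form_term_bound[OF assms] in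
      \<open>auto intro: summable_mult2 summable_abs_sqrt_coeff simp del: norm_mult\<close>)

lemma sqrt_form_summable:
  assumes "x \<in> carr" "y \<in> carr"
  shows "summable (\<lambda>j. of_real (sqrt_coeff j) * ip ((X ^^ j) x) y)"
  using sqrt_form_abs_summable[OF assms] by (rule summable_norm_cancel)

lemma sqrt_form_bound:
  assumes "x \<in> carr" "y \<in> carr"
  shows "cmod (sqrt_form x y) \<le> 2 * nrm x * nrm y"
proof -
  have "cmod (sqrt_form x y) \<le> (\<Sum>j. norm (of_real (sqrt_coeff j) * ip ((X ^^ j) x) y))"
    unfolding sqrt_form_def by (rule summable_norm[OF sqrt_form_abs_summable[OF assms]])
  also have "\<dots> \<le> (\<Sum>j. \<bar>sqrt_coeff j\<bar> * (nrm x * nrm y))"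
    by (rule suminf_le[OF sqrt_form_term_bound[OF assms] sqrt_form_abs_summable[OF assms]])
      (intro summable_mult2 summable_abs_sqrt_coeff)
  also have "\<dots> = (\<Sum>j. \<bar>sqrt_coeff j\<bar>) * (nrm x * nrm y)"
    by (rule suminf_mult2[symmetric, OF summable_abs_sqrt_coeff])
  also have "\<dots> \<le> 2 * (nrm x * nrm y)"
    using assms by (intro mult_right_mono suminf_abs_sqrt_coeff) auto
  finally show ?thesis by simp
qed

text \<open>Positivity holds because \<open>\<langle>R x, x\<rangle> \<ge> (\<Sum>j\<le>m. \<beta>\<^sub>j) \<parallel>x\<parallel>\<^sup>2\<close> in the limit:
  the later \<open>\<beta>\<^sub>j\<close> are nonpositive and \<open>\<langle>X\<^sup>j x, x\<rangle> \<le> \<parallel>x\<parallel>\<^sup>2\<close>.\<close>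

lemma sqrt_of_defect_exists:
  obtains R where "positive_op H R" "compose carr R R = defect"
    "\<And>x y. x \<in> carr \<Longrightarrow> y \<in> carr \<Longrightarrow> ip (R x) y = sqrt_form x y"
proof -
  have "\<exists>R\<in>bounded_ops H H. \<forall>x\<in>carr. \<forall>y\<in>carr. ip (R x) y = sqrt_form x y"
  proof (rule bounded_form_represented[where K = 2])
    show "sqrt_form (x + y) z = sqrt_form x z + sqrt_form y z"
      if "x \<in> carr" "y \<in> carr" "z \<in> carr" for x y z
      using that unfolding sqrt_form_def
      by (subst suminf_add[OF sqrt_form_summable sqrt_form_summable])
        (auto simp: power_add inner_add algebra_simps)
    show "sqrt_form x (y + z) = sqrt_form x y + sqrt_form x z"
      if "x \<in> carr" "y \<in> carr" "z \<in> carr" for x y z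
      using that unfolding sqrt_form_def
      by (subst suminf_add[OF sqrt_form_summable sqrt_form_summable])
        (auto simp: inner_add_right algebra_simps)
    show "sqrt_form (sc c x) y = c * sqrt_form x y" if "x \<in> carr" "y \<in> carr" for x y c
      using that unfolding sqrt_form_def
      by (subst suminf_mult[symmetric, OF sqrt_form_summable])
        (auto simp: power_scale inner_scale algebra_simps)
    show "sqrt_form x (sc c y) = cnj c * sqrt_form x y" if "x \<in> carr" "y \<in> carr" for x y c
      using that unfolding sqrt_form_def
      by (subst suminf_mult[symmetric, OF sqrt_form_summable])
        (auto simp: inner_scale_right algebra_simps)
  qed (rule sqrt_form_bound)
  then obtain R where R: "R \<in> bounded_ops H H"
    and form: "\<And>x y. x \<in> carr \<Longrightarrow> y \<in> carr \<Longrightarrow> ip (R x) y = sqrt_form x y" by blast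
  note RD [simp] = bounded_opsD[OF R]
  have pos: "ip (R x) x \<in> \<real>\<^sub>\<ge>\<^sub>0" if x: "x \<in> carr" for x
  proof -
    have real: "ip ((X ^^ j) x) x = of_real (Re (ip ((X ^^ j) x) x))" for j
      using power_self_adjoint[OF x x, of j] inner_cnj[of x "(X ^^ j) x"] x
      by (simp add: complex_eq_iff)
    let ?r = "\<lambda>j. sqrt_coeff j * Re (ip ((X ^^ j) x) x)"
    have term_eq: "of_real (sqrt_coeff j) * ip ((X ^^ j) x) x = of_real (?r j)" for j
      by (subst real) simp
    have sr: "summable ?r"
      using sqrt_form_summable[OF x x] unfolding term_eq by (simp only: summable_of_real_iff)
    have form_eq: "ip (R x) x = of_real (\<Sum>j. ?r j)"
      unfolding form[OF x x] sqrt_form_def term_eq by (rule suminf_of_real[OF sr, symmetric])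
    have "0 \<le> (\<Sum>j<n. ?r j)" for n
    proof (cases n)
      case (Suc m)
      have "(\<Sum>j\<le>m. sqrt_coeff j * (nrm x)\<^sup>2) \<le> (\<Sum>j\<le>m. ?r j)"
      proof (rule sum_mono)
        fix j
        have "Re (ip ((X ^^ j) x) x) \<le> (nrm x)\<^sup>2"
          using power_inner_bound[OF x x, of j] complex_Re_le_cmod[of "ip ((X ^^ j) x) x"]
          by (simp add: power2_eq_square)
        then show "sqrt_coeff j * (nrm x)\<^sup>2 \<le> ?r j"
          using sqrt_coeff_nonpos[of j] x
          by (cases "j = 0") (auto simp: norm_squared intro: mult_left_mono_neg)
      qed
      moreover have "0 \<le> (\<Sum>j\<le>m. sqrt_coeff j * (nrm x)\<^sup>2)"
        using sqrt_coeff_sum_nonneg[of m] by (simp flip: sum_distrib_right)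
      ultimately show ?thesis using Suc by (simp add: lessThan_Suc_atMost)
    qed simp
    then have "0 \<le> (\<Sum>j. ?r j)"
      using summable_LIMSEQ[OF sr] LIMSEQ_le_const by blast
    then show ?thesis by (simp add: form_eq)
  qed
  then have posR: "positive_op H R" using R by (simp add: positive_op_def)
  have "R (R x) = x - X x" if x: "x \<in> carr" for x
  proof (rule inner_eqI)
    fix y assume y: "y \<in> carr"
    have "ip (R (R x)) y = (\<Sum>j. of_real (sqrt_coeff j) * ip ((X ^^ j) (R x)) y)"
      using x y by (simp add: form[of "R x"] sqrt_form_def)
    also have "\<dots> = (\<Sum>j. of_real (sqrt_coeff j) *
        (\<Sum>i. of_real (sqrt_coeff i) * ip ((X ^^ (i + j)) x) y))"
    proof (intro arg_cong[where f = suminf] ext arg_cong2[where f = "(*)"] refl)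
      fix j
      have "ip ((X ^^ j) (R x)) y = sqrt_form x ((X ^^ j) y)"
        using x y by (simp add: power_self_adjoint form)
      also have "\<dots> = (\<Sum>i. of_real (sqrt_coeff i) * ip ((X ^^ (i + j)) x) y)"
        using x y unfolding sqrt_form_def
        by (simp add: power_self_adjoint[symmetric] add.commute[of _ j] funpow_add)
      finally show "ip ((X ^^ j) (R x)) y
          = (\<Sum>i. of_real (sqrt_coeff i) * ip ((X ^^ (i + j)) x) y)" .
    qed
    also have "\<dots> = ip ((X ^^ 0) x) y - ip ((X ^^ 1) x) y"
      by (rule sqrt_coeff_double_series) (rule power_inner_bound[OF x y])
    finally show "ip (R (R x)) y = ip (x - X x) y"
      using x y by (simp add: inner_diff)
  qed (use x in auto)
  then have "compose carr R R = defect"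
    by (auto simp: fun_eq_iff compose_def op_diff_def op_id_def)
  then show thesis using that posR form by blast
qed

text \<open>Uniqueness: another positive root \<open>S\<close> commutes with \<open>X = 1 - S\<^sup>2\<close>, hence with \<open>R\<close>, so
  \<open>(R + S)(R - S) = R\<^sup>2 - S\<^sup>2 = 0\<close>. For \<open>u = (R - S) x\<close> this gives \<open>\<langle>R u, u\<rangle> + \<langle>S u, u\<rangle> = 0\<close>, so
  that \<open>R u = S u = 0\<close> and then \<open>\<langle>u, u\<rangle> = \<langle>x, (R - S) u\<rangle> = 0\<close>.\<close>

lemma sqrt_op_works:
  "positive_op H (sqrt_op H defect)" "compose carr (sqrt_op H defect) (sqrt_op H defect) = defect"
proof -
  obtain R where R: "positive_op H R" "compose carr R R = defect"
    and form: "\<And>x y. x \<in> carr \<Longrightarrow> y \<in> carr \<Longrightarrow> ip (R x) y = sqrt_form x y"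
    using sqrt_of_defect_exists by blast
  note RD [simp] = bounded_opsD[OF positive_opD(1)[OF R(1)]]
  have "\<exists>!R. positive_op H R \<and> compose carr R R = defect"
  proof (rule ex1I[of _ R])
    show "positive_op H R \<and> compose carr R R = defect" using R by blast
    fix S assume S: "positive_op H S \<and> compose carr S S = defect"
    note SD [simp] = bounded_opsD[OF positive_opD(1)[OF conjunct1[OF S]]]
    have RR: "R (R x) = x - X x" and SS: "S (S x) = x - X x" if "x \<in> carr" for x
      using R(2) S that by (metis compose_eq defect_apply)+
    have XS: "X (S x) = S (X x)" if "x \<in> carr" for x
    proof -
      have "S x - X (S x) = S (x - X x)"
        using SS[of "S x"] SS[of x] that by simp
      then show ?thesis using that by simp
    qed
    have XSj: "(X ^^ j) (S x) = S ((X ^^ j) x)" if "x \<in> carr" for x j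
      using that by (induction j) (auto simp: XS)
    have comm: "R (S x) = S (R x)" if x: "x \<in> carr" for x
    proof (rule inner_eqI)
      fix y assume y: "y \<in> carr"
      have "ip (R (S x)) y = sqrt_form x (S y)"
        using x y S unfolding form[OF SD(1)[OF x] y] sqrt_form_def
        by (simp add: XSj positive_op_self_adjoint)
      also have "\<dots> = ip (S (R x)) y"
        using x y S by (simp add: form[symmetric] positive_op_self_adjoint[of S])
      finally show "ip (R (S x)) y = ip (S (R x)) y" .
    qed (use x in auto)
    show "S = R"
    proof (rule bounded_ops_eqI)
      fix x assume x: "x \<in> carr"
      define u where "u = R x - S x"
      have u: "u \<in> carr" using x by (simp add: u_def)
      have "R u + S u = 0"
        using x by (simp add: u_def comm RR SS)
      then have "ip (R u) u + ip (S u) u = 0"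
        using inner_add[of "R u" "S u" u] u by simp
      then have "Re (ip (R u) u) + Re (ip (S u) u) = 0"
        by (metis plus_complex.sel(1) zero_complex.sel(1))
      moreover have "Re (ip (R u) u) \<ge> 0" "Re (ip (S u) u) \<ge> 0"
        using u R S positive_opD(2) by blast+
      ultimately have "R u = 0" "S u = 0"
        using u R(1) S positive_op_kernel[of R u] positive_op_kernel[of S u] by linarith+
      then have "ip (R x - S x) u = 0"
        using x u R(1) S by (simp add: inner_diff positive_op_self_adjoint)
      then have "u = 0" using u inner_definite[of u] by (simp add: u_def)
      then show "S x = R x" by (simp add: u_def)
    qed (use R S positive_opD in auto)
  qed
  then have "positive_op H (sqrt_op H defect) \<and>
      compose carr (sqrt_op H defect) (sqrt_op H defect) = defect"
    unfolding sqrt_op_def by (rule theI')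
  then show "positive_op H (sqrt_op H defect)"
    "compose carr (sqrt_op H defect) (sqrt_op H defect) = defect" by auto
qed

text \<open>Douglas' criterion. With \<open>R\<close> the root, \<open>\<langle>(1 - X) x, x\<rangle> = \<parallel>R x\<parallel>\<^sup>2\<close>, and a vector \<open>u\<close> with
  \<open>|\<langle>x, u\<rangle>| \<le> c \<parallel>R x\<parallel>\<close> is of the form \<open>R h\<close> by \<open>functional_through_map_represented\<close>.\<close>

lemma range_sqrt_defect:
  "hcarrier (range_space H H (sqrt_op H defect)) =
     {u \<in> carr. \<exists>c. \<forall>x\<in>carr. (cmod (ip u x))\<^sup>2 \<le> c * ((nrm x)\<^sup>2 - Re (ip (X x) x))}"
proof -
  define R where "R = sqrt_op H defect"
  have R: "positive_op H R" unfolding R_def by (rule sqrt_op_works)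
  have RR: "R (R x) = x - X x" if "x \<in> carr" for x
    using fun_cong[OF sqrt_op_works(2), of x] that
    by (simp add: R_def compose_eq defect_apply)
  note RD [simp] = bounded_opsD[OF positive_opD(1)[OF R]]
  have nR: "(nrm (R x))\<^sup>2 = (nrm x)\<^sup>2 - Re (ip (X x) x)" if "x \<in> carr" for x
  proof -
    have "ip (R x) (R x) = ip (R (R x)) x"
      using that by (simp add: positive_op_self_adjoint[OF R, of "R x" x])
    then show ?thesis using that by (simp add: norm_squared RR inner_diff)
  qed
  have "u \<in> R ` carr \<longleftrightarrow>
      u \<in> carr \<and> (\<exists>c. \<forall>x\<in>carr. (cmod (ip u x))\<^sup>2 \<le> c * (nrm (R x))\<^sup>2)" for u
  proof (intro iffI conjI; (elim conjE exE)?)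
    assume "u \<in> R ` carr"
    then obtain h where h: "h \<in> carr" "u = R h" by blast
    then show "u \<in> carr" by simp
    show "\<exists>c. \<forall>x\<in>carr. (cmod (ip u x))\<^sup>2 \<le> c * (nrm (R x))\<^sup>2"
    proof (intro exI ballI)
      fix x assume x: "x \<in> carr"
      have "cmod (ip u x) \<le> nrm h * nrm (R x)"
        using Cauchy_Schwarz[of h "R x"] h x by (simp add: positive_op_self_adjoint[OF R])
      then have "(cmod (ip u x))\<^sup>2 \<le> (nrm h * nrm (R x))\<^sup>2" by (simp add: power_mono)
      then show "(cmod (ip u x))\<^sup>2 \<le> (nrm h)\<^sup>2 * (nrm (R x))\<^sup>2"
        by (simp add: power_mult_distrib)
    qed
  next
    fix c assume u: "u \<in> carr" and c: "\<forall>x\<in>carr. (cmod (ip u x))\<^sup>2 \<le> c * (nrm (R x))\<^sup>2"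
    have bd: "cmod (ip x u) \<le> sqrt \<bar>c\<bar> * nrm (R x)" if x: "x \<in> carr" for x
    proof -
      have "(cmod (ip x u))\<^sup>2 = (cmod (ip u x))\<^sup>2"
        using inner_cnj[OF x u] by simp
      also have "\<dots> \<le> c * (nrm (R x))\<^sup>2" using c x by blast
      also have "\<dots> \<le> \<bar>c\<bar> * (nrm (R x))\<^sup>2" by (intro mult_right_mono) auto
      also have "\<dots> = (sqrt \<bar>c\<bar> * nrm (R x))\<^sup>2" by (simp add: power_mult_distrib)
      finally show ?thesis by (rule power2_le_imp_le) (use x in simp)
    qed
    obtain h \<xi> where h: "h \<in> carr" and rep: "\<And>x. x \<in> carr \<Longrightarrow> ip x u = ip (R x) h"
      by (rule functional_through_map_represented[of carr R "\<lambda>x. ip x u" "sqrt \<bar>c\<bar>"])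
        (use u in \<open>simp_all add: carrier_subspace bd inner_add inner_scale\<close>)
    have "u = R h"
    proof (rule inner_eqI)
      fix x assume x: "x \<in> carr"
      have "ip x u = ip x (R h)"
        using rep[OF x] x h by (simp add: positive_op_self_adjoint[OF R])
      then show "ip u x = ip (R h) x"
        using inner_cnj[of u x] inner_cnj[of "R h" x] u h x by simp
    qed (use u h in auto)
    then show "u \<in> R ` carr" using h by blast
  qed
  then show ?thesis
    unfolding R_def[symmetric] range_space_def by (auto simp: nR set_eq_iff)
qed

end

context complex_hilbert_space
begin

lemma positive_contraction_adjoint_pair:
  assumes A: "A \<in> bounded_ops H H" and B: "B \<in> bounded_ops H H"
    and adj: "\<And>x y. \<lbrakk>x \<in> carr; y \<in> carr\<rbrakk> \<Longrightarrow> ip (A x) y = ip x (B y)"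
    and cA: "\<And>x. x \<in> carr \<Longrightarrow> nrm (A x) \<le> nrm x" and cB: "\<And>x. x \<in> carr \<Longrightarrow> nrm (B x) \<le> nrm x"
  shows "positive_contraction H (compose carr A B)"
proof -
  note [simp] = bounded_opsD[OF A] bounded_opsD[OF B]
  have c: "nrm (A (B x)) \<le> nrm x" if "x \<in> carr" for x
    using cA[of "B x"] cB[of x] that by simp
  show ?thesis
  proof (unfold_locales)
    show "positive_op H (compose carr A B)"
      unfolding positive_op_def
    proof (intro conjI ballI)
      show "compose carr A B \<in> bounded_ops H H"
        using c by (auto simp: bounded_ops_def compose_def intro!: exI[of _ 1])
      show "ip (compose carr A B x) x \<in> \<real>\<^sub>\<ge>\<^sub>0" if "x \<in> carr" for x
        using that by (simp add: compose_eq adj inner_self del: of_real_power)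
    qed
    show "nrm (compose carr A B x) \<le> nrm x" if "x \<in> carr" for x
      using c that by (simp add: compose_eq)
  qed
qed

lemma range_sqrt_complement:
  assumes T: "T \<in> bounded_ops H H" and c: "\<And>x. x \<in> carr \<Longrightarrow> nrm (T x) \<le> nrm x"
  defines "T' \<equiv> adjoint_op H H T"
  shows "hcarrier (range_space H H (sqrt_op H (op_diff H (op_id H) (compose carr T T')))) =
      {u \<in> carr. \<exists>c. \<forall>x\<in>carr. (cmod (ip u x))\<^sup>2 \<le> c * ((nrm x)\<^sup>2 - (nrm (T' x))\<^sup>2)}"
    and "hcarrier (range_space H H (sqrt_op H (op_diff H (op_id H) (compose carr T' T)))) =
      {u \<in> carr. \<exists>c. \<forall>x\<in>carr. (cmod (ip u x))\<^sup>2 \<le> c * ((nrm x)\<^sup>2 - (nrm (T x))\<^sup>2)}"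
proof -
  have T': "T' \<in> bounded_ops H H" unfolding T'_def by (rule adjoint_op_works[OF T])
  have c': "nrm (T' x) \<le> nrm x" if "x \<in> carr" for x
    unfolding T'_def by (rule adjoint_op_contraction[OF T c that])
  note [simp] = bounded_opsD[OF T] bounded_opsD[OF T']
  have adj: "ip (T x) y = ip x (T' y)" "ip (T' x) y = ip x (T y)" if "x \<in> carr" "y \<in> carr" for x y
    using that adjoint_op_works(2)[OF T] adjoint_op_inner_left[OF T] by (auto simp: T'_def)
  interpret TT': positive_contraction H "compose carr T T'"
    by (rule positive_contraction_adjoint_pair) (use T T' c c' adj in auto)
  interpret T'T: positive_contraction H "compose carr T' T"
    by (rule positive_contraction_adjoint_pair) (use T T' c c' adj in auto)
  show "hcarrier (range_space H H (sqrt_op H TT'.defect)) =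
      {u \<in> carr. \<exists>c. \<forall>x\<in>carr. (cmod (ip u x))\<^sup>2 \<le> c * ((nrm x)\<^sup>2 - (nrm (T' x))\<^sup>2)}"
    unfolding TT'.range_sqrt_defect by (simp add: compose_eq adj norm_squared cong: conj_cong)
  show "hcarrier (range_space H H (sqrt_op H T'T.defect)) =
      {u \<in> carr. \<exists>c. \<forall>x\<in>carr. (cmod (ip u x))\<^sup>2 \<le> c * ((nrm x)\<^sup>2 - (nrm (T x))\<^sup>2)}"
    unfolding T'T.range_sqrt_defect by (simp add: compose_eq adj norm_squared cong: conj_cong)
qed

text \<open>The Neumann series \<open>\<Sum>n. K\<^sup>n x\<close>.\<close>

lemma one_minus_strict_contraction_onto:
  assumes m: "\<And>x. x \<in> carr \<Longrightarrow> K x \<in> carr"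
    and d: "\<And>x y. \<lbrakk>x \<in> carr; y \<in> carr\<rbrakk> \<Longrightarrow> K (x - y) = K x - K y"
    and c: "\<And>x. x \<in> carr \<Longrightarrow> nrm (K x) \<le> q * nrm x" and q: "0 \<le> q" "q < 1"
    and x: "x \<in> carr"
  shows "\<exists>y\<in>carr. y - K y = x"
proof -
  define u where "u n = (K ^^ n) x" for n
  have u [simp]: "u n \<in> carr" for n using m x by (induction n) (auto simp: u_def)
  have nu: "nrm (u n) \<le> q ^ n * nrm x" for n
  proof (induction n)
    case (Suc n)
    have "nrm (u (Suc n)) \<le> q * nrm (u n)" using c[OF u[of n]] by (simp add: u_def)
    also have "\<dots> \<le> q * (q ^ n * nrm x)" using q Suc by (intro mult_left_mono) auto
    finally show ?case by simp
  qed (simp add: u_def)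
  have "summable (\<lambda>n. nrm (u n))"
    by (rule summable_comparison_test'[where g = "\<lambda>n. q ^ n * nrm x" and N = 0])
      (use nu q in \<open>auto intro: summable_mult2 summable_geometric\<close>)
  then obtain y where y: "y \<in> carr" and lim: "(\<lambda>N. nrm ((\<Sum>n<N. u n) - y)) \<longlonglongrightarrow> 0"
    using abs_convergent[of u] u by blast
  have K0: "K 0 = 0" using d[of 0 0] by simp
  have Ka: "K (v + w) = K v + K w" if "v \<in> carr" "w \<in> carr" for v w
    using d[of "v + w" w] that by simp
  have KS: "x + K (\<Sum>n<N. u n) = (\<Sum>n<Suc N. u n)" for N
  proof (induction N)
    case (Suc N)
    have "x + K (\<Sum>n<Suc N. u n) = (x + K (\<Sum>n<N. u n)) + K (u N)"
      by (simp add: Ka add.assoc)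
    also have "K (u N) = u (Suc N)" by (simp add: u_def)
    finally show ?case using Suc by simp
  qed (simp add: K0 u_def)
  have "x + K y = y"
  proof (rule limit_unique)
    \<comment> \<open>The partial sums converge to \<open>y\<close>, and also to \<open>x + K y\<close> since \<open>K\<close> maps the \<open>N\<close>-th one to the next minus \<open>x\<close>.\<close>
    show "(\<lambda>N. nrm ((\<Sum>n<Suc N. u n) - y)) \<longlonglongrightarrow> 0" by (rule LIMSEQ_Suc[OF lim])
    show "(\<lambda>N. nrm ((\<Sum>n<Suc N. u n) - (x + K y))) \<longlonglongrightarrow> 0"
    proof (rule Lim_null_comparison)
      have "(\<Sum>n<Suc N. u n) - (x + K y) = K ((\<Sum>n<N. u n) - y)" for N
        unfolding KS[symmetric] using y by (simp add: d)
      then show "eventually (\<lambda>N. norm (nrm ((\<Sum>n<Suc N. u n) - (x + K y)))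
          \<le> q * nrm ((\<Sum>n<N. u n) - y)) sequentially"
        using c y m by (simp add: mem_sum)
      show "(\<lambda>N. q * nrm ((\<Sum>n<N. u n) - y)) \<longlonglongrightarrow> 0"
        using tendsto_mult_left[OF lim, of q] by simp
    qed
  qed (use x y m in auto)
  then have "y - K y = x" by (metis add_diff_cancel_right')
  then show ?thesis using y by blast
qed

end


section \<open>Weighted square-summable families\<close>

lemma sum_fun_apply: "(\<Sum>i\<in>I. u i) k = (\<Sum>i\<in>I. u i k)"
  for u :: "'a \<Rightarrow> 'b \<Rightarrow> 'c::comm_monoid_add"
  by (induction I rule: infinite_finite_induct) auto

definition wl2 :: "('i \<Rightarrow> real) \<Rightarrow> ('i \<Rightarrow> complex) hspace" where
  "wl2 w = \<lparr>hcarrier = {x. (\<lambda>i. w i * (cmod (x i))\<^sup>2) summable_on UNIV},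
     hscale = (\<lambda>c x i. c * x i),
     hinner = (\<lambda>x y. \<Sum>\<^sub>\<infinity>i. of_real (w i) * (x i * cnj (y i)))\<rparr>"

lemma wl2_mem: "x \<in> hcarrier (wl2 w) \<longleftrightarrow> (\<lambda>i. w i * (cmod (x i))\<^sup>2) summable_on UNIV"
  by (simp add: wl2_def)

lemma wl2_scale [simp]: "hscale (wl2 w) c x = (\<lambda>i. c * x i)"
  by (simp add: wl2_def)

lemma wl2_scale_eq: "hscale (wl2 w) = (\<lambda>c x i. c * x i)"
  by (simp add: wl2_def)

lemma wl2_inner: "hinner (wl2 w) x y = (\<Sum>\<^sub>\<infinity>i. of_real (w i) * (x i * cnj (y i)))"
  by (simp add: wl2_def)

lemma infsum_of_real_complex: "(\<Sum>\<^sub>\<infinity>i\<in>A. complex_of_real (f i)) = of_real (\<Sum>\<^sub>\<infinity>i\<in>A. f i)"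
  using summable_on_bounded_linear_iff[OF bounded_linear_of_real bounded_linear_Re, of f A]
  by (intro infsum_bounded_linear_strong bounded_linear_of_real) simp

lemma wl2_inner_self:
  "hinner (wl2 w) x x = of_real (\<Sum>\<^sub>\<infinity>i. w i * (cmod (x i))\<^sup>2)"
proof -
  have "of_real (w i) * (x i * cnj (x i)) = complex_of_real (w i * (cmod (x i))\<^sup>2)" for i
    by (simp add: complex_norm_square del: of_real_power)
  then show ?thesis
    unfolding wl2_inner by (simp only: infsum_of_real_complex)
qed

locale pos_weight =
  fixes w :: "'i \<Rightarrow> real"
  assumes pos: "\<And>i. 0 < w i"
begin

abbreviation "carr_w \<equiv> hcarrier (wl2 w)"
abbreviation "norm_w \<equiv> hnorm (wl2 w)"

lemma nonneg [simp]: "0 \<le> w i" using pos[of i] by simp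

lemma norm_sq: "(norm_w x)\<^sup>2 = (\<Sum>\<^sub>\<infinity>i. w i * (cmod (x i))\<^sup>2)"
  by (simp add: hnorm_def wl2_inner_self infsum_nonneg)

lemma inner_summable:
  assumes "x \<in> carr_w" "y \<in> carr_w"
  shows "(\<lambda>i. of_real (w i) * (x i * cnj (y i))) summable_on UNIV"
proof (rule abs_summable_summable, rule summable_on_comparison_test)
  show "(\<lambda>i. w i * (cmod (x i))\<^sup>2 + w i * (cmod (y i))\<^sup>2) summable_on UNIV"
    using assms unfolding wl2_mem by (rule summable_on_add)
  fix i
  have "cmod (x i) * cmod (y i) \<le> (cmod (x i))\<^sup>2 + (cmod (y i))\<^sup>2"
    using sum_squares_bound[of "cmod (x i)" "cmod (y i)"]
      mult_nonneg_nonneg[OF norm_ge_zero[of "x i"] norm_ge_zero[of "y i"]] by linarith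
  then have "w i * (cmod (x i) * cmod (y i)) \<le> w i * ((cmod (x i))\<^sup>2 + (cmod (y i))\<^sup>2)"
    by (rule mult_left_mono) simp
  then show "norm (of_real (w i) * (x i * cnj (y i))) \<le> w i * (cmod (x i))\<^sup>2 + w i * (cmod (y i))\<^sup>2"
    by (simp add: norm_mult distrib_left)
qed simp

lemma add_mem:
  assumes "x \<in> carr_w" "y \<in> carr_w"
  shows "x + y \<in> carr_w"
  unfolding wl2_mem
proof (rule summable_on_comparison_test)
  show "(\<lambda>i. 2 * (w i * (cmod (x i))\<^sup>2) + 2 * (w i * (cmod (y i))\<^sup>2)) summable_on UNIV"
    using assms unfolding wl2_mem by (intro summable_on_add summable_on_cmult_right)
  fix i
  have "(cmod (x i + y i))\<^sup>2 \<le> (cmod (x i) + cmod (y i))\<^sup>2"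
    by (intro power_mono norm_triangle_ineq) simp
  also have "\<dots> \<le> 2 * (cmod (x i))\<^sup>2 + 2 * (cmod (y i))\<^sup>2"
    using sum_squares_bound[of "cmod (x i)" "cmod (y i)"] by (simp add: power2_sum)
  finally have "w i * (cmod (x i + y i))\<^sup>2 \<le> w i * (2 * (cmod (x i))\<^sup>2 + 2 * (cmod (y i))\<^sup>2)"
    by (rule mult_left_mono) simp
  then show "w i * (cmod ((x + y) i))\<^sup>2
      \<le> 2 * (w i * (cmod (x i))\<^sup>2) + 2 * (w i * (cmod (y i))\<^sup>2)"
    by (simp add: algebra_simps)
qed simp

lemma scale_mem:
  assumes "x \<in> carr_w"
  shows "(\<lambda>i. c * x i) \<in> carr_w"
  using summable_on_cmult_right[of "\<lambda>i. w i * (cmod (x i))\<^sup>2" UNIV "(cmod c)\<^sup>2"] assms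
  unfolding wl2_mem by (simp add: norm_mult power_mult_distrib mult_ac)

lemma inner_space: "complex_inner_space (wl2 w)"
proof (unfold_locales, unfold wl2_scale_eq)
  interpret vector_space "\<lambda>c (x :: 'i \<Rightarrow> complex) i. c * x i"
    by unfold_locales (auto simp: fun_eq_iff algebra_simps)
  show "module.subspace (\<lambda>c x i. c * x i) (carr_w)"
    by (intro subspaceI) (auto simp: wl2_mem[of 0] intro: add_mem scale_mem)
  show "hinner (wl2 w) (x + y) z = hinner (wl2 w) x z + hinner (wl2 w) y z"
    if "x \<in> carr_w" "y \<in> carr_w" "z \<in> carr_w" for x y z
    using infsum_add[OF inner_summable[OF that(1,3)] inner_summable[OF that(2,3)]]
    by (simp add: wl2_inner algebra_simps)
  show "hinner (wl2 w) (\<lambda>i. c * x i) y = c * hinner (wl2 w) x y" for c x y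
    unfolding wl2_inner by (simp flip: infsum_cmult_right' add: mult_ac)
  show "hinner (wl2 w) x y = cnj (hinner (wl2 w) y x)" for x y
    unfolding wl2_inner by (simp flip: infsum_cnj add: mult_ac)
  show "hinner (wl2 w) x x \<in> \<real>\<^sub>\<ge>\<^sub>0" for x
    by (simp add: wl2_inner_self infsum_nonneg)
  show "x = 0" if "x \<in> carr_w" "hinner (wl2 w) x x = 0" for x
  proof
    fix i
    have "(\<Sum>\<^sub>\<infinity>i. w i * (cmod (x i))\<^sup>2) = 0" using that(2) by (simp add: wl2_inner_self)
    then have "w i * (cmod (x i))\<^sup>2 = 0"
      using that(1) by (intro nonneg_infsum_le_0D[where A = UNIV]) (auto simp: wl2_mem)
    then show "x i = 0 i" using pos[of i] by simp
  qed
qed (auto simp: fun_eq_iff algebra_simps)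

lemma coordinate_bound:
  assumes "x \<in> carr_w"
  shows "w i * (cmod (x i))\<^sup>2 \<le> (norm_w x)\<^sup>2"
  using finite_sum_le_infsum[of "\<lambda>i. w i * (cmod (x i))\<^sup>2" UNIV "{i}"] assms
  by (simp add: norm_sq wl2_mem)

sublocale wl2: complex_hilbert_space "wl2 w"
proof -
  interpret pre: complex_inner_space "wl2 w" by (rule inner_space)
  show "complex_hilbert_space (wl2 w)"
  proof (rule pre.complex_hilbert_spaceI)
    fix u :: "nat \<Rightarrow> 'i \<Rightarrow> complex"
    assume u: "\<And>n. u n \<in> carr_w"
      and C: "\<And>\<epsilon>. \<epsilon> > 0 \<Longrightarrow> \<exists>N. \<forall>m\<ge>N. \<forall>n\<ge>N. norm_w (u m - u n) < \<epsilon>"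
    have "\<exists>l. (\<lambda>n. u n i) \<longlonglongrightarrow> l" for i
    proof -
      have "Cauchy (\<lambda>n. u n i)"
        unfolding Cauchy_def dist_norm
      proof (intro allI impI)
        fix \<epsilon> :: real assume "\<epsilon> > 0"
        then obtain N where N: "\<And>m n. m \<ge> N \<Longrightarrow> n \<ge> N \<Longrightarrow> norm_w (u m - u n) < \<epsilon> * sqrt (w i)"
          using C[of "\<epsilon> * sqrt (w i)"] pos[of i] by auto
        show "\<exists>N. \<forall>m\<ge>N. \<forall>n\<ge>N. cmod (u m i - u n i) < \<epsilon>"
        proof (intro exI allI impI)
          fix m n assume "N \<le> m" "N \<le> n"
          then have "(norm_w (u m - u n))\<^sup>2 < (\<epsilon> * sqrt (w i))\<^sup>2"
            using N u by (intro power_strict_mono) auto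
          moreover have "(\<epsilon> * sqrt (w i))\<^sup>2 = w i * \<epsilon>\<^sup>2"
            by (simp add: power_mult_distrib)
          moreover have "w i * (cmod (u m i - u n i))\<^sup>2 \<le> (norm_w (u m - u n))\<^sup>2"
            using coordinate_bound[of "u m - u n" i] u by simp
          ultimately have "w i * (cmod (u m i - u n i))\<^sup>2 < w i * \<epsilon>\<^sup>2" by linarith
          then have "(cmod (u m i - u n i))\<^sup>2 < \<epsilon>\<^sup>2" using pos[of i] by simp
          then show "cmod (u m i - u n i) < \<epsilon>"
            using \<open>\<epsilon> > 0\<close> by (simp add: power_less_imp_less_base)
        qed
      qed
      then show ?thesis by (simp add: Cauchy_convergent_iff convergent_def)
    qed
    then obtain l where l: "\<And>i. (\<lambda>n. u n i) \<longlonglongrightarrow> l i" by metis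
    have close: "u n - l \<in> carr_w \<and> norm_w (u n - l) \<le> \<epsilon>"
      if N: "\<And>m n. m \<ge> N \<Longrightarrow> n \<ge> N \<Longrightarrow> norm_w (u m - u n) < \<epsilon>" and n: "n \<ge> N" and e: "\<epsilon> > 0"
      for N n \<epsilon>
    proof -
      have fin: "(\<Sum>i\<in>F. w i * (cmod ((u n - l) i))\<^sup>2) \<le> \<epsilon>\<^sup>2" if F: "finite F" for F
      proof (rule LIMSEQ_le_const2)
        show "(\<lambda>m. \<Sum>i\<in>F. w i * (cmod (u n i - u m i))\<^sup>2) \<longlonglongrightarrow> (\<Sum>i\<in>F. w i * (cmod ((u n - l) i))\<^sup>2)"
          unfolding minus_apply by (intro tendsto_intros l)
        show "\<exists>N. \<forall>m\<ge>N. (\<Sum>i\<in>F. w i * (cmod (u n i - u m i))\<^sup>2) \<le> \<epsilon>\<^sup>2"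
        proof (intro exI allI impI)
          fix m assume m: "m \<ge> N"
          have mem: "u n - u m \<in> carr_w" using u by simp
          then have "(\<Sum>i\<in>F. w i * (cmod ((u n - u m) i))\<^sup>2) \<le> (norm_w (u n - u m))\<^sup>2"
            unfolding norm_sq wl2_mem by (intro finite_sum_le_infsum) (use F in auto)
          also have "\<dots> \<le> \<epsilon>\<^sup>2"
            using N[OF n m] mem by (intro power_mono) auto
          finally show "(\<Sum>i\<in>F. w i * (cmod (u n i - u m i))\<^sup>2) \<le> \<epsilon>\<^sup>2" by simp
        qed
      qed
      have mem: "u n - l \<in> carr_w"
        unfolding wl2_mem
      proof (rule nonneg_bdd_above_summable_on)
        show "bdd_above (sum (\<lambda>i. w i * (cmod ((u n - l) i))\<^sup>2) ` {F. F \<subseteq> UNIV \<and> finite F})"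
          using fin by (intro bdd_aboveI2[where M = "\<epsilon>\<^sup>2"]) auto
      qed simp
      have "(norm_w (u n - l))\<^sup>2 \<le> \<epsilon>\<^sup>2"
        unfolding norm_sq using mem fin unfolding wl2_mem by (intro infsum_le_finite_sums) auto
      then have "norm_w (u n - l) \<le> \<epsilon>" using e by (simp add: power2_le_iff_abs_le)
      then show ?thesis using mem by blast
    qed
    have ul: "u n - l \<in> carr_w" for n
    proof -
      obtain N where N: "\<And>m n. m \<ge> N \<Longrightarrow> n \<ge> N \<Longrightarrow> norm_w (u m - u n) < 1"
        using C[of 1] by auto
      have "u N - (u N - l) \<in> carr_w"
        by (rule pre.mem_diff[OF u conjunct1[OF close[OF N order_refl zero_less_one]]])
      then have "l \<in> carr_w" by simp
      then show ?thesis using u by simp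
    qed
    have "l \<in> carr_w"
      using pre.mem_diff[OF u[of 0] ul[of 0]] by simp
    moreover have "(\<lambda>n. norm_w (u n - l)) \<longlonglongrightarrow> 0"
    proof (rule LIMSEQ_I)
      fix \<epsilon> :: real assume "\<epsilon> > 0"
      then obtain N where N: "\<And>m n. m \<ge> N \<Longrightarrow> n \<ge> N \<Longrightarrow> norm_w (u m - u n) < \<epsilon> / 2"
        using C[of "\<epsilon> / 2"] by auto
      have "norm_w (u n - l) < \<epsilon>" if "n \<ge> N" for n
        using close[OF N that] \<open>\<epsilon> > 0\<close> by auto
      then show "\<exists>N. \<forall>n\<ge>N. norm (norm_w (u n - l) - 0) < \<epsilon>"
        using ul by auto
    qed
    ultimately show "\<exists>s\<in>carr_w. (\<lambda>n. norm_w (u n - s)) \<longlonglongrightarrow> 0" by blast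
  qed
qed

lemma coordinate_tendsto:
  assumes "\<And>n. u n \<in> carr_w" "s \<in> carr_w"
    "(\<lambda>n. norm_w (u n - s)) \<longlonglongrightarrow> 0"
  shows "(\<lambda>n. u n i) \<longlonglongrightarrow> s i"
proof -
  have "(\<lambda>n. (cmod (u n i - s i))\<^sup>2) \<longlonglongrightarrow> 0"
  proof (rule Lim_null_comparison)
    have "(cmod (u n i - s i))\<^sup>2 \<le> (norm_w (u n - s))\<^sup>2 / w i" for n
      using coordinate_bound[of "u n - s" i] assms pos[of i] by (simp add: field_simps)
    then show "eventually (\<lambda>n. norm ((cmod (u n i - s i))\<^sup>2)
        \<le> (norm_w (u n - s))\<^sup>2 / w i) sequentially" by simp
    show "(\<lambda>n. (norm_w (u n - s))\<^sup>2 / w i) \<longlonglongrightarrow> 0"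
      using tendsto_divide[OF tendsto_power[OF assms(3), of 2] tendsto_const[of "w i"]] pos[of i]
      by simp
  qed
  then have "(\<lambda>n. cmod (u n i - s i)) \<longlonglongrightarrow> 0"
    using tendsto_real_sqrt by fastforce
  then show ?thesis by (simp add: tendsto_norm_zero_iff LIM_zero_iff)
qed

end

lemma wl2_dominated:
  assumes "\<And>i. 0 < w i" "\<And>i. 0 < v i"
    and x: "x \<in> hcarrier (wl2 v)"
    and le: "\<And>i. w i * (cmod (y i))\<^sup>2 \<le> K * (v i * (cmod (x i))\<^sup>2)"
  shows "y \<in> hcarrier (wl2 w)" "(hnorm (wl2 w) y)\<^sup>2 \<le> K * (hnorm (wl2 v) x)\<^sup>2"
proof -
  interpret w: pos_weight w by unfold_locales fact
  interpret v: pos_weight v by unfold_locales fact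
  have s: "(\<lambda>i. K * (v i * (cmod (x i))\<^sup>2)) summable_on UNIV"
    using x unfolding wl2_mem by (rule summable_on_cmult_right)
  then show "y \<in> hcarrier (wl2 w)"
    unfolding wl2_mem by (rule summable_on_comparison_test) (use le in auto)
  then show "(hnorm (wl2 w) y)\<^sup>2 \<le> K * (hnorm (wl2 v) x)\<^sup>2"
    unfolding w.norm_sq v.norm_sq infsum_cmult_right'[symmetric] wl2_mem
    by (intro infsum_mono s le)
qed

abbreviation l2 :: "(nat \<Rightarrow> complex) hspace" where
  "l2 \<equiv> wl2 (\<lambda>_. 1)"

interpretation l2: pos_weight "\<lambda>_::nat. 1::real"
  by unfold_locales simp

lemma l2_infinite_dimensional: "infinite_dimensional l2"
  unfolding infinite_dimensional_def
proof
  define e :: "nat \<Rightarrow> nat \<Rightarrow> complex" where "e k = (\<lambda>i. if i = k then 1 else 0)" for k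
  assume "\<exists>S. finite S \<and> l2.wl2.span S = hcarrier l2"
  then obtain S where S: "finite S" "l2.wl2.span S = hcarrier l2" by blast
  have mem: "e k \<in> hcarrier l2" for k
    unfolding wl2_mem by (rule finite_nonzero_values_imp_summable_on) (auto simp: e_def)
  have inj: "inj e" by (rule injI) (auto simp: e_def fun_eq_iff split: if_splits)
  have "l2.wl2.independent (range e)"
    unfolding l2.wl2.independent_explicit_module
  proof (intro allI impI)
    fix t c v assume t: "finite t" "t \<subseteq> range e" "(\<Sum>v\<in>t. hscale l2 (c v) v) = 0" "v \<in> t"
    then obtain k where k: "v = e k" by blast
    have "0 = (\<Sum>v\<in>t. hscale l2 (c v) v) k" using t(3) by simp
    also have "\<dots> = (\<Sum>u\<in>t. c u * u k)" by (simp add: sum_fun_apply)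
    also have "\<dots> = (\<Sum>u\<in>t. if u = v then c v else 0)"
    proof (rule sum.cong)
      fix u assume "u \<in> t"
      then obtain j where j: "u = e j" using t(2) by blast
      have "e j k = (if j = k then 1 else 0)" by (simp add: e_def)
      then show "c u * u k = (if u = v then c v else 0)"
        by (simp add: j k inj_eq[OF inj])
    qed simp
    also have "\<dots> = c v" using t by simp
    finally show "c v = 0" by simp
  qed
  then have "finite (range e)"
    using l2.wl2.independent_span_bound[OF S(1), of "range e"] mem S(2) by blast
  then show False using inj range_inj_infinite by blast
qed

text \<open>The countable dense set consists of the finitely supported sequences of Gaussian rationals,
  enumerated by lists.\<close>

lemma l2_separable: "separable_space (htop l2)"
proof -
  interpret M: Metric_space "hcarrier l2" "hdist l2" by (rule l2.wl2.is_metric_space)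
  define q :: "(rat \<times> rat) list \<Rightarrow> nat \<Rightarrow> complex" where
    "q ps = (\<lambda>k. if k < length ps then Complex (of_rat (fst (ps ! k))) (of_rat (snd (ps ! k))) else 0)"
    for ps
  have q_mem: "q ps \<in> hcarrier l2" for ps
    unfolding wl2_mem
  proof (rule finite_nonzero_values_imp_summable_on)
    show "finite {x \<in> UNIV. 1 * (cmod (q ps x))\<^sup>2 \<noteq> 0}"
      by (rule finite_subset[of _ "{..<length ps}"]) (auto simp: q_def)
  qed
  have dense: "\<exists>y\<in>range q. y \<in> M.mball x r" if x: "x \<in> hcarrier l2" and r: "r > 0" for x r
  proof -
    have sx: "(\<lambda>i. (cmod (x i))\<^sup>2) summable_on UNIV" using x by (simp add: wl2_mem)
    then have sm: "summable (\<lambda>i. (cmod (x i))\<^sup>2)" by (rule summable_on_imp_summable)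
    obtain N where N: "(\<Sum>i. (cmod (x (i + N)))\<^sup>2) < r\<^sup>2 / 4"
      using suminf_exist_split[OF _ sm, of "r\<^sup>2 / 4"] r abs_ge_self
      unfolding real_norm_def
      by (metis le_less_trans order_refl zero_less_divide_iff zero_less_numeral zero_less_power)
    define \<delta> where "\<delta> = r / (4 * (real N + 1))"
    have \<delta>: "\<delta> > 0" using r by (simp add: \<delta>_def)
    have "\<exists>p :: rat \<times> rat. cmod (x k - Complex (of_rat (fst p)) (of_rat (snd p))) < 2 * \<delta>" for k
    proof -
      obtain a where a: "Re (x k) < of_rat a" "of_rat a < Re (x k) + \<delta>"
        using of_rat_dense[of "Re (x k)" "Re (x k) + \<delta>"] \<delta> by auto
      obtain b where b: "Im (x k) < of_rat b" "of_rat b < Im (x k) + \<delta>"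
        using of_rat_dense[of "Im (x k)" "Im (x k) + \<delta>"] \<delta> by auto
      have "cmod (x k - Complex (of_rat a) (of_rat b))
          \<le> \<bar>Re (x k) - of_rat a\<bar> + \<bar>Im (x k) - of_rat b\<bar>"
        using cmod_le[of "x k - Complex (of_rat a) (of_rat b)"] by simp
      also have "\<dots> < 2 * \<delta>" using a b by linarith
      finally show ?thesis by (intro exI[of _ "(a, b)"]) simp
    qed
    then obtain p :: "nat \<Rightarrow> rat \<times> rat" where
      p: "\<And>k. cmod (x k - Complex (of_rat (fst (p k))) (of_rat (snd (p k)))) < 2 * \<delta>" by metis
    define y where "y = q (map p [0..<N])"
    have ylt: "cmod (x k - y k) < 2 * \<delta>" if "k < N" for k
      using p[of k] that by (simp add: y_def q_def)
    have yge: "y k = 0" if "k \<ge> N" for k using that by (simp add: y_def q_def)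
    have mem: "x - y \<in> hcarrier l2" using x q_mem by (simp add: y_def)
    then have sxy: "(\<lambda>i. (cmod (x i - y i))\<^sup>2) summable_on UNIV" by (simp add: wl2_mem)
    have "(hnorm l2 (x - y))\<^sup>2 = (\<Sum>i. (cmod (x i - y i))\<^sup>2)"
      using has_sum_imp_sums[OF has_sum_infsum[OF sxy]] by (simp add: l2.norm_sq sums_iff)
    also have "\<dots> = (\<Sum>i. (cmod (x (i + N) - y (i + N)))\<^sup>2) + (\<Sum>i<N. (cmod (x i - y i))\<^sup>2)"
      (is "_ = ?a + ?b")
      by (rule suminf_split_initial_segment[OF summable_on_imp_summable[OF sxy]])
    finally have split: "(hnorm l2 (x - y))\<^sup>2 = ?a + ?b" .
    have "?a < r\<^sup>2 / 4"
      using N by (simp add: yge)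
    moreover have "?b \<le> r\<^sup>2 / 4"
    proof -
      have "?b \<le> (\<Sum>i<N. (2 * \<delta>)\<^sup>2)"
      by (intro sum_mono power_mono[OF less_imp_le[OF ylt]]) auto
      also have "\<dots> \<le> r\<^sup>2 / 4"
      proof -
      have "real N * (2 * \<delta>)\<^sup>2 = (r\<^sup>2 / 4) * (real N / (real N + 1)\<^sup>2)"
      proof -
        have "2 * \<delta> = (r / 2) / (real N + 1)" by (simp add: \<delta>_def field_simps)
        then show ?thesis by (simp only: power_divide) simp
      qed
      also have "\<dots> \<le> (r\<^sup>2 / 4) * 1"
        by (rule mult_left_mono) (auto simp: divide_le_eq power2_eq_square algebra_simps)
      finally show ?thesis by simp
    qed
      finally show ?thesis .
    qed
    moreover have "0 < r\<^sup>2" using r by simp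
    ultimately have "(hnorm l2 (x - y))\<^sup>2 < r\<^sup>2"
      unfolding split by linarith
    then have "hnorm l2 (x - y) < r" using r by (simp add: power_less_imp_less_base)
    then show ?thesis
      using x q_mem by (intro bexI[of _ y]) (auto simp: M.in_mball hdist_def y_def)
  qed
  show ?thesis
    unfolding separable_space_def
  proof (intro exI conjI)
    show "countable (range q)" by simp
    show "range q \<subseteq> topspace (htop l2)" using q_mem by auto
    show "htop l2 closure_of range q = topspace (htop l2)"
      unfolding M.metric_closure_of using dense by auto
  qed
qed


section \<open>Bergman spaces as spaces of coefficient arrays\<close>

context complex_hilbert_space
begin

text \<open>Transports the Hilbert space structure from coefficient arrays to Bergman spaces.\<close>

lemma isometric_image_Hilbert:
  fixes K :: "'w::ab_group_add hspace" and P :: "'v \<Rightarrow> 'w"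
  assumes V: "vector_space (hscale K)"
    and img: "hcarrier K = P ` carr"
    and add: "\<And>x y. \<lbrakk>x \<in> carr; y \<in> carr\<rbrakk> \<Longrightarrow> P (x + y) = P x + P y"
    and scale: "\<And>c x. x \<in> carr \<Longrightarrow> P (sc c x) = hscale K c (P x)"
    and inner: "\<And>x y. \<lbrakk>x \<in> carr; y \<in> carr\<rbrakk> \<Longrightarrow> hinner K (P x) (P y) = ip x y"
  shows "complex_hilbert_space K"
proof -
  interpret K: vector_space "hscale K" by (rule V)
  have P0: "P 0 = 0" using add[of 0 0] by simp
  have Pdiff: "P (x - y) = P x - P y" if "x \<in> carr" "y \<in> carr" for x y
    using add[of "x - y" y] that by (simp add: eq_diff_eq)
  have Pnorm: "hnorm K (P x) = nrm x" if "x \<in> carr" for x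
    using that by (simp add: hnorm_def inner)
  interpret K: complex_inner_space K
  proof
    show "K.subspace (hcarrier K)"
      unfolding img
    proof (rule K.subspaceI)
      show "0 \<in> P ` carr" using P0 by (metis imageI mem_zero)
      show "x + y \<in> P ` carr" if "x \<in> P ` carr" "y \<in> P ` carr" for x y
        using that by (auto simp: add[symmetric])
      show "hscale K c x \<in> P ` carr" if "x \<in> P ` carr" for c x
        using that by (auto simp: scale[symmetric])
    qed
    show "hinner K x y = cnj (hinner K y x)" if "x \<in> hcarrier K" "y \<in> hcarrier K" for x y
    proof -
      obtain a b where "x = P a" "y = P b" "a \<in> carr" "b \<in> carr" using \<open>x \<in> _\<close> \<open>y \<in> _\<close> img by auto
      then show ?thesis using inner_cnj[of a b] by (simp add: inner)
    qed
    show "x = 0" if "x \<in> hcarrier K" "hinner K x x = 0" for x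
    proof -
      obtain a where "x = P a" "a \<in> carr" using \<open>x \<in> _\<close> img by auto
      then show ?thesis using that(2) inner[of a a] inner_definite[of a] P0 by simp
    qed
  qed (auto simp: img add[symmetric] scale[symmetric] inner inner_add inner_scale inner_nonneg)
  show ?thesis
  proof (rule K.complex_hilbert_spaceI)
    fix u :: "nat \<Rightarrow> 'w" assume u: "\<And>n. u n \<in> hcarrier K"
      and C: "\<And>\<epsilon>. \<epsilon> > 0 \<Longrightarrow> \<exists>N. \<forall>m\<ge>N. \<forall>n\<ge>N. hnorm K (u m - u n) < \<epsilon>"
    obtain \<xi> where \<xi>: "\<And>n. \<xi> n \<in> carr" "\<And>n. u n = P (\<xi> n)"
      using u unfolding img image_iff by metis
    have "\<exists>s\<in>carr. (\<lambda>n. nrm (\<xi> n - s)) \<longlonglongrightarrow> 0"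
      using C by (intro Cauchy_convergent) (auto simp: \<xi> Pdiff[symmetric] Pnorm)
    then obtain s where "s \<in> carr" "(\<lambda>n. nrm (\<xi> n - s)) \<longlonglongrightarrow> 0" by blast
    then show "\<exists>s\<in>hcarrier K. (\<lambda>n. hnorm K (u n - s)) \<longlonglongrightarrow> 0"
      by (intro bexI[of _ "P s"]) (auto simp: \<xi> Pdiff[symmetric] Pnorm img)
  qed
qed

end

lemma bergman_weight_0: "-2 < \<beta> \<Longrightarrow> bergman_weight \<beta> 0 = 1"
proof -
  assume "-2 < \<beta>"
  then have "0 < Gamma (\<beta> + 2)" by (intro Gamma_real_pos) simp
  then show ?thesis by (simp add: bergman_weight_def)
qed

lemma bergman_weight_Suc:
  assumes "-2 < \<beta>"
  shows "bergman_weight \<beta> (Suc n) = bergman_weight \<beta> n * ((real n + \<beta> + 2) / (real n + 1))"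
proof -
  have "real n + \<beta> + 2 \<notin> \<int>\<^sub>\<le>\<^sub>0" using assms nonpos_Ints_nonpos by fastforce
  then have "Gamma (real (Suc n) + \<beta> + 2) = (real n + \<beta> + 2) * Gamma (real n + \<beta> + 2)"
    using Gamma_plus1[of "real n + \<beta> + 2"] by (simp add: algebra_simps)
  then show ?thesis by (simp add: bergman_weight_def algebra_simps)
qed

lemma bergman_weight_pos: "-2 < \<beta> \<Longrightarrow> 0 < bergman_weight \<beta> n"
  unfolding bergman_weight_def by (intro divide_pos_pos mult_pos_pos Gamma_real_pos) auto

text \<open>The ratio of consecutive weights tends to \<open>1\<close>.\<close>

lemma summable_bergman_weight_power:
  assumes \<beta>: "-2 < \<beta>" and q: "0 \<le> q" "q < 1"
  shows "summable (\<lambda>n. bergman_weight \<beta> n * q ^ n)"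
proof -
  obtain N :: nat where N: "2 * \<bar>\<beta> + 1\<bar> / (1 - q) \<le> real N" by (meson real_arch_simple)
  show ?thesis
  proof (rule summable_ratio_test[where c = "(1 + q) / 2" and N = N])
    fix n assume n: "N \<le> n"
    have "2 * \<bar>\<beta> + 1\<bar> / (1 - q) \<le> real n + 1" using N n by linarith
    then have *: "2 * \<bar>\<beta> + 1\<bar> \<le> (real n + 1) * (1 - q)"
      using q by (simp add: divide_le_eq)
    have "q * (\<beta> + 1) \<le> 1 * \<bar>\<beta> + 1\<bar>"
      using q by (intro order_trans[OF mult_left_mono[OF abs_ge_self] mult_right_mono]) auto
    then have "q * (real n + \<beta> + 2) \<le> (1 + q) / 2 * (real n + 1)"
      using * by (simp add: algebra_simps)
    then have le: "(real n + \<beta> + 2) / (real n + 1) * q \<le> (1 + q) / 2"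
      by (simp add: divide_le_eq mult.commute)
    have c: "0 \<le> bergman_weight \<beta> n * q ^ n" 
      using bergman_weight_pos[OF \<beta>, of n] q by simp
    have "bergman_weight \<beta> (Suc n) * q ^ Suc n
        = (real n + \<beta> + 2) / (real n + 1) * q * (bergman_weight \<beta> n * q ^ n)"
      by (simp add: bergman_weight_Suc[OF \<beta>])
    also have "\<dots> \<le> (1 + q) / 2 * (bergman_weight \<beta> n * q ^ n)"
      by (rule mult_right_mono[OF le c])
    finally show "norm (bergman_weight \<beta> (Suc n) * q ^ Suc n)
        \<le> (1 + q) / 2 * norm (bergman_weight \<beta> n * q ^ n)"
      using bergman_weight_pos[OF \<beta>, of n] bergman_weight_pos[OF \<beta>, of "Suc n"] q
      by (simp add: abs_mult)
  qed (use q in auto)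
qed

definition coeff_weight :: "real \<Rightarrow> nat \<times> nat \<Rightarrow> real" where
  "coeff_weight \<beta> p = 1 / bergman_weight \<beta> (fst p)"

abbreviation coeff_arrays :: "real \<Rightarrow> (nat \<times> nat \<Rightarrow> complex) set" where
  "coeff_arrays \<beta> \<equiv> hcarrier (wl2 (coeff_weight \<beta>))"

abbreviation coeff_row :: "(nat \<times> nat \<Rightarrow> complex) \<Rightarrow> nat \<Rightarrow> nat \<Rightarrow> complex" where
  "coeff_row X n \<equiv> \<lambda>k. X (n, k)"

text \<open>The function with coefficient array \<open>X\<close>. The map does not depend on the weight, so it
  identifies all spaces \<open>A\<^sup>2\<^sub>\<beta>\<close> with spaces of arrays at once.\<close>

definition series_fun :: "(nat \<times> nat \<Rightarrow> complex) \<Rightarrow> complex \<Rightarrow> nat \<Rightarrow> complex" where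
  "series_fun X z = (if z \<in> ball 0 1 then (\<lambda>k. \<Sum>n. z ^ n * X (n, k)) else 0)"

lemma array_square_summable_iff:
  assumes \<beta>: "-2 < \<beta>"
  shows "X \<in> coeff_arrays \<beta> \<longleftrightarrow>
    (\<forall>n. coeff_row X n \<in> hcarrier l2) \<and>
    summable (\<lambda>n. (hnorm l2 (coeff_row X n))\<^sup>2 / bergman_weight \<beta> n)"
proof -
  define f where "f p = coeff_weight \<beta> p * (cmod (X p))\<^sup>2" for p
  note c = bergman_weight_pos[OF \<beta>]
  have f: "f (n, k) = 1 / bergman_weight \<beta> n * (1 * (cmod (X (n, k)))\<^sup>2)" for n k
    by (simp add: f_def coeff_weight_def)
  have row: "coeff_row X n \<in> hcarrier l2 \<longleftrightarrow> (\<lambda>k. f (n, k)) summable_on UNIV" for n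
    unfolding wl2_mem f using c[of n] by (subst summable_on_cmult_right') auto
  have inf: "infsum (\<lambda>k. f (n, k)) UNIV = (hnorm l2 (coeff_row X n))\<^sup>2 / bergman_weight \<beta> n" for n
    unfolding l2.norm_sq f by (simp only: infsum_cmult_right') simp
  have nn: "0 \<le> (hnorm l2 (coeff_row X n))\<^sup>2 / bergman_weight \<beta> n" for n
    using c[of n] by simp
  have "f summable_on UNIV \<times> UNIV \<longleftrightarrow>
    (\<forall>n. coeff_row X n \<in> hcarrier l2) \<and>
    summable (\<lambda>n. (hnorm l2 (coeff_row X n))\<^sup>2 / bergman_weight \<beta> n)"
  proof (intro iffI conjI allI)
    assume s: "f summable_on UNIV \<times> UNIV"
    then have s': "(\<lambda>(n, k). f (n, k)) summable_on UNIV \<times> UNIV" by simp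
    show r: "coeff_row X n \<in> hcarrier l2" for n
      unfolding row by (rule summable_on_SigmaD1[OF s']) simp
    have "(\<lambda>n. infsum (\<lambda>k. f (n, k)) UNIV) summable_on UNIV"
      by (rule summable_on_Sigma_banach[OF s'])
    then show "summable (\<lambda>n. (hnorm l2 (coeff_row X n))\<^sup>2 / bergman_weight \<beta> n)"
      unfolding inf by (rule summable_on_imp_summable)
  next
    assume A: "(\<forall>n. coeff_row X n \<in> hcarrier l2) \<and>
      summable (\<lambda>n. (hnorm l2 (coeff_row X n))\<^sup>2 / bergman_weight \<beta> n)"
    show "f summable_on UNIV \<times> UNIV"
    proof (rule summable_on_SigmaI)
      show "((\<lambda>k. f (n, k)) has_sum (hnorm l2 (coeff_row X n))\<^sup>2 / bergman_weight \<beta> n) UNIV" for n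
        using A row inf by (metis has_sum_infsum)
      show "(\<lambda>n. (hnorm l2 (coeff_row X n))\<^sup>2 / bergman_weight \<beta> n) summable_on UNIV"
        using A nn by (simp add: summable_on_UNIV_nonneg_real_iff)
      show "0 \<le> f (n, k)" for n k
        using c[of n] by (simp add: f)
    qed
  qed
  then show ?thesis by (simp add: wl2_mem f_def[abs_def])
qed

text \<open>By \<open>2 a b \<le> a\<^sup>2 + b\<^sup>2\<close> with \<open>a = |z|\<^sup>n \<surd>c\<^sub>n\<close> and
  \<open>b = \<parallel>X\<^sub>n\<parallel> / \<surd>c\<^sub>n\<close>.\<close>

lemma l2_row_series_summable:
  assumes \<beta>: "-2 < \<beta>" and X: "X \<in> coeff_arrays \<beta>" and z: "cmod z < 1"
  shows "summable (\<lambda>n. hnorm l2 (hscale l2 (z ^ n) (coeff_row X n)))"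
proof (rule summable_comparison_test')
  have rows: "\<And>n. coeff_row X n \<in> hcarrier l2"
    and s: "summable (\<lambda>n. (hnorm l2 (coeff_row X n))\<^sup>2 / bergman_weight \<beta> n)"
    using X array_square_summable_iff[OF \<beta>] by auto
  have q: "(cmod z)\<^sup>2 < 1" using z by (simp add: power_less_one_iff)
  show "summable (\<lambda>n. bergman_weight \<beta> n * ((cmod z)\<^sup>2) ^ n
      + (hnorm l2 (coeff_row X n))\<^sup>2 / bergman_weight \<beta> n)"
    by (intro summable_add s summable_bergman_weight_power \<beta> q) auto
  fix n
  define c where "c = bergman_weight \<beta> n"
  have c: "c > 0" unfolding c_def by (rule bergman_weight_pos[OF \<beta>])
  define a b where "a = sqrt c * cmod z ^ n" and "b = hnorm l2 (coeff_row X n) / sqrt c"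
  have "a * b \<le> a\<^sup>2 + b\<^sup>2"
  proof -
    have "0 \<le> a" "0 \<le> b"
      using c l2.wl2.norm_nonneg[OF rows[of n]] by (simp_all add: a_def b_def)
    then have "0 \<le> a * b" by simp
    then show ?thesis using sum_squares_bound[of a b] by linarith
  qed
  moreover have "a * b = cmod z ^ n * hnorm l2 (coeff_row X n)" using c by (simp add: a_def b_def)
  moreover have "a\<^sup>2 = c * ((cmod z)\<^sup>2) ^ n"
    using c by (simp add: a_def power_mult_distrib flip: power_mult) (simp add: mult.commute)
  moreover have "b\<^sup>2 = (hnorm l2 (coeff_row X n))\<^sup>2 / c" using c by (simp add: b_def power_divide)
  ultimately show "norm (hnorm l2 (hscale l2 (z ^ n) (coeff_row X n)))
      \<le> bergman_weight \<beta> n * ((cmod z)\<^sup>2) ^ n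
      + (hnorm l2 (coeff_row X n))\<^sup>2 / bergman_weight \<beta> n"
    using rows[of n] l2.wl2.norm_nonneg[OF rows[of n]]
    by (simp add: l2.wl2.norm_scale c_def norm_power abs_mult del: wl2_scale)
qed

lemma has_coeffs_l2_sums:
  assumes h: "has_coeffs l2 f a" and z: "z \<in> ball 0 1"
  shows "(\<lambda>n. z ^ n * a n k) sums f z k"
proof -
  have a: "a n \<in> hcarrier l2" for n using h by (simp add: has_coeffs_def)
  let ?S = "\<lambda>N. \<Sum>n<N. hscale l2 (z ^ n) (a n)"
  have mem: "?S N \<in> hcarrier l2" for N
    by (intro l2.wl2.mem_sum l2.wl2.mem_scale a)
  have "limitin (htop l2) ?S (f z) sequentially"
    using h z by (simp add: has_coeffs_def hsums_def)
  then have "f z \<in> hcarrier l2" "(\<lambda>N. hnorm l2 (?S N - f z)) \<longlonglongrightarrow> 0"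
    using l2.wl2.limitin_iff[of ?S, OF mem] by auto
  then have "(\<lambda>N. ?S N k) \<longlonglongrightarrow> f z k"
    using mem by (intro l2.coordinate_tendsto)
  then show ?thesis by (simp add: sums_def sum_fun_apply)
qed

lemma has_coeffs_series_fun:
  assumes \<beta>: "-2 < \<beta>" and X: "X \<in> coeff_arrays \<beta>"
  shows "has_coeffs l2 (series_fun X) (coeff_row X)"
  unfolding has_coeffs_def
proof (intro conjI allI ballI)
  show rows: "coeff_row X n \<in> hcarrier l2" for n
    using X array_square_summable_iff[OF \<beta>] by auto
  fix z :: complex assume z: "z \<in> ball 0 1"
  let ?u = "\<lambda>n. hscale l2 (z ^ n) (coeff_row X n)"
  have u: "?u n \<in> hcarrier l2" for n using rows by (rule l2.wl2.mem_scale)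
  then have mem: "(\<Sum>n<N. ?u n) \<in> hcarrier l2" for N
    by (intro l2.wl2.mem_sum)
  have "summable (\<lambda>n. hnorm l2 (?u n))"
    using l2_row_series_summable[OF \<beta> X] z by simp
  then obtain s where s: "s \<in> hcarrier l2" "(\<lambda>N. hnorm l2 ((\<Sum>n<N. ?u n) - s)) \<longlonglongrightarrow> 0"
    using l2.wl2.abs_convergent[of ?u] u by blast
  have "(\<lambda>N. (\<Sum>n<N. ?u n) k) \<longlonglongrightarrow> s k" for k
    by (rule l2.coordinate_tendsto[OF mem s])
  then have "(\<lambda>n. z ^ n * X (n, k)) sums s k" for k
    by (simp add: sums_def sum_fun_apply)
  then have "s = series_fun X z"
    using z by (auto simp: series_fun_def sums_iff)
  then show "hsums l2 ?u (series_fun X z)"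
    unfolding hsums_def using s l2.wl2.limitin_iff[of "\<lambda>N. \<Sum>n<N. ?u n", OF mem] by simp
qed

text \<open>Coordinatewise, this is uniqueness of the coefficients of a scalar power series.\<close>

lemma has_coeffs_l2_unique:
  assumes a: "has_coeffs l2 f a" and b: "has_coeffs l2 f b"
  shows "a = b"
proof (intro ext)
  fix n k
  define A B where "A = Abs_fps (\<lambda>n. a n k)" and "B = Abs_fps (\<lambda>n. b n k)"
  have sA: "\<And>z. z \<in> ball 0 1 \<Longrightarrow> (\<lambda>n. fps_nth A n * z ^ n) sums f z k"
    and sB: "\<And>z. z \<in> ball 0 1 \<Longrightarrow> (\<lambda>n. fps_nth B n * z ^ n) sums f z k"
    using has_coeffs_l2_sums[OF a, of _ k] has_coeffs_l2_sums[OF b, of _ k]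
    by (simp_all add: A_def B_def mult.commute)
  have half: "(1/2 :: complex) \<in> ball 0 1" by simp
  have "conv_radius (fps_nth A) \<ge> norm (1/2 :: complex)"
    "conv_radius (fps_nth B) \<ge> norm (1/2 :: complex)"
    using sA[OF half] sB[OF half] by (intro conv_radius_geI; simp only: sums_iff)+
  then have "fps_conv_radius A > 0" "fps_conv_radius B > 0"
    unfolding fps_conv_radius_def by (auto intro: less_le_trans[rotated])
  moreover have "eventually (\<lambda>z. eval_fps A z = eval_fps B z) (nhds 0)"
  proof -
    have "eventually (\<lambda>z::complex. z \<in> ball 0 1) (nhds 0)"
      by (intro eventually_nhds_in_open) auto
    then show ?thesis
      by eventually_elim (use sA sB in \<open>simp add: eval_fps_def sums_iff\<close>)
  qed
  ultimately have "A = B" by (rule eval_fps_eqD)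
  then show "a n k = b n k" by (metis A_def B_def fps_nth_Abs_fps)
qed

lemma coeffs_l2_eq: "has_coeffs l2 f a \<Longrightarrow> coeffs l2 f = a"
  unfolding coeffs_def by (rule the_equality) (auto intro: has_coeffs_l2_unique)

lemma series_fun_sums:
  assumes "-2 < \<beta>" "X \<in> coeff_arrays \<beta>" "z \<in> ball 0 1"
  shows "(\<lambda>n. z ^ n * X (n, k)) sums series_fun X z k"
  using has_coeffs_l2_sums[OF has_coeffs_series_fun] assms by blast

lemma bergman_carrier:
  assumes \<beta>: "-2 < \<beta>"
  shows "hcarrier (bergman_space \<beta> l2) = series_fun ` coeff_arrays \<beta>"
proof (intro equalityI subsetI)
  fix f assume "f \<in> hcarrier (bergman_space \<beta> l2)"
  then obtain a where out: "\<And>z. z \<notin> ball 0 1 \<Longrightarrow> f z = 0" and a: "has_coeffs l2 f a"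
    and s: "summable (\<lambda>n. (hnorm l2 (a n))\<^sup>2 / bergman_weight \<beta> n)"
    by (auto simp: bergman_space_def)
  define X where "X = (\<lambda>(n, k). a n k)"
  have X: "X \<in> coeff_arrays \<beta>"
    using a s unfolding array_square_summable_iff[OF \<beta>] by (simp add: X_def has_coeffs_def)
  have "f z k = series_fun X z k" for z k
  proof (cases "z \<in> ball 0 1")
    case True
    then show ?thesis
      using has_coeffs_l2_sums[OF a True, of k] series_fun_sums[OF \<beta> X True, of k]
      by (simp add: X_def sums_iff)
  next
    case False
    then show ?thesis using out by (auto simp: series_fun_def)
  qed
  then have "f = series_fun X" by (intro ext)
  then show "f \<in> series_fun ` coeff_arrays \<beta>" using X by blast
next
  fix f assume "f \<in> series_fun ` coeff_arrays \<beta>"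
  then obtain X where X: "X \<in> coeff_arrays \<beta>" "f = series_fun X" by blast
  then show "f \<in> hcarrier (bergman_space \<beta> l2)"
    using has_coeffs_series_fun[OF \<beta> X(1)] array_square_summable_iff[OF \<beta>, of X]
    by (auto simp: bergman_space_def series_fun_def)
qed

lemma bergman_inner:
  assumes \<beta>: "-2 < \<beta>"
    and X: "X \<in> coeff_arrays \<beta>" and Y: "Y \<in> coeff_arrays \<beta>"
  shows "hinner (bergman_space \<beta> l2) (series_fun X) (series_fun Y)
      = hinner (wl2 (coeff_weight \<beta>)) X Y"
proof -
  interpret W: pos_weight "coeff_weight \<beta>"
    by unfold_locales (simp add: coeff_weight_def bergman_weight_pos[OF \<beta>])
  define g where "g p = of_real (coeff_weight \<beta> p) * (X p * cnj (Y p))" for p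
  have g: "g summable_on UNIV \<times> UNIV"
    using W.inner_summable[OF X Y] by (simp add: g_def[abs_def])
  then have g': "(\<lambda>(n, k). g (n, k)) summable_on UNIV \<times> UNIV" by simp
  have row: "(\<Sum>\<^sub>\<infinity>k. g (n, k))
      = hinner l2 (coeff_row X n) (coeff_row Y n) / of_real (bergman_weight \<beta> n)" for n
  proof -
    have "(\<Sum>\<^sub>\<infinity>k. g (n, k))
        = (\<Sum>\<^sub>\<infinity>k. inverse (of_real (bergman_weight \<beta> n)) *
          (of_real 1 * (X (n, k) * cnj (Y (n, k)))))"
      by (simp add: g_def coeff_weight_def field_simps)
    then show ?thesis
      unfolding wl2_inner by (simp only: infsum_cmult_right') (simp add: field_simps)
  qed
  have "hinner (bergman_space \<beta> l2) (series_fun X) (series_fun Y)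
      = (\<Sum>n. \<Sum>\<^sub>\<infinity>k. g (n, k))"
    unfolding row bergman_space_def
    by (simp add: coeffs_l2_eq[OF has_coeffs_series_fun[OF \<beta> X]]
        coeffs_l2_eq[OF has_coeffs_series_fun[OF \<beta> Y]])
  also have "\<dots> = (\<Sum>\<^sub>\<infinity>n. \<Sum>\<^sub>\<infinity>k. g (n, k))"
    using has_sum_imp_sums[OF has_sum_infsum[OF summable_on_Sigma_banach[OF g']]]
    by (simp add: sums_iff)
  also have "\<dots> = infsum g (UNIV \<times> UNIV)" by (rule infsum_Sigma_banach[OF g])
  also have "\<dots> = hinner (wl2 (coeff_weight \<beta>)) X Y" by (simp add: wl2_inner g_def[abs_def])
  finally show ?thesis .
qed

lemma series_fun_add:
  assumes "-2 < \<beta>" "X \<in> coeff_arrays \<beta>" "Y \<in> coeff_arrays \<beta>"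
  shows "series_fun (X + Y) = series_fun X + series_fun Y"
proof (intro ext)
  fix z k
  show "series_fun (X + Y) z k = (series_fun X + series_fun Y) z k"
  proof (cases "z \<in> ball 0 1")
    case True
    then show ?thesis
      using sums_add[OF series_fun_sums[OF assms(1,2) True, of k] series_fun_sums[OF assms(1,3) True, of k]]
      by (simp add: series_fun_def distrib_left sums_iff)
  qed (simp add: series_fun_def)
qed

lemma series_fun_scale:
  assumes "-2 < \<beta>" "X \<in> coeff_arrays \<beta>"
  shows "series_fun (\<lambda>p. c * X p) = (\<lambda>z k. c * series_fun X z k)"
proof (intro ext)
  fix z k
  show "series_fun (\<lambda>p. c * X p) z k = c * series_fun X z k"
  proof (cases "z \<in> ball 0 1")
    case True
    then show ?thesis
      using sums_mult[OF series_fun_sums[OF assms True, of k], of c]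
      by (simp add: series_fun_def mult.left_commute sums_iff)
  qed (simp add: series_fun_def)
qed

lemma bergman_scale: "hscale (bergman_space \<beta> l2) = (\<lambda>c f z k. c * f z k)"
  by (simp add: bergman_space_def fun_eq_iff)

lemma bergman_Hilbert:
  assumes \<beta>: "-2 < \<beta>"
  shows "complex_hilbert_space (bergman_space \<beta> l2)"
proof -
  interpret W: pos_weight "coeff_weight \<beta>"
    by unfold_locales (simp add: coeff_weight_def bergman_weight_pos[OF \<beta>])
  show ?thesis
  proof (rule W.wl2.isometric_image_Hilbert[where P = series_fun])
    show "vector_space (hscale (bergman_space \<beta> l2))"
      unfolding bergman_scale by unfold_locales (auto simp: fun_eq_iff algebra_simps)
  qed (use \<beta> in \<open>auto simp: bergman_carrier bergman_inner bergman_scale series_fun_add series_fun_scale\<close>)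
qed


section \<open>Defect forms of Moebius transforms of weighted shifts\<close>

definition shift :: "(nat \<times> nat \<Rightarrow> complex) \<Rightarrow> nat \<times> nat \<Rightarrow> complex" where
  "shift X = (\<lambda>(n, k). case n of 0 \<Rightarrow> 0 | Suc m \<Rightarrow> X (m, k))"

text \<open>The adjoint of \<open>shift\<close> in \<open>A\<^sup>2\<^sub>\<alpha>\<close>; the factor is the ratio of the weights at \<open>n + 1\<close> and \<open>n\<close>.\<close>

definition bshift :: "real \<Rightarrow> (nat \<times> nat \<Rightarrow> complex) \<Rightarrow> nat \<times> nat \<Rightarrow> complex" where
  "bshift \<alpha> X = (\<lambda>(n, k). of_real ((real n + 1) / (real n + \<alpha> + 2)) * X (Suc n, k))"

text \<open>Any infinite family of distinct points in \<open>(0, 1/4]\<close> serves. The bound \<open>1/4\<close> makes the Moebius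
  transform uniformly invertible: it beats the bound \<open>\<surd>2\<close> for the norm of the backward shift in \<open>bshift_V_bound\<close>.\<close>

definition zero_at :: "nat \<Rightarrow> real" where
  "zero_at k = 1 / (real k + 4)"

definition diag :: "(nat \<times> nat \<Rightarrow> complex) \<Rightarrow> nat \<times> nat \<Rightarrow> complex" where
  "diag X = (\<lambda>(n, k). of_real (zero_at k) * X (n, k))"

lemma shift_simps [simp]: "shift X (0, k) = 0" "shift X (Suc n, k) = X (n, k)"
  by (simp_all add: shift_def)

lemma zero_at_bounds: "0 < zero_at k" "zero_at k \<le> 1 / 4"
  by (simp_all add: zero_at_def)

lemma zero_at_square_le: "(zero_at k)\<^sup>2 \<le> 1 / 16"
  using power_mono[OF zero_at_bounds(2), of k 2] zero_at_bounds(1)[of k]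
  by (simp add: power2_eq_square)

lemma shift_diff: "shift (X - Y) = shift X - shift Y"
  by (auto simp: shift_def fun_eq_iff split: nat.split)

lemma bshift_diff: "bshift \<alpha> (X - Y) = bshift \<alpha> X - bshift \<alpha> Y"
  by (simp add: bshift_def fun_eq_iff right_diff_distrib)

lemma diag_diff: "diag (X - Y) = diag X - diag Y"
  by (auto simp: diag_def fun_eq_iff algebra_simps)

lemma diag_shift: "diag (shift X) = shift (diag X)"
  by (auto simp: diag_def shift_def fun_eq_iff split: nat.split)

lemma diag_bshift: "diag (bshift \<alpha> X) = bshift \<alpha> (diag X)"
  by (auto simp: diag_def bshift_def fun_eq_iff)

text \<open>The change of variables behind all computations with the two shifts.\<close>

lemma has_sum_drop_first_row:
  fixes g :: "nat \<times> nat \<Rightarrow> 'a::{comm_monoid_add, topological_space}"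
  assumes "\<And>k. g (0, k) = 0"
  shows "(g has_sum s) UNIV \<longleftrightarrow> ((\<lambda>(n, k). g (Suc n, k)) has_sum s) UNIV"
proof -
  let ?h = "\<lambda>(n, k). (Suc n, k) :: nat \<times> nat"
  have inj: "inj ?h" by (auto simp: inj_def)
  have "(g has_sum s) UNIV \<longleftrightarrow> (g has_sum s) (range ?h)"
  proof (rule has_sum_cong_neutral)
    fix p assume p: "p \<in> UNIV - range ?h"
    obtain n k where nk: "p = (n, k)" by (cases p)
    have "n = 0"
    proof (cases n)
      case (Suc m)
      then have "p = ?h (m, k)" using nk by simp
      then show ?thesis using p by blast
    qed
    then show "g p = 0" using assms nk by simp
  qed auto
  also have "\<dots> \<longleftrightarrow> ((g \<circ> ?h) has_sum s) UNIV" by (rule has_sum_reindex[OF inj])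
  also have "g \<circ> ?h = (\<lambda>(n, k). g (Suc n, k))" by auto
  finally show ?thesis .
qed

lemma summable_on_drop_first_row:
  fixes g :: "nat \<times> nat \<Rightarrow> 'a::{comm_monoid_add, topological_space}"
  assumes "\<And>k. g (0, k) = 0"
  shows "g summable_on UNIV \<longleftrightarrow> (\<lambda>(n, k). g (Suc n, k)) summable_on UNIV"
  using has_sum_drop_first_row[where g = g, OF assms] by (simp add: summable_on_def)

lemma infsum_drop_first_row:
  fixes g :: "nat \<times> nat \<Rightarrow> 'a::{comm_monoid_add, t2_space}"
  assumes "\<And>k. g (0, k) = 0"
  shows "infsum g UNIV = (\<Sum>\<^sub>\<infinity>(n, k). g (Suc n, k))"
proof (cases "g summable_on UNIV")
  case True
  then show ?thesis using has_sum_drop_first_row[where g = g, OF assms] by (metis has_sum_infsum infsumI)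
next
  case False
  then show ?thesis using summable_on_drop_first_row[where g = g, OF assms] by (metis infsum_not_exists)
qed

text \<open>The weights \<open>w\<close> of \<open>A\<^sup>2\<^sub>\<alpha>\<close> together with the weights \<open>v\<close> of the norm to which
  both defect forms are comparable.\<close>

locale bergman_pair =
  fixes \<alpha> :: real
  assumes alpha: "-1 < \<alpha>"
begin

abbreviation "w \<equiv> coeff_weight \<alpha>"

definition v :: "nat \<times> nat \<Rightarrow> real" where
  "v p = w p / (real (fst p) + 1)"

abbreviation "carr_w \<equiv> hcarrier (wl2 w)"
abbreviation "carr_v \<equiv> hcarrier (wl2 v)"
abbreviation "norm_w \<equiv> hnorm (wl2 w)"
abbreviation "norm_v \<equiv> hnorm (wl2 v)"

lemma w_pos: "0 < w p"
  using alpha by (simp add: coeff_weight_def bergman_weight_pos)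

lemma v_pos: "0 < v p"
  using w_pos[of p] by (simp add: v_def)

sublocale W: pos_weight w by unfold_locales (rule w_pos)
sublocale V: pos_weight v by unfold_locales (rule v_pos)

lemma w_Suc: "w (Suc n, k) = w (n, k) * ((real n + 1) / (real n + \<alpha> + 2))"
  using alpha by (simp add: coeff_weight_def bergman_weight_Suc)

lemma W_subset_V: "X \<in> carr_w \<Longrightarrow> X \<in> carr_v"
proof (rule wl2_dominated(1)[where K = 1, OF v_pos w_pos])
  show "v p * (cmod (X p))\<^sup>2 \<le> 1 * (w p * (cmod (X p))\<^sup>2)" for p
  proof -
    have "v p \<le> w p" using w_pos[of p] by (simp add: v_def divide_le_eq distrib_left)
    then show ?thesis by (simp add: mult_right_mono)
  qed
qed

lemma diag_bound:
  assumes u: "\<And>p. 0 < u p" and X: "X \<in> hcarrier (wl2 u)"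
  shows "diag X \<in> hcarrier (wl2 u)" "(hnorm (wl2 u) (diag X))\<^sup>2 \<le> 1/16 * (hnorm (wl2 u) X)\<^sup>2"
proof -
  have "u p * (cmod (diag X p))\<^sup>2 \<le> 1/16 * (u p * (cmod (X p))\<^sup>2)" for p
  proof -
    have "(cmod (diag X p))\<^sup>2 = (zero_at (snd p))\<^sup>2 * (cmod (X p))\<^sup>2"
      by (simp add: diag_def split_beta norm_mult power_mult_distrib)
    also have "\<dots> \<le> 1/16 * (cmod (X p))\<^sup>2" by (intro mult_right_mono zero_at_square_le) simp
    finally have "u p * (cmod (diag X p))\<^sup>2 \<le> u p * (1/16 * (cmod (X p))\<^sup>2)"
      by (rule mult_left_mono) (use u[of p] in simp)
    then show ?thesis by simp
  qed
  then show "diag X \<in> hcarrier (wl2 u)" "(hnorm (wl2 u) (diag X))\<^sup>2 \<le> 1/16 * (hnorm (wl2 u) X)\<^sup>2"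
    using wl2_dominated[where w = u and v = u, OF u u X] by blast+
qed

lemmas W_diag [simp] = diag_bound(1)[OF w_pos]

lemma diag_self_adjoint: "hinner (wl2 w) (diag X) Y = hinner (wl2 w) X (diag Y)"
  unfolding wl2_inner by (intro infsum_cong) (simp add: diag_def split_beta)

lemma damped_norm_defect:
  assumes X: "X \<in> carr_w" and r: "\<And>p. 0 \<le> r p" "\<And>p. r p \<le> 1"
  shows "(\<lambda>p. w p * r p * (cmod (X p))\<^sup>2) summable_on UNIV"
    "(norm_w X)\<^sup>2 - (\<Sum>\<^sub>\<infinity>p. w p * r p * (cmod (X p))\<^sup>2)
      = (\<Sum>\<^sub>\<infinity>p. w p * (1 - r p) * (cmod (X p))\<^sup>2)"
proof -
  have sX: "(\<lambda>p. w p * (cmod (X p))\<^sup>2) summable_on UNIV" using X by (simp add: wl2_mem)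
  show s: "(\<lambda>p. w p * r p * (cmod (X p))\<^sup>2) summable_on UNIV"
  proof (rule summable_on_comparison_test[OF sX])
    fix p
    have "w p * r p \<le> w p * 1" using r(2)[of p] w_pos[of p] by (intro mult_left_mono) auto
    then show "w p * r p * (cmod (X p))\<^sup>2 \<le> w p * (cmod (X p))\<^sup>2"
      by (intro mult_right_mono) auto
    show "0 \<le> w p * r p * (cmod (X p))\<^sup>2" using r(1)[of p] w_pos[of p] by simp
  qed
  have "(\<Sum>\<^sub>\<infinity>p. w p * (1 - r p) * (cmod (X p))\<^sup>2)
      = (\<Sum>\<^sub>\<infinity>p. w p * (cmod (X p))\<^sup>2 + - (w p * r p * (cmod (X p))\<^sup>2))"
    by (intro infsum_cong) (simp add: algebra_simps)
  also have "\<dots> = (\<Sum>\<^sub>\<infinity>p. w p * (cmod (X p))\<^sup>2) + (\<Sum>\<^sub>\<infinity>p. - (w p * r p * (cmod (X p))\<^sup>2))"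
    by (rule infsum_add[OF sX summable_on_uminus[THEN iffD2, OF s]])
  finally show "(norm_w X)\<^sup>2 - (\<Sum>\<^sub>\<infinity>p. w p * r p * (cmod (X p))\<^sup>2)
      = (\<Sum>\<^sub>\<infinity>p. w p * (1 - r p) * (cmod (X p))\<^sup>2)"
    unfolding W.norm_sq infsum_uminus by simp
qed

lemma shift_defect:
  assumes X: "X \<in> carr_w"
  shows "shift X \<in> carr_w"
    "(norm_w X)\<^sup>2 - (norm_w (shift X))\<^sup>2
      = (\<Sum>\<^sub>\<infinity>p. w p * ((\<alpha> + 1) / (real (fst p) + \<alpha> + 2)) * (cmod (X p))\<^sup>2)"
proof -
  define r where "r p = (real (fst p) + 1) / (real (fst p) + \<alpha> + 2)" for p :: "nat \<times> nat"
  have r: "0 \<le> r p" "r p \<le> 1" "1 - r p = (\<alpha> + 1) / (real (fst p) + \<alpha> + 2)" for p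
    using alpha by (simp_all add: r_def field_simps)
  note s = damped_norm_defect[of X r, OF X r(1,2)]
  let ?g = "\<lambda>p. w p * (cmod (shift X p))\<^sup>2"
  have g0: "?g (0, k) = 0" for k by simp
  have gS: "(\<lambda>(n, k). ?g (Suc n, k)) = (\<lambda>p. w p * r p * (cmod (X p))\<^sup>2)"
    by (auto simp: w_Suc r_def split_beta fun_eq_iff)
  show "shift X \<in> carr_w"
    using summable_on_drop_first_row[of ?g, OF g0] gS s(1) by (simp add: wl2_mem)
  show "(norm_w X)\<^sup>2 - (norm_w (shift X))\<^sup>2
      = (\<Sum>\<^sub>\<infinity>p. w p * ((\<alpha> + 1) / (real (fst p) + \<alpha> + 2)) * (cmod (X p))\<^sup>2)"
    using s(2) unfolding W.norm_sq[of "shift X"] infsum_drop_first_row[of ?g, OF g0] gS r(3) .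
qed

lemma bshift_defect:
  assumes X: "X \<in> carr_w"
  shows "bshift \<alpha> X \<in> carr_w"
    "(norm_w X)\<^sup>2 - (norm_w (bshift \<alpha> X))\<^sup>2
      = (\<Sum>\<^sub>\<infinity>p. w p * ((\<alpha> + 1) / (real (fst p) + \<alpha> + 1)) * (cmod (X p))\<^sup>2)"
proof -
  define r where "r p = real (fst p) / (real (fst p) + \<alpha> + 1)" for p :: "nat \<times> nat"
  have r: "0 \<le> r p" "r p \<le> 1" "1 - r p = (\<alpha> + 1) / (real (fst p) + \<alpha> + 1)" for p
    using alpha by (simp_all add: r_def field_simps)
  note s = damped_norm_defect[of X r, OF X r(1,2)]
  \<comment> \<open>\<open>?g\<close> vanishes in the first row, and moved up by one row it becomes the summand \<open>?f\<close>.\<close>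
  let ?g = "\<lambda>p. w p * r p * (cmod (X p))\<^sup>2"
  let ?f = "\<lambda>p. w p * (cmod (bshift \<alpha> X p))\<^sup>2"
  have g0: "?g (0, k) = 0" for k by (simp add: r_def)
  have gS: "(\<lambda>(n, k). ?g (Suc n, k)) = ?f"
  proof (rule ext, clarify)
    fix n k
    define \<rho> where "\<rho> = (real n + 1) / (real n + \<alpha> + 2)"
    have "r (Suc n, k) = \<rho>" by (simp add: r_def \<rho>_def algebra_simps)
    moreover have "w (Suc n, k) = w (n, k) * \<rho>" by (simp add: w_Suc \<rho>_def)
    moreover have "cmod (bshift \<alpha> X (n, k)) = \<rho> * cmod (X (Suc n, k))"
      using alpha unfolding bshift_def split_conv norm_mult norm_of_real \<rho>_def[symmetric]
      by (simp add: \<rho>_def)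
    ultimately show "?g (Suc n, k) = ?f (n, k)" by (simp add: power2_eq_square)
  qed
  show "bshift \<alpha> X \<in> carr_w"
    using summable_on_drop_first_row[of ?g, OF g0] gS s(1) by (simp add: wl2_mem)
  show "(norm_w X)\<^sup>2 - (norm_w (bshift \<alpha> X))\<^sup>2
      = (\<Sum>\<^sub>\<infinity>p. w p * ((\<alpha> + 1) / (real (fst p) + \<alpha> + 1)) * (cmod (X p))\<^sup>2)"
    using s(2) unfolding W.norm_sq[of "bshift \<alpha> X"] infsum_drop_first_row[of ?g, OF g0] gS r(3) .
qed

lemma shift_adjoint:
  "hinner (wl2 w) (shift X) Y = hinner (wl2 w) X (bshift \<alpha> Y)"
proof -
  let ?g = "\<lambda>p. of_real (w p) * (shift X p * cnj (Y p))"
  have "infsum ?g UNIV = (\<Sum>\<^sub>\<infinity>(n, k). ?g (Suc n, k))"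
    by (rule infsum_drop_first_row) simp
  also have "\<dots> = (\<Sum>\<^sub>\<infinity>p. of_real (w p) * (X p * cnj (bshift \<alpha> Y p)))"
    by (intro infsum_cong) (auto simp: w_Suc bshift_def)
  finally show ?thesis by (simp add: wl2_inner)
qed

lemma shift_V_bound:
  assumes X: "X \<in> carr_v"
  shows "shift X \<in> carr_v" "(norm_v (shift X))\<^sup>2 \<le> 2 * (norm_v X)\<^sup>2"
proof -
  have sX: "(\<lambda>p. v p * (cmod (X p))\<^sup>2) summable_on UNIV" using X by (simp add: wl2_mem)
  let ?g = "\<lambda>p. v p * (cmod (shift X p))\<^sup>2"
  let ?g' = "\<lambda>(n, k). ?g (Suc n, k)"
  have g0: "?g (0, k) = 0" for k by simp
  have vS: "v (Suc n, k) \<le> v (n, k)" for n k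
  proof -
    have "v (Suc n, k) = w (n, k) * ((real n + 1) / (real n + \<alpha> + 2)) / (real n + 2)"
      by (simp add: v_def w_Suc)
    also have "\<dots> \<le> w (n, k) * 1 / (real n + 1)"
      using alpha w_pos[of "(n, k)"] by (intro frac_le mult_left_mono) auto
    finally show ?thesis by (simp add: v_def)
  qed
  have le: "?g' p \<le> v p * (cmod (X p))\<^sup>2" for p
    using vS by (cases p) (auto intro: mult_right_mono)
  have s': "?g' summable_on UNIV"
    by (rule summable_on_comparison_test[OF sX]) (use le v_pos in \<open>auto simp: less_imp_le\<close>)
  then show "shift X \<in> carr_v"
    using summable_on_drop_first_row[of ?g, OF g0] by (simp add: wl2_mem)
  have "(norm_v (shift X))\<^sup>2 = infsum ?g' UNIV"
    unfolding V.norm_sq by (rule infsum_drop_first_row[of ?g, OF g0])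
  also have "\<dots> \<le> (norm_v X)\<^sup>2"
    unfolding V.norm_sq by (rule infsum_mono[OF s' sX le])
  finally show "(norm_v (shift X))\<^sup>2 \<le> 2 * (norm_v X)\<^sup>2"
    using zero_le_power2[of "norm_v X"] by linarith
qed

text \<open>Here \<open>\<alpha>\<close> may be close to \<open>-1\<close>: with the weights \<open>w p / (n + \<alpha> + 1)\<close> of the defect form itself
  the norm of the backward shift blows up at \<open>n = 0\<close>, which is why \<open>v\<close> has the denominator \<open>n + 1\<close>
  for all \<open>\<alpha>\<close>.\<close>

lemma bshift_V_bound:
  assumes X: "X \<in> carr_v"
  shows "bshift \<alpha> X \<in> carr_v"
    "(norm_v (bshift \<alpha> X))\<^sup>2 \<le> 2 * (norm_v X)\<^sup>2"
proof -
  have sX: "(\<lambda>p. 2 * (v p * (cmod (X p))\<^sup>2)) summable_on UNIV"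
    using X by (intro summable_on_cmult_right) (simp add: wl2_mem)
  let ?g = "\<lambda>p. if fst p = 0 then 0 else w p / (real (fst p) + \<alpha> + 1) * (cmod (X p))\<^sup>2"
  let ?f = "\<lambda>p. v p * (cmod (bshift \<alpha> X p))\<^sup>2"
  have g0: "?g (0, k) = 0" for k by simp
  have gS: "(\<lambda>(n, k). ?g (Suc n, k)) = ?f"
  proof (rule ext, clarify)
    fix n k
    define \<rho> where "\<rho> = (real n + 1) / (real n + \<alpha> + 2)"
    have "w (Suc n, k) / (real (Suc n) + \<alpha> + 1) = v (n, k) * \<rho>\<^sup>2"
    proof -
      define d where "d = real n + \<alpha> + 2"
      have "0 < d" "real (Suc n) + \<alpha> + 1 = d" using alpha by (simp_all add: d_def)
      then show ?thesis by (simp add: w_Suc v_def \<rho>_def power2_eq_square flip: d_def)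
    qed
    moreover have "cmod (bshift \<alpha> X (n, k)) = \<rho> * cmod (X (Suc n, k))"
      using alpha unfolding bshift_def split_conv norm_mult norm_of_real \<rho>_def[symmetric]
      by (simp add: \<rho>_def)
    ultimately show "?g (Suc n, k) = ?f (n, k)" by (simp add: power_mult_distrib)
  qed
  have le: "?g p \<le> 2 * (v p * (cmod (X p))\<^sup>2)" for p
  proof (cases "fst p = 0")
    case True
    then show ?thesis using v_pos[of p] by simp
  next
    case False
    then have "1 \<le> real (fst p)" by simp
    then have "w p / (real (fst p) + \<alpha> + 1) \<le> w p / ((real (fst p) + 1) / 2)"
      using alpha w_pos[of p] by (intro divide_left_mono) auto
    then have "w p / (real (fst p) + \<alpha> + 1) \<le> 2 * v p" by (simp add: v_def mult.commute)
    then have "w p / (real (fst p) + \<alpha> + 1) * (cmod (X p))\<^sup>2 \<le> 2 * v p * (cmod (X p))\<^sup>2"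
      by (rule mult_right_mono) simp
    then show ?thesis using False by (simp add: mult.assoc)
  qed
  have s': "?g summable_on UNIV"
    by (rule summable_on_comparison_test[OF sX le]) (use alpha w_pos in \<open>auto simp: less_imp_le\<close>)
  then show "bshift \<alpha> X \<in> carr_v"
    using summable_on_drop_first_row[of ?g, OF g0] gS by (simp add: wl2_mem)
  have "(norm_v (bshift \<alpha> X))\<^sup>2 = infsum ?g UNIV"
    unfolding V.norm_sq using infsum_drop_first_row[of ?g, OF g0] gS by simp
  also have "\<dots> \<le> 2 * (norm_v X)\<^sup>2"
    unfolding V.norm_sq infsum_cmult_right'[symmetric] by (rule infsum_mono[OF s' sX le])
  finally show "(norm_v (bshift \<alpha> X))\<^sup>2 \<le> 2 * (norm_v X)\<^sup>2" .
qed

lemma weight_ratio_bounds: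
  fixes n :: nat
  defines "m \<equiv> min 1 (\<alpha> + 1)" and "M \<equiv> max 1 (\<alpha> + 1)"
  shows "0 < m" "m \<le> (\<alpha> + 1) * (real n + 1) / (real n + \<alpha> + 1)"
    "(\<alpha> + 1) * (real n + 1) / (real n + \<alpha> + 1) \<le> M"
proof -
  show "0 < m" using alpha by (simp add: m_def)
  have d: "0 < real n + \<alpha> + 1" using alpha by simp
  show "m \<le> (\<alpha> + 1) * (real n + 1) / (real n + \<alpha> + 1)"
  proof (cases "\<alpha> \<le> 0")
    case True
    then have "m = \<alpha> + 1" by (simp add: m_def)
    moreover have "(\<alpha> + 1) * (real n + \<alpha> + 1) \<le> (\<alpha> + 1) * (real n + 1)"
      using True alpha by (intro mult_left_mono) auto
    ultimately show ?thesis using d by (simp add: le_divide_eq)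
  next
    case False
    then show ?thesis using d by (simp add: m_def le_divide_eq algebra_simps)
  qed
  show "(\<alpha> + 1) * (real n + 1) / (real n + \<alpha> + 1) \<le> M"
  proof (cases "\<alpha> \<le> 0")
    case True
    then have "\<alpha> * real n \<le> 0" by (simp add: mult_nonpos_nonneg)
    then show ?thesis using d True by (simp add: M_def divide_le_eq algebra_simps)
  next
    case False
    then have "M = \<alpha> + 1" by (simp add: M_def)
    moreover have "(\<alpha> + 1) * (real n + 1) \<le> (\<alpha> + 1) * (real n + \<alpha> + 1)"
      using False by (intro mult_left_mono) auto
    ultimately show ?thesis using d by (simp add: divide_le_eq)
  qed
qed

text \<open>The vectors \<open>X\<close> are parametrised as \<open>(1 - A S) Y\<close> with \<open>A = diag\<close>, where the Moebius transform
  \<open>(S - A)(1 - A S)\<^sup>-\<^sup>1\<close> takes the value \<open>(S - A) Y\<close>. So this says that the defect form of the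
  transform is comparable to the squared norm with weights \<open>v\<close>.\<close>

definition comparable_defect ::
    "((nat \<times> nat \<Rightarrow> complex) \<Rightarrow> nat \<times> nat \<Rightarrow> complex) \<Rightarrow> bool" where
  "comparable_defect S \<longleftrightarrow> (\<exists>c1>0. \<exists>c2. \<forall>X\<in>carr_w. \<exists>Y\<in>carr_w.
     Y - diag (S Y) = X \<and>
     c1 * (norm_v X)\<^sup>2 \<le> (norm_w X)\<^sup>2 - (norm_w (S Y - diag Y))\<^sup>2 \<and>
     (norm_w X)\<^sup>2 - (norm_w (S Y - diag Y))\<^sup>2 \<le> c2 * (norm_v X)\<^sup>2)"

lemma comparable_defect_onto:
  assumes "comparable_defect S" "X \<in> carr_w"
  obtains Y where "Y \<in> carr_w" "Y - diag (S Y) = X"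
    "norm_w (S Y - diag Y) \<le> norm_w X"
proof -
  obtain c1 Y where "0 < c1" and Y: "Y \<in> carr_w" "Y - diag (S Y) = X"
    and le: "c1 * (norm_v X)\<^sup>2 \<le> (norm_w X)\<^sup>2 - (norm_w (S Y - diag Y))\<^sup>2"
    using assms unfolding comparable_defect_def by blast
  have "0 \<le> c1 * (norm_v X)\<^sup>2" using \<open>0 < c1\<close> by simp
  then have "(norm_w (S Y - diag Y))\<^sup>2 \<le> (norm_w X)\<^sup>2" using le by linarith
  then have "norm_w (S Y - diag Y) \<le> norm_w X"
    by (rule power2_le_imp_le) (use assms in simp)
  then show thesis using that Y by blast
qed

text \<open>Stated for an operator \<open>S\<close> that can be the shift or its adjoint, with \<open>A = diag\<close>. Expanding
  \<open>\<parallel>Y - A S Y\<parallel>\<^sup>2 - \<parallel>S Y - A Y\<parallel>\<^sup>2\<close>, the cross terms \<open>\<langle>Y, A S Y\<rangle>\<close> and \<open>\<langle>S Y, A Y\<rangle>\<close> have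
  the same real part since \<open>A\<close> is self-adjoint; as \<open>A\<close> commutes with \<open>S\<close>, what remains is
  \<open>Q(Y) - Q(A Y)\<close> with \<open>Q(Y) = \<parallel>Y\<parallel>\<^sup>2 - \<parallel>S Y\<parallel>\<^sup>2\<close>. Since \<open>Q\<close> is diagonal, \<open>0 \<le> Q(A Y) \<le> Q(Y)/16\<close>.
  Finally \<open>\<parallel>A S\<parallel> \<le> \<surd>2/4 \<le> 1/2\<close> in the norm with weights \<open>v\<close>, so that \<open>Y\<close> and
  \<open>X = Y - A S Y\<close> have comparable norms there.\<close>

lemma mobius_defect_bounds:
  fixes S :: "(nat \<times> nat \<Rightarrow> complex) \<Rightarrow> nat \<times> nat \<Rightarrow> complex" and q :: "nat \<times> nat \<Rightarrow> real"
  assumes SW: "\<And>X. X \<in> carr_w \<Longrightarrow> S X \<in> carr_w"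
    and Sd: "\<And>X Y. S (X - Y) = S X - S Y"
    and SA: "\<And>X. diag (S X) = S (diag X)"
    and Q: "\<And>X. X \<in> carr_w \<Longrightarrow>
        (norm_w X)\<^sup>2 - (norm_w (S X))\<^sup>2 = (\<Sum>\<^sub>\<infinity>p. q p * (cmod (X p))\<^sup>2)"
    and lo: "0 < lo" "\<And>p. lo * v p \<le> q p" and hi: "\<And>p. q p \<le> hi * v p"
    and SV: "\<And>X. X \<in> carr_v \<Longrightarrow> S X \<in> carr_v"
      "\<And>X. X \<in> carr_v \<Longrightarrow> (norm_v (S X))\<^sup>2 \<le> 2 * (norm_v X)\<^sup>2"
  shows "comparable_defect S"
proof -
  have q0: "0 \<le> q p" for p 
    using less_imp_le[OF mult_pos_pos[OF lo(1) v_pos[of p]]] lo(2)[of p] by (rule order_trans)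
  have S_contr: "norm_w (S X) \<le> norm_w X" if "X \<in> carr_w" for X
  proof (rule power2_le_imp_le)
    have "0 \<le> (\<Sum>\<^sub>\<infinity>p. q p * (cmod (X p))\<^sup>2)" using q0 by (intro infsum_nonneg) auto
    then show "(norm_w (S X))\<^sup>2 \<le> (norm_w X)\<^sup>2" using Q[OF that] by linarith
  qed (use that in simp)
  have diag_norm: "norm_w (diag X) \<le> 1/4 * norm_w X" if "X \<in> carr_w" for X
  proof (rule power2_le_imp_le)
    show "(norm_w (diag X))\<^sup>2 \<le> (1/4 * norm_w X)\<^sup>2"
      using diag_bound(2)[OF w_pos that] by (simp add: power_divide)
  qed (use that in simp)
  have "\<exists>Y\<in>carr_w. Y - diag (S Y) = X \<and>
      lo / 8 * (norm_v X)\<^sup>2 \<le> (norm_w X)\<^sup>2 - (norm_w (S Y - diag Y))\<^sup>2 \<and>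
      (norm_w X)\<^sup>2 - (norm_w (S Y - diag Y))\<^sup>2 \<le> 4 * hi * (norm_v X)\<^sup>2"
    if X: "X \<in> carr_w" for X
  proof -
    obtain Y where Y: "Y \<in> carr_w" and YX: "Y - diag (S Y) = X"
    proof -
      have "\<exists>Y\<in>carr_w. Y - diag (S Y) = X"
      proof (rule W.wl2.one_minus_strict_contraction_onto[where q = "1/4"])
        show "norm_w (diag (S Z)) \<le> 1/4 * norm_w Z" if "Z \<in> carr_w" for Z
          using diag_norm[OF SW[OF that]] S_contr[OF that] by linarith
      qed (use X SW in \<open>auto simp: Sd diag_diff\<close>)
      then show thesis using that by blast
    qed
    define s t r where "s = S Y" and "t = diag Y" and "r = diag (S Y)"
    have m: "s \<in> carr_w" "t \<in> carr_w" "r \<in> carr_w"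
      using Y SW by (auto simp: s_def t_def r_def)
    have "hinner (wl2 w) Y r = hinner (wl2 w) t s"
      by (simp add: r_def t_def s_def diag_self_adjoint)
    then have "Re (hinner (wl2 w) Y r) = Re (hinner (wl2 w) s t)"
      using W.wl2.Re_inner_commute[OF m(1,2)] by simp
    then have eq: "(norm_w X)\<^sup>2 - (norm_w (s - t))\<^sup>2
        = ((norm_w Y)\<^sup>2 - (norm_w s)\<^sup>2) - ((norm_w t)\<^sup>2 - (norm_w r)\<^sup>2)"
      using W.wl2.norm_squared_diff[OF Y m(3)] W.wl2.norm_squared_diff[OF m(1,2)] YX
      by (simp add: r_def)
    have rt: "r = S t" by (simp add: r_def t_def SA)
    define QY QT where "QY = (\<Sum>\<^sub>\<infinity>p. q p * (cmod (Y p))\<^sup>2)" and "QT = (\<Sum>\<^sub>\<infinity>p. q p * (cmod (t p))\<^sup>2)"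
    have D: "(norm_w X)\<^sup>2 - (norm_w (s - t))\<^sup>2 = QY - QT"
      using eq Q[OF Y] Q[OF m(2)] unfolding rt QY_def QT_def s_def by simp
    have YV: "Y \<in> carr_v" by (rule W_subset_V[OF Y])
    have sYV: "(\<lambda>p. v p * (cmod (Y p))\<^sup>2) summable_on UNIV" using YV by (simp add: wl2_mem)
    have sq: "(\<lambda>p. q p * (cmod (Y p))\<^sup>2) summable_on UNIV"
    proof (rule summable_on_comparison_test)
      show "(\<lambda>p. hi * (v p * (cmod (Y p))\<^sup>2)) summable_on UNIV"
        by (rule summable_on_cmult_right[OF sYV])
      show "q p * (cmod (Y p))\<^sup>2 \<le> hi * (v p * (cmod (Y p))\<^sup>2)" for p
        using mult_right_mono[OF hi[of p], of "(cmod (Y p))\<^sup>2"] by (simp add: mult.assoc)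
    qed (use q0 in auto)
    have QT_le: "QT \<le> 1/16 * QY" and QT0: "0 \<le> QT"
    proof -
      have le: "q p * (cmod (t p))\<^sup>2 \<le> 1/16 * (q p * (cmod (Y p))\<^sup>2)" for p
      proof -
        have "(cmod (t p))\<^sup>2 = (zero_at (snd p))\<^sup>2 * (cmod (Y p))\<^sup>2"
          by (simp add: t_def diag_def split_beta norm_mult power_mult_distrib)
        also have "\<dots> \<le> 1/16 * (cmod (Y p))\<^sup>2" by (intro mult_right_mono zero_at_square_le) simp
        finally have "q p * (cmod (t p))\<^sup>2 \<le> q p * (1/16 * (cmod (Y p))\<^sup>2)"
          by (rule mult_left_mono) (rule q0)
        then show ?thesis by simp
      qed
      have s16: "(\<lambda>p. 1/16 * (q p * (cmod (Y p))\<^sup>2)) summable_on UNIV"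
        by (rule summable_on_cmult_right[OF sq])
      then have "(\<lambda>p. q p * (cmod (t p))\<^sup>2) summable_on UNIV"
        by (rule summable_on_comparison_test) (use le q0 in auto)
      then show "QT \<le> 1/16 * QY"
        unfolding QT_def QY_def infsum_cmult_right'[symmetric] by (rule infsum_mono[OF _ s16 le])
      show "0 \<le> QT" unfolding QT_def using q0 by (intro infsum_nonneg) auto
    qed
    have QY_lo: "lo * (norm_v Y)\<^sup>2 \<le> QY"
      unfolding V.norm_sq QY_def infsum_cmult_right'[symmetric]
    proof (rule infsum_mono[OF summable_on_cmult_right[OF sYV] sq])
      show "lo * (v p * (cmod (Y p))\<^sup>2) \<le> q p * (cmod (Y p))\<^sup>2" for p
        using mult_right_mono[OF lo(2)[of p], of "(cmod (Y p))\<^sup>2"] by (simp add: mult.assoc)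
    qed
    have QY_hi: "QY \<le> hi * (norm_v Y)\<^sup>2"
      unfolding V.norm_sq QY_def infsum_cmult_right'[symmetric]
    proof (rule infsum_mono[OF sq summable_on_cmult_right[OF sYV]])
      show "q p * (cmod (Y p))\<^sup>2 \<le> hi * (v p * (cmod (Y p))\<^sup>2)" for p
        using mult_right_mono[OF hi[of p], of "(cmod (Y p))\<^sup>2"] by (simp add: mult.assoc)
    qed
    define ny nx nr where "ny = norm_v Y" and "nx = norm_v X" and "nr = norm_v r"
    have rV: "r \<in> carr_v" unfolding r_def by (intro diag_bound(1)[OF v_pos] SV(1) YV)
    have nonneg: "0 \<le> ny" "0 \<le> nx" "0 \<le> nr"
      using YV rV W_subset_V[OF X] by (auto simp: ny_def nx_def nr_def)
    have nr_le: "nr \<le> ny / 2"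
    proof (rule power2_le_imp_le)
      have "nr\<^sup>2 \<le> 1/16 * (2 * ny\<^sup>2)"
        unfolding nr_def r_def ny_def
        using diag_bound(2)[OF v_pos SV(1)[OF YV]] SV(2)[OF YV] by linarith
      moreover have "(ny / 2)\<^sup>2 = ny\<^sup>2 / 4" by (simp add: power_divide)
      ultimately show "nr\<^sup>2 \<le> (ny / 2)\<^sup>2" using zero_le_power2[of nr] by linarith
    qed (use nonneg in simp)
    have Xr: "X = Y - r" using YX by (simp add: r_def)
    have "nx \<le> ny + nr" "ny \<le> nx + nr"
      unfolding nx_def ny_def nr_def Xr
      using V.wl2.norm_triangle_diff[OF YV rV] V.wl2.norm_triangle_diff2[OF YV rV] by auto
    then have "nx \<le> 2 * ny" "ny \<le> 2 * nx" using nr_le nonneg by linarith+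
    then have "nx\<^sup>2 \<le> (2 * ny)\<^sup>2" "ny\<^sup>2 \<le> (2 * nx)\<^sup>2" 
      using power_mono[OF _ nonneg(2), of "2 * ny" 2] power_mono[OF _ nonneg(1), of "2 * nx" 2] by blast+
    then have nn: "nx\<^sup>2 \<le> 4 * ny\<^sup>2" "ny\<^sup>2 \<le> 4 * nx\<^sup>2" by (auto simp: power_mult_distrib)
    have hi0: "0 \<le> hi"
      using order_trans[OF q0 hi, of "(0, 0)"] v_pos[of "(0, 0)"] by (simp add: zero_le_mult_iff)
    have "lo * nx\<^sup>2 \<le> 4 * QY"
    proof -
      have "lo * nx\<^sup>2 \<le> lo * (4 * ny\<^sup>2)" using lo(1) nn(1) by (intro mult_left_mono) auto
      also have "\<dots> \<le> 4 * QY" using QY_lo by (simp add: ny_def)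
      finally show ?thesis .
    qed
    moreover have "QY \<le> 4 * hi * nx\<^sup>2"
      using QY_hi mult_left_mono[OF nn(2) hi0] by (simp add: ny_def)
    ultimately have bounds: "lo / 8 * nx\<^sup>2 \<le> QY - QT" "QY - QT \<le> 4 * hi * nx\<^sup>2"
      using QT_le QT0 mult_nonneg_nonneg[OF less_imp_le[OF lo(1)] zero_le_power2[of nx]]
      unfolding times_divide_eq_left by linarith+
    show ?thesis
      by (intro bexI[OF _ Y] conjI YX; use bounds in \<open>simp only: D[unfolded s_def t_def] nx_def\<close>)
  qed
  then show ?thesis
    unfolding comparable_defect_def using lo(1)
    by (intro exI[of _ "lo / 8"] conjI exI[of _ "4 * hi"]) auto
qed

lemma comparable_defect_shift: "comparable_defect shift"
proof -
  define lo where "lo = (\<alpha> + 1) / (\<alpha> + 2)"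
  let ?q = "\<lambda>p. w p * ((\<alpha> + 1) / (real (fst p) + \<alpha> + 2))"
  have lo: "0 < lo" using alpha by (simp add: lo_def)
  have q_lo: "lo * v p \<le> ?q p" for p
  proof -
    let ?n = "real (fst p)"
    have "?n \<le> (\<alpha> + 2) * ?n" using alpha mult_right_mono[of 1 "\<alpha> + 2" ?n] by simp
    then have "?n + \<alpha> + 2 \<le> (\<alpha> + 2) * (?n + 1)" by (simp add: algebra_simps)
    then have "(\<alpha> + 1) / ((\<alpha> + 2) * (?n + 1)) \<le> (\<alpha> + 1) / (?n + \<alpha> + 2)"
      using alpha by (intro divide_left_mono mult_pos_pos) auto
    then have "w p * ((\<alpha> + 1) / ((\<alpha> + 2) * (?n + 1))) \<le> ?q p"
      using w_pos[of p] by (intro mult_left_mono) auto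
    moreover have "lo * v p = w p * ((\<alpha> + 1) / ((\<alpha> + 2) * (?n + 1)))"
      by (simp add: lo_def v_def)
    ultimately show ?thesis by simp
  qed
  have q_hi: "?q p \<le> (\<alpha> + 1) * v p" for p
  proof -
    have "(\<alpha> + 1) / (real (fst p) + \<alpha> + 2) \<le> (\<alpha> + 1) / (real (fst p) + 1)"
      using alpha by (intro divide_left_mono) auto
    then have "?q p \<le> w p * ((\<alpha> + 1) / (real (fst p) + 1))"
      using w_pos[of p] by (intro mult_left_mono) auto
    then show ?thesis by (simp add: v_def mult.commute)
  qed
  show ?thesis
    by (rule mobius_defect_bounds[OF shift_defect(1) shift_diff diag_shift shift_defect(2) lo q_lo q_hi
        shift_V_bound])
qed

lemma comparable_defect_bshift: "comparable_defect (bshift \<alpha>)"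
proof -
  define m M where "m = min 1 (\<alpha> + 1)" and "M = max 1 (\<alpha> + 1)"
  let ?q = "\<lambda>p. w p * ((\<alpha> + 1) / (real (fst p) + \<alpha> + 1))"
  note ratio = weight_ratio_bounds[folded m_def M_def]
  have q_eq: "?q p = (\<alpha> + 1) * (real (fst p) + 1) / (real (fst p) + \<alpha> + 1) * v p" for p
    by (simp add: v_def)
  have q_lo: "m * v p \<le> ?q p" for p
    unfolding q_eq by (rule mult_right_mono[OF ratio(2) less_imp_le[OF v_pos]])
  have q_hi: "?q p \<le> M * v p" for p
    unfolding q_eq by (rule mult_right_mono[OF ratio(3) less_imp_le[OF v_pos]])
  show ?thesis
    by (rule mobius_defect_bounds[OF bshift_defect(1) bshift_diff diag_bshift bshift_defect(2)
        ratio(1) q_lo q_hi bshift_V_bound])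
qed

lemma coeff_weight_lower: "coeff_weight (\<alpha> - 1) p = w p * ((real (fst p) + \<alpha> + 1) / (\<alpha> + 1))"
proof -
  obtain n k where p: "p = (n, k)" by (cases p)
  have "coeff_weight (\<alpha> - 1) (n, k) = w (n, k) * ((real n + \<alpha> + 1) / (\<alpha> + 1))"
  proof (induction n)
    case 0
    then show ?case using alpha by (simp add: coeff_weight_def bergman_weight_0)
  next
    case (Suc n)
    have "coeff_weight (\<alpha> - 1) (Suc n, k)
        = coeff_weight (\<alpha> - 1) (n, k) * ((real n + 1) / (real n + \<alpha> + 1))"
      using alpha by (simp add: coeff_weight_def bergman_weight_Suc algebra_simps)
    also have "\<dots> = w (n, k) * ((real n + 1) / (\<alpha> + 1))"
      unfolding Suc using alpha by simp
    also have "\<dots> = w (Suc n, k) * ((real (Suc n) + \<alpha> + 1) / (\<alpha> + 1))"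
    proof -
      define d where "d = real n + \<alpha> + 2"
      have "0 < d" "real (Suc n) + \<alpha> + 1 = d" using alpha by (simp_all add: d_def)
      then show ?thesis by (simp add: w_Suc flip: d_def)
    qed
    finally show ?case .
  qed
  then show ?thesis by (simp add: p)
qed

lemma smaller_bergman_mem_iff:
  "U \<in> coeff_arrays (\<alpha> - 1) \<longleftrightarrow>
    (\<lambda>p. w p * (real (fst p) + 1) * (cmod (U p))\<^sup>2) summable_on UNIV"
proof -
  define m M where "m = min 1 (\<alpha> + 1)" and "M = max 1 (\<alpha> + 1)"
  note ratio = weight_ratio_bounds[folded m_def M_def]
  have d: "0 < real (fst p) + \<alpha> + 1" for p :: "nat \<times> nat" using alpha by simp
  have nn: "0 \<le> coeff_weight (\<alpha> - 1) p" for p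
    using d[of p] w_pos[of p] alpha by (simp add: coeff_weight_lower)
  have up: "w p * (real (fst p) + 1) \<le> M * coeff_weight (\<alpha> - 1) p"
    and down: "m * coeff_weight (\<alpha> - 1) p \<le> w p * (real (fst p) + 1)" for p
  proof -
    have eq: "w p * (real (fst p) + 1)
        = (\<alpha> + 1) * (real (fst p) + 1) / (real (fst p) + \<alpha> + 1) * coeff_weight (\<alpha> - 1) p"
      using d[of p] alpha by (simp add: coeff_weight_lower)
    show "w p * (real (fst p) + 1) \<le> M * coeff_weight (\<alpha> - 1) p"
      "m * coeff_weight (\<alpha> - 1) p \<le> w p * (real (fst p) + 1)"
      unfolding eq by (rule mult_right_mono[OF ratio(3) nn], rule mult_right_mono[OF ratio(2) nn])
  qed
  show ?thesis
    unfolding wl2_mem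
  proof
    assume "(\<lambda>p. coeff_weight (\<alpha> - 1) p * (cmod (U p))\<^sup>2) summable_on UNIV"
    then have "(\<lambda>p. M * (coeff_weight (\<alpha> - 1) p * (cmod (U p))\<^sup>2)) summable_on UNIV"
      by (rule summable_on_cmult_right)
    then show "(\<lambda>p. w p * (real (fst p) + 1) * (cmod (U p))\<^sup>2) summable_on UNIV"
    proof (rule summable_on_comparison_test)
      show "w p * (real (fst p) + 1) * (cmod (U p))\<^sup>2
          \<le> M * (coeff_weight (\<alpha> - 1) p * (cmod (U p))\<^sup>2)" for p
        using mult_right_mono[OF up[of p], of "(cmod (U p))\<^sup>2"] by (simp add: mult.assoc)
    qed (simp add: less_imp_le[OF w_pos])
  next
    assume "(\<lambda>p. w p * (real (fst p) + 1) * (cmod (U p))\<^sup>2) summable_on UNIV"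
    then have "(\<lambda>p. 1 / m * (w p * (real (fst p) + 1) * (cmod (U p))\<^sup>2)) summable_on UNIV"
      by (rule summable_on_cmult_right)
    then show "(\<lambda>p. coeff_weight (\<alpha> - 1) p * (cmod (U p))\<^sup>2) summable_on UNIV"
    proof (rule summable_on_comparison_test)
      fix p
      have "m * coeff_weight (\<alpha> - 1) p * (cmod (U p))\<^sup>2 \<le> w p * (real (fst p) + 1) * (cmod (U p))\<^sup>2"
        by (rule mult_right_mono[OF down]) simp
      then show "coeff_weight (\<alpha> - 1) p * (cmod (U p))\<^sup>2
          \<le> 1 / m * (w p * (real (fst p) + 1) * (cmod (U p))\<^sup>2)"
        using ratio(1) by (simp add: le_divide_eq mult.assoc mult.commute[of m])
    qed (use nn in simp)
  qed
qed

lemma smaller_bergman_subset: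
  assumes "U \<in> coeff_arrays (\<alpha> - 1)"
  shows "U \<in> carr_w"
  unfolding wl2_mem
proof (rule summable_on_comparison_test)
  show "(\<lambda>p. w p * (real (fst p) + 1) * (cmod (U p))\<^sup>2) summable_on UNIV"
    using assms smaller_bergman_mem_iff by blast
  fix p
  have "w p * 1 \<le> w p * (real (fst p) + 1)" using w_pos[of p] by (intro mult_left_mono) auto
  then show "w p * (cmod (U p))\<^sup>2 \<le> w p * (real (fst p) + 1) * (cmod (U p))\<^sup>2"
    by (intro mult_right_mono) auto
qed simp

text \<open>The dual of the space with weights \<open>v = w/(n + 1)\<close>, with respect to the pairing with weights \<open>w\<close>,
  is the space with weights \<open>(n + 1) w\<close>. One inclusion is the Cauchy-Schwarz inequality, the other
  comes from testing on finite pieces of \<open>(n + 1) U\<close>.\<close>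

lemma bounded_against_form_iff:
  assumes c1: "0 < c1"
    and lo: "\<And>X. X \<in> carr_w \<Longrightarrow> c1 * (norm_v X)\<^sup>2 \<le> Q X"
    and hi: "\<And>X. X \<in> carr_w \<Longrightarrow> Q X \<le> c2 * (norm_v X)\<^sup>2"
    and U: "U \<in> carr_w"
  shows "(\<exists>c. \<forall>X\<in>carr_w. (cmod (hinner (wl2 w) U X))\<^sup>2 \<le> c * Q X) \<longleftrightarrow>
    U \<in> coeff_arrays (\<alpha> - 1)"
proof
  let ?U = "\<lambda>p. of_nat (fst p + 1) * U p"
  have v_U: "v p * (cmod (?U p))\<^sup>2 = w p * (real (fst p) + 1) * (cmod (U p))\<^sup>2" for p
  proof -
    define t where "t = real (fst p + 1)"
    have "cmod (?U p) = t * cmod (U p)" by (simp only: norm_mult norm_of_nat t_def)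
    moreover have "v p = w p / t" "real (fst p) + 1 = t" "0 < t" by (simp_all add: v_def t_def)
    ultimately show ?thesis by (simp only: power_mult_distrib) (simp add: power2_eq_square)
  qed
  show "U \<in> coeff_arrays (\<alpha> - 1)"
    if bnd: "\<exists>c. \<forall>X\<in>carr_w. (cmod (hinner (wl2 w) U X))\<^sup>2 \<le> c * Q X"
  proof -
    obtain c where c: "\<And>X. X \<in> carr_w \<Longrightarrow> (cmod (hinner (wl2 w) U X))\<^sup>2 \<le> c * Q X"
      using bnd by blast
    have bound: "(\<Sum>p\<in>F. w p * (real (fst p) + 1) * (cmod (U p))\<^sup>2) \<le> \<bar>c\<bar> * c2" if F: "finite F" for F
    proof -
      define s where "s = (\<Sum>p\<in>F. w p * (real (fst p) + 1) * (cmod (U p))\<^sup>2)"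
      \<comment> \<open>The test vector: pairing it with \<open>U\<close> and taking its norm with weights \<open>v\<close> squared both give \<open>s\<close>.\<close>
      define X where "X p = (if p \<in> F then ?U p else 0)" for p
      have X: "X \<in> carr_w"
        unfolding wl2_mem
        by (rule finite_nonzero_values_imp_summable_on, rule finite_subset[OF _ F]) (auto simp: X_def)
      have s0: "0 \<le> s" unfolding s_def using w_pos by (intro sum_nonneg) (simp add: less_imp_le)
      have "((\<lambda>p. of_real (w p) * (U p * cnj (X p))) has_sum of_real s) UNIV"
      proof (rule has_sum_finite_neutralI[OF F])
        show "of_real s = (\<Sum>p\<in>F. of_real (w p) * (U p * cnj (X p)))"
          unfolding s_def of_real_sum
        proof (rule sum.cong)
          fix p assume "p \<in> F"
          then have "U p * cnj (X p) = of_real ((real (fst p) + 1) * (cmod (U p))\<^sup>2)"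
            by (simp add: X_def complex_norm_square mult_ac del: of_real_power)
          then show "of_real (w p * (real (fst p) + 1) * (cmod (U p))\<^sup>2)
              = of_real (w p) * (U p * cnj (X p))"
            by (simp add: mult.assoc)
        qed simp
      qed (auto simp: X_def)
      then have inner: "hinner (wl2 w) U X = of_real s" unfolding wl2_inner by (rule infsumI)
      have "((\<lambda>p. v p * (cmod (X p))\<^sup>2) has_sum s) UNIV"
      proof (rule has_sum_finite_neutralI[OF F])
        show "s = (\<Sum>p\<in>F. v p * (cmod (X p))\<^sup>2)"
          unfolding s_def by (rule sum.cong) (simp_all only: X_def if_True v_U)
      qed (auto simp: X_def)
      then have nv: "(norm_v X)\<^sup>2 = s" unfolding V.norm_sq by (rule infsumI)
      have "c1 * s \<le> Q X" using lo[OF X] by (simp add: nv)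
      moreover have "0 \<le> c1 * s" using c1 s0 by simp
      ultimately have "0 \<le> Q X" by linarith
      have "s\<^sup>2 \<le> c * Q X" using c[OF X] by (simp add: inner)
      also have "\<dots> \<le> \<bar>c\<bar> * Q X" using \<open>0 \<le> Q X\<close> by (intro mult_right_mono) auto
      also have "\<dots> \<le> \<bar>c\<bar> * (c2 * s)" using hi[OF X] by (intro mult_left_mono) (auto simp: nv)
      finally have "s * s \<le> (\<bar>c\<bar> * c2) * s" by (simp add: power2_eq_square mult.assoc)
      \<comment> \<open>For \<open>s = 0\<close> one cannot cancel \<open>s\<close>, but the two bounds on \<open>Q\<close> force \<open>c2\<close> to be nonnegative.\<close>
      moreover have "0 \<le> \<bar>c\<bar> * c2" if "s = 0"
      proof -
        have "0 \<le> c2"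
        proof -
          define e :: "nat \<times> nat \<Rightarrow> complex" where "e = (\<lambda>p. if p = (0, 0) then 1 else 0)"
          have e: "e \<in> carr_w"
            unfolding wl2_mem by (rule finite_nonzero_values_imp_summable_on) (auto simp: e_def)
          have "e \<in> carr_v" by (rule W_subset_V[OF e])
          moreover have "e \<noteq> 0"
          proof
            assume "e = 0"
            then have "e (0, 0) = 0" by simp
            then show False by (simp add: e_def)
          qed
          ultimately have "0 < (norm_v e)\<^sup>2" by simp
          moreover have "c1 * (norm_v e)\<^sup>2 \<le> c2 * (norm_v e)\<^sup>2"
            using lo[OF e] hi[OF e] by (rule order_trans)
          ultimately have "c1 \<le> c2" by simp
          then show ?thesis using c1 by simp
        qed
        then show ?thesis by simp
      qed
      ultimately have "s \<le> \<bar>c\<bar> * c2"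
        using s0 by (cases "s = 0") (auto simp: mult_le_cancel_right)
      then show ?thesis by (simp add: s_def)
    qed
    show ?thesis
      unfolding smaller_bergman_mem_iff
    proof (rule nonneg_bdd_above_summable_on)
      show "bdd_above (sum (\<lambda>p. w p * (real (fst p) + 1) * (cmod (U p))\<^sup>2) ` {F. F \<subseteq> UNIV \<and> finite F})"
        using bound by (intro bdd_aboveI2) auto
    qed (simp add: less_imp_le[OF w_pos])
  qed
  show "\<exists>c. \<forall>X\<in>carr_w. (cmod (hinner (wl2 w) U X))\<^sup>2 \<le> c * Q X"
    if "U \<in> coeff_arrays (\<alpha> - 1)"
  proof -
    have UV: "?U \<in> carr_v"
      unfolding wl2_mem v_U using that smaller_bergman_mem_iff by blast
    show ?thesis
    proof (intro exI ballI)
      fix X assume X: "X \<in> carr_w"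
      have XV: "X \<in> carr_v" by (rule W_subset_V[OF X])
      have "hinner (wl2 w) U X = hinner (wl2 v) ?U X"
        unfolding wl2_inner
      proof (rule infsum_cong)
        fix p :: "nat \<times> nat"
        have "w p = v p * real (fst p + 1)" by (simp add: v_def add.commute)
        then show "of_real (w p) * (U p * cnj (X p)) = of_real (v p) * (?U p * cnj (X p))"
          by (simp only: of_real_mult of_real_of_nat_eq mult.assoc)
      qed
      then have "(cmod (hinner (wl2 w) U X))\<^sup>2 \<le> (norm_v ?U * norm_v X)\<^sup>2"
        using V.wl2.Cauchy_Schwarz[OF UV XV] by (simp add: power_mono)
      also have "\<dots> = (norm_v ?U)\<^sup>2 / c1 * (c1 * (norm_v X)\<^sup>2)"
        using c1 by (simp add: power_mult_distrib)
      also have "\<dots> \<le> (norm_v ?U)\<^sup>2 / c1 * Q X"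
        using c1 lo[OF X] by (intro mult_left_mono) auto
      finally show "(cmod (hinner (wl2 w) U X))\<^sup>2 \<le> (norm_v ?U)\<^sup>2 / c1 * Q X" .
    qed
  qed
qed

end


section \<open>The diagonal Blaschke function\<close>

definition diag_blaschke :: "complex \<Rightarrow> (nat \<Rightarrow> complex) \<Rightarrow> nat \<Rightarrow> complex" where
  "diag_blaschke z = (\<lambda>x\<in>hcarrier l2. \<lambda>k. blaschke_factor (of_real (zero_at k)) z * x k)"

lemma one_minus_zero_at_mult:
  assumes "cmod z < 1"
  shows "3 / 4 \<le> cmod (1 - of_real (zero_at k) * z)" "1 - of_real (zero_at k) * z \<noteq> 0"
proof -
  have "cmod (of_real (zero_at k) * z) \<le> 1 / 4 * 1"
    using assms zero_at_bounds[of k] unfolding norm_mult by (intro mult_mono) auto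
  then show "3 / 4 \<le> cmod (1 - of_real (zero_at k) * z)"
    using norm_triangle_ineq2[of 1 "of_real (zero_at k) * z"] by simp
  then show "1 - of_real (zero_at k) * z \<noteq> 0" by auto
qed

lemma blaschke_factor_zero_at:
  "blaschke_factor (of_real (zero_at k)) z = (z - of_real (zero_at k)) / (1 - of_real (zero_at k) * z)"
  by (simp add: blaschke_factor_def)

lemma blaschke_factor_le_1:
  assumes "cmod z < 1"
  shows "cmod (blaschke_factor (of_real (zero_at k)) z) \<le> 1"
proof -
  define a where "a = zero_at k"
  have "(cmod (1 - of_real a * z))\<^sup>2 - (cmod (z - of_real a))\<^sup>2 = (1 - a\<^sup>2) * (1 - (cmod z)\<^sup>2)"
    unfolding cmod_power2 by (simp add: power2_eq_square algebra_simps)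
  moreover have "0 \<le> (1 - a\<^sup>2) * (1 - (cmod z)\<^sup>2)"
    using zero_at_square_le[of k] assms by (intro mult_nonneg_nonneg) (auto simp: a_def power_le_one)
  ultimately have "(cmod (z - of_real a))\<^sup>2 \<le> (cmod (1 - of_real a * z))\<^sup>2" by linarith
  then have "cmod (z - of_real a) \<le> cmod (1 - of_real a * z)" by (rule power2_le_imp_le) simp
  then show ?thesis
    using one_minus_zero_at_mult[OF assms, of k]
    by (simp add: blaschke_factor_zero_at norm_divide divide_le_eq a_def)
qed

text \<open>The lower bound needs an argument because \<open>op_norm\<close> is a supremum of reals, which has no useful
  value on unbounded sets.\<close>

lemma diagonal_operator:
  assumes K: "\<And>k. cmod (d k) \<le> K"
  defines "T \<equiv> \<lambda>x\<in>hcarrier l2. \<lambda>k. d k * x k"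
  shows "T \<in> bounded_ops l2 l2" "op_norm l2 l2 T \<le> K" "0 \<le> op_norm l2 l2 T"
proof -
  have K0: "0 \<le> K" using order_trans[OF norm_ge_zero K] .
  have mem: "(\<lambda>k. d k * x k) \<in> hcarrier l2"
    and le: "hnorm l2 (\<lambda>k. d k * x k) \<le> K * hnorm l2 x" if x: "x \<in> hcarrier l2" for x
  proof -
    have "1 * (cmod (d k * x k))\<^sup>2 \<le> K\<^sup>2 * (1 * (cmod (x k))\<^sup>2)" for k
      using power_mono[OF K[of k], of 2] by (simp add: norm_mult power_mult_distrib mult_right_mono)
    from wl2_dominated[where w = "\<lambda>_. 1" and v = "\<lambda>_. 1", OF _ _ x this]
    show m: "(\<lambda>k. d k * x k) \<in> hcarrier l2"
      and "hnorm l2 (\<lambda>k. d k * x k) \<le> K * hnorm l2 x"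
      using x K0 by (auto simp: power_mult_distrib[symmetric] elim!: power2_le_imp_le)
  qed
  show T: "T \<in> bounded_ops l2 l2"
    unfolding bounded_ops_def
  proof (intro CollectI conjI ballI allI)
    show "T \<in> hcarrier l2 \<rightarrow>\<^sub>E hcarrier l2" using mem by (auto simp: T_def)
    show "T (x + y) = T x + T y" if "x \<in> hcarrier l2" "y \<in> hcarrier l2" for x y
      using that by (simp add: T_def fun_eq_iff distrib_left)
    show "T (hscale l2 c x) = hscale l2 c (T x)" if "x \<in> hcarrier l2" for c x
      using that l2.scale_mem[OF that] by (simp add: T_def fun_eq_iff)
    show "\<exists>C. \<forall>x\<in>hcarrier l2. hnorm l2 (T x) \<le> C * hnorm l2 x"
      using le by (auto simp: T_def)
  qed
  have q: "hnorm l2 (T x) / hnorm l2 x \<le> K" if x: "x \<in> hcarrier l2" for x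
  proof (cases "hnorm l2 x = 0")
    case False
    then have "0 < hnorm l2 x" using l2.wl2.norm_nonneg[OF x] by simp
    then show ?thesis using le[OF x] x by (simp add: T_def divide_le_eq)
  qed (use K0 in simp)
  show "op_norm l2 l2 T \<le> K"
    unfolding op_norm_def
  proof (rule cSUP_least)
    show "hcarrier l2 \<noteq> {}" using l2.wl2.mem_zero by blast
  qed (rule q)
  have "hnorm l2 (T 0) / hnorm l2 0 \<le> op_norm l2 l2 T"
    unfolding op_norm_def by (rule cSUP_upper[OF l2.wl2.mem_zero]) (use q in \<open>auto intro!: bdd_aboveI2\<close>)
  then show "0 \<le> op_norm l2 l2 T" by simp
qed

text \<open>With \<open>p = 1 - a u\<close> and \<open>q = 1 - a z\<close>, the difference quotient of \<open>\<phi>\<^bsub>a\<^esub>\<close> is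
  \<open>(1 - a\<^sup>2) / (p q)\<close>, which differs from the derivative \<open>(1 - a\<^sup>2) / q\<^sup>2\<close> by
  \<open>(1 - a\<^sup>2) a (u - z) / (q\<^sup>2 p)\<close>. As \<open>|p|\<close> and \<open>|q|\<close> are at least \<open>3/4\<close> for all the
  points \<open>a\<close>, the error is at most \<open>|u - z|\<close> in every coordinate.\<close>

lemma diag_blaschke_analytic: "op_analytic l2 diag_blaschke"
  unfolding op_analytic_def
proof (rule ballI)
  fix z :: complex assume "z \<in> ball 0 1"
  then have z: "cmod z < 1" by simp
  define A where "A k = complex_of_real (zero_at k)" for k
  have A: "cmod (A k) \<le> 1 / 4" for k
    using zero_at_bounds[of k] by (simp add: A_def)
  have A1: "cmod (1 - (A k)\<^sup>2) \<le> 1" for k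
  proof -
    have "1 - (A k)\<^sup>2 = of_real (1 - (zero_at k)\<^sup>2)" by (simp add: A_def)
    then show ?thesis using zero_at_square_le[of k]
      by (simp only: norm_of_real) (simp add: abs_if)
  qed
  have den: "3 / 4 \<le> cmod (1 - A k * u)" "1 - A k * u \<noteq> 0" if "cmod u < 1" for k u
    using one_minus_zero_at_mult[OF that, of k] by (simp_all add: A_def)
  define d where "d k = (1 - (A k)\<^sup>2) / (1 - A k * z)\<^sup>2" for k
  define D where "D = (\<lambda>x\<in>hcarrier l2. \<lambda>k. d k * x k)"
  have d_le: "cmod (d k) \<le> 2" for k
  proof -
    have "(3/4)\<^sup>2 \<le> (cmod (1 - A k * z))\<^sup>2" using den(1)[OF z] by (intro power_mono) auto
    then have "1 / (cmod (1 - A k * z))\<^sup>2 \<le> 1 / (3/4)\<^sup>2" by (intro frac_le) auto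
    moreover have "cmod (d k) \<le> 1 / (cmod (1 - A k * z))\<^sup>2"
      unfolding d_def norm_divide norm_power using A1[of k] by (intro divide_right_mono) auto
    ultimately show ?thesis by (simp add: power2_eq_square)
  qed
  have D: "D \<in> bounded_ops l2 l2" unfolding D_def by (rule diagonal_operator(1)[OF d_le])
  let ?R = "\<lambda>u. \<lambda>x\<in>hcarrier l2. hscale l2 (1 / (u - z)) (diag_blaschke u x - diag_blaschke z x) - D x"
  have R: "0 \<le> op_norm l2 l2 (?R u) \<and> op_norm l2 l2 (?R u) \<le> cmod (u - z)"
    if u: "cmod u < 1" and uz: "u \<noteq> z" for u
  proof -
    define e where "e k = (1 - (A k)\<^sup>2) * A k * (u - z) / ((1 - A k * z)\<^sup>2 * (1 - A k * u))" for k
    have coeff: "1 / (u - z) * (blaschke_factor (A k) u - blaschke_factor (A k) z) - d k = e k" for k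
    proof -
      define p q where "p = 1 - A k * u" and "q = 1 - A k * z"
      have pq: "p \<noteq> 0" "q \<noteq> 0" using den(2)[OF u] den(2)[OF z] by (simp_all add: p_def q_def)
      have "(u - A k) * q - (z - A k) * p = (1 - (A k)\<^sup>2) * (u - z)"
        by (simp add: p_def q_def algebra_simps power2_eq_square)
      moreover have "blaschke_factor (A k) u - blaschke_factor (A k) z
          = ((u - A k) * q - (z - A k) * p) / (p * q)"
        using pq by (simp add: blaschke_factor_zero_at A_def[of k] flip: p_def q_def)
          (simp add: p_def q_def A_def field_simps)
      ultimately have "1 / (u - z) * (blaschke_factor (A k) u - blaschke_factor (A k) z)
          = (1 - (A k)\<^sup>2) / (p * q)"
        using uz by simp
      moreover have "(1 - (A k)\<^sup>2) / (p * q) - (1 - (A k)\<^sup>2) / q\<^sup>2 = (1 - (A k)\<^sup>2) * (q - p) / (q\<^sup>2 * p)"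
        using pq by (simp add: field_simps power2_eq_square)
      moreover have "q - p = A k * (u - z)" by (simp add: p_def q_def algebra_simps)
      ultimately show ?thesis by (simp add: d_def e_def mult.assoc flip: p_def q_def)
    qed
    \<comment> \<open>\<open>(3/4)\<^sup>3 \<ge> 1/4\<close> and \<open>|a| \<le> 1/4\<close>.\<close>
    have e_le: "cmod (e k) \<le> cmod (u - z)" for k
    proof -
      have "(3/4)\<^sup>2 * (3/4) \<le> (cmod (1 - A k * z))\<^sup>2 * cmod (1 - A k * u)"
        using den(1)[OF z] den(1)[OF u] by (intro mult_mono power_mono) auto
      then have "1/4 \<le> (cmod (1 - A k * z))\<^sup>2 * cmod (1 - A k * u)"
        by (simp add: power2_eq_square)
      moreover have "cmod (1 - (A k)\<^sup>2) * cmod (A k) * cmod (u - z) \<le> 1 * (1/4) * cmod (u - z)"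
        using A1[of k] A[of k] by (intro mult_mono) auto
      ultimately have "cmod (e k) \<le> (1 * (1/4) * cmod (u - z)) / (1/4)"
        unfolding e_def norm_divide norm_mult norm_power by (intro frac_le) auto
      then show ?thesis by simp
    qed
    have "?R u = (\<lambda>x\<in>hcarrier l2. \<lambda>k. e k * x k)"
    proof (rule restrict_ext)
      fix x assume x: "x \<in> hcarrier l2"
      show "hscale l2 (1 / (u - z)) (diag_blaschke u x - diag_blaschke z x) - D x = (\<lambda>k. e k * x k)"
      proof
        fix k
        show "(hscale l2 (1 / (u - z)) (diag_blaschke u x - diag_blaschke z x) - D x) k = e k * x k"
          using x unfolding coeff[symmetric] by (simp add: diag_blaschke_def D_def A_def algebra_simps)
      qed
    qed
    then show ?thesis using diagonal_operator[of e, OF e_le] by simp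
  qed
  have "((\<lambda>u. op_norm l2 l2 (?R u)) \<longlongrightarrow> 0) (at z)"
  proof (rule Lim_null_comparison)
    have "eventually (\<lambda>u. u \<in> ball 0 1 \<and> u \<noteq> z) (at z)"
      using z by (intro eventually_conj eventually_at_in_open') (auto simp: eventually_at_filter)
    then show "eventually (\<lambda>u. norm (op_norm l2 l2 (?R u)) \<le> cmod (u - z)) (at z)"
      by eventually_elim (use R in auto)
    have "((\<lambda>u. cmod (u - z)) \<longlongrightarrow> cmod (z - z)) (at z)" by (intro tendsto_intros)
    then show "((\<lambda>u. cmod (u - z)) \<longlongrightarrow> 0) (at z)" by simp
  qed
  then show "\<exists>D\<in>bounded_ops l2 l2. ((\<lambda>u. op_norm l2 l2 (\<lambda>x\<in>hcarrier l2.
      hscale l2 (1 / (u - z)) (diag_blaschke u x - diag_blaschke z x) - D x)) \<longlongrightarrow> 0) (at z)"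
    using D by blast
qed

lemma diag_blaschke_Hinf: "diag_blaschke \<in> Hinf_unit_ball l2"
  unfolding Hinf_unit_ball_def
proof (intro CollectI conjI ballI diag_blaschke_analytic)
  fix z :: complex assume "z \<in> ball 0 1"
  then have z: "cmod z < 1" by simp
  show "diag_blaschke z \<in> bounded_ops l2 l2" "op_norm l2 l2 (diag_blaschke z) \<le> 1"
    unfolding diag_blaschke_def
    by (rule diagonal_operator[OF blaschke_factor_le_1[OF z]])+
qed

text \<open>The value is the orthogonal sum of a nonzero multiple of \<open>x - P x\<close> and of \<open>P x\<close>.\<close>

lemma (in complex_hilbert_space) bp_factor_nonzero:
  assumes F: "closed_subspace H F" "F \<subseteq> carr" and b: "blaschke_factor a z \<noteq> 0"
    and x: "x \<in> carr" "x \<noteq> 0"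
  shows "bp_factor H a F z x \<in> carr" "bp_factor H a F z x \<noteq> 0"
proof -
  define p where "p = orth_proj H F x"
  have pF: "p \<in> F" and orth: "ip (x - p) p = 0"
    using orth_proj_works[OF F(1) x(1)] by (auto simp: p_def)
  have p: "p \<in> carr" using pF F(2) by blast
  have eq: "bp_factor H a F z x = sc (blaschke_factor a z) (x - p) + p"
    using x by (simp add: bp_factor_def p_def)
  show "bp_factor H a F z x \<in> carr" using x p by (simp add: eq)
  show "bp_factor H a F z x \<noteq> 0"
  proof
    assume 0: "bp_factor H a F z x = 0"
    have "ip (sc (blaschke_factor a z) (x - p) + p) p = ip p p"
      using x p orth by (simp add: inner_add inner_scale)
    then have "ip p p = 0" using 0 p by (simp add: eq)
    then have "p = 0" using p inner_definite by blast
    then have "sc (blaschke_factor a z) x = 0" using 0 eq by simp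
    then show False using b x by simp
  qed
qed

lemma (in complex_hilbert_space) bp_prod_nonzero:
  assumes "\<And>a F. (a, F) \<in> set ps \<Longrightarrow>
      closed_subspace H F \<and> F \<subseteq> carr \<and> blaschke_factor a z \<noteq> 0"
    and x: "x \<in> carr" "x \<noteq> 0"
  shows "bp_prod H ps z x \<in> carr \<and> bp_prod H ps z x \<noteq> 0"
  using assms(1)
proof (induction ps)
  case Nil
  then show ?case using x by (simp add: bp_prod_def op_id_def)
next
  case (Cons aF ps)
  obtain a F where aF: "aF = (a, F)" by (cases aF)
  have IH: "bp_prod H ps z x \<in> carr \<and> bp_prod H ps z x \<noteq> 0" using Cons by auto
  have "bp_prod H (aF # ps) z x = bp_factor H a F z (bp_prod H ps z x)"
    using x by (simp add: bp_prod_def aF compose_eq)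
  then show ?case using IH bp_factor_nonzero[of F a z "bp_prod H ps z x"] Cons.prems[of a F] aF by auto
qed

lemma diag_blaschke_not_bp: "\<not> finite_blaschke_potapov l2 diag_blaschke"
proof
  assume "finite_blaschke_potapov l2 diag_blaschke"
  then obtain U ps where U: "unitary_op l2 U"
    and ps: "\<And>a F. (a, F) \<in> set ps \<Longrightarrow> a \<in> ball 0 1 \<and> closed_subspace l2 F \<and> F \<subset> hcarrier l2"
    and B: "\<And>z. z \<in> ball 0 1 \<Longrightarrow> diag_blaschke z = compose (hcarrier l2) U (bp_prod l2 ps z)"
    unfolding finite_blaschke_potapov_def by blast
  have "inj (\<lambda>k. complex_of_real (zero_at k))"
    by (rule injI) (simp add: zero_at_def)
  then have "infinite (range (\<lambda>k. complex_of_real (zero_at k)))" by (rule range_inj_infinite)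
  then have "\<not> range (\<lambda>k. complex_of_real (zero_at k)) \<subseteq> fst ` set ps"
    using finite_subset by blast
  then obtain k where k: "complex_of_real (zero_at k) \<notin> fst ` set ps" by blast
  define z where "z = complex_of_real (zero_at k)"
  have z: "cmod z < 1" using zero_at_bounds[of k] by (simp add: z_def)
  define e :: "nat \<Rightarrow> complex" where "e = (\<lambda>i. if i = k then 1 else 0)"
  have e: "e \<in> hcarrier l2"
    unfolding wl2_mem by (rule finite_nonzero_values_imp_summable_on) (auto simp: e_def)
  have "e k \<noteq> 0" by (simp add: e_def)
  then have e0: "e \<noteq> 0" by auto
  \<comment> \<open>The basis vector \<open>e\<close> is killed at a point where every factor of the product is injective.\<close>
  have Be: "diag_blaschke z e = 0"
    using e by (auto simp: diag_blaschke_def e_def z_def blaschke_factor_def fun_eq_iff)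
  have nz: "blaschke_factor a z \<noteq> 0" if "(a, F) \<in> set ps" for a F
  proof -
    have "a \<noteq> z" using k that unfolding z_def by force
    moreover have "cmod (cnj a * z) < 1"
      using ps[OF that] z mult_strict_mono[of "cmod a" 1 "cmod z" 1] by (simp add: norm_mult)
    then have "1 - cnj a * z \<noteq> 0" by auto
    ultimately show ?thesis by (simp add: blaschke_factor_def)
  qed
  have P: "bp_prod l2 ps z e \<in> hcarrier l2" "bp_prod l2 ps z e \<noteq> 0"
    using l2.wl2.bp_prod_nonzero[of ps z e] ps nz e e0 by blast+
  define y where "y = bp_prod l2 ps z e"
  have "U y = 0"
    using B[of z] Be z e by (simp add: y_def compose_eq)
  have Ub: "U \<in> bounded_ops l2 l2" and left: "compose (hcarrier l2) (adjoint_op l2 l2 U) U = op_id l2"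
    using U by (auto simp: unitary_op_def)
  have inv: "adjoint_op l2 l2 U (U x) = x" if "x \<in> hcarrier l2" for x
    using fun_cong[OF left, of x] that by (simp add: compose_eq op_id_def)
  have "y = adjoint_op l2 l2 U (U 0)"
    using inv[of y] \<open>U y = 0\<close> l2.wl2.bounded_opsD(5)[OF Ub] P by (simp add: y_def)
  also have "\<dots> = 0" by (rule inv[OF l2.wl2.mem_zero])
  finally show False using P by (simp add: y_def)
qed


section \<open>The two sub-Bergman spaces of the diagonal Blaschke function\<close>

lemma bergman_value_mem:
  assumes \<beta>: "-2 < \<beta>" and f: "f \<in> hcarrier (bergman_space \<beta> l2)" and z: "z \<in> ball 0 1"
  shows "f z \<in> hcarrier l2"
proof -
  interpret M: Metric_space "hcarrier l2" "hdist l2" by (rule l2.wl2.is_metric_space)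
  obtain a where "has_coeffs l2 f a" using f by (auto simp: bergman_space_def)
  then have "limitin (htop l2) (\<lambda>N. \<Sum>n<N. hscale l2 (z ^ n) (a n)) (f z) sequentially"
    using z by (simp add: has_coeffs_def hsums_def)
  then have "f z \<in> topspace (htop l2)" by (rule limitin_topspace)
  then show ?thesis by simp
qed

context bergman_pair
begin

lemma alpha': "-2 < \<alpha>"
  using alpha by simp

lemma series_fun_diff:
  assumes "X \<in> carr_w" "Y \<in> carr_w"
  shows "series_fun (X - Y) = series_fun X - series_fun Y"
  using series_fun_add[OF alpha', of "X - Y" Y] assms by (simp add: eq_diff_eq)

lemma series_fun_shift:
  assumes Y: "Y \<in> carr_w" and z: "z \<in> ball 0 1"
  shows "series_fun (shift Y) z k = z * series_fun Y z k"
proof -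
  have "(\<lambda>n. z ^ Suc n * shift Y (Suc n, k)) sums (z * series_fun Y z k)"
    using sums_mult[OF series_fun_sums[OF alpha' Y z, of k], of z] by (simp add: mult.assoc)
  then have "(\<lambda>n. z ^ n * shift Y (n, k)) sums (z * series_fun Y z k + z ^ 0 * shift Y (0, k))"
    by (rule sums_Suc)
  then show ?thesis
    using sums_unique2[OF series_fun_sums[OF alpha' shift_defect(1)[OF Y] z, of k]] by simp
qed

lemma series_fun_diag:
  assumes Y: "Y \<in> carr_w" and z: "z \<in> ball 0 1"
  shows "series_fun (diag Y) z k = of_real (zero_at k) * series_fun Y z k"
proof -
  have "(\<lambda>n. z ^ n * diag Y (n, k)) sums (of_real (zero_at k) * series_fun Y z k)"
    using sums_mult[OF series_fun_sums[OF alpha' Y z, of k], of "of_real (zero_at k)"]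
    by (simp add: diag_def mult.left_commute)
  then show ?thesis
    using sums_unique2[OF series_fun_sums[OF alpha' W_diag[OF Y] z, of k]] by simp
qed

abbreviation "A2 \<equiv> bergman_space \<alpha> l2"
abbreviation "T \<equiv> mult_op \<alpha> l2 diag_blaschke"

sublocale A2: complex_hilbert_space A2
  by (rule bergman_Hilbert[OF alpha'])

lemma A2_carrier: "hcarrier A2 = series_fun ` carr_w"
  by (rule bergman_carrier[OF alpha'])

lemma series_fun_mem [simp]: "X \<in> carr_w \<Longrightarrow> series_fun X \<in> hcarrier A2"
  by (simp add: A2_carrier)

lemma A2_inner:
  "\<lbrakk>X \<in> carr_w; Y \<in> carr_w\<rbrakk>
    \<Longrightarrow> hinner A2 (series_fun X) (series_fun Y) = hinner (wl2 w) X Y"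
  by (rule bergman_inner[OF alpha'])

lemma A2_norm: "X \<in> carr_w \<Longrightarrow> hnorm A2 (series_fun X) = norm_w X"
  by (simp add: hnorm_def A2_inner)

text \<open>The identity \<open>T (1 - A S) = S - A\<close>.\<close>

lemma T_series_fun:
  assumes Y: "Y \<in> carr_w"
  shows "T (series_fun (Y - diag (shift Y))) = series_fun (shift Y - diag Y)"
proof -
  let ?X = "Y - diag (shift Y)"
  have m: "shift Y \<in> carr_w" "diag Y \<in> carr_w" "diag (shift Y) \<in> carr_w"
    using Y shift_defect(1) by auto
  have X: "?X \<in> carr_w" using Y m by simp
  show ?thesis
  proof (intro ext)
    fix z k
    show "T (series_fun ?X) z k = series_fun (shift Y - diag Y) z k"
    proof (cases "z \<in> ball 0 1")
      case True
      define y where "y = series_fun Y z k"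
      define a where "a = complex_of_real (zero_at k)"
      have "1 - a * z \<noteq> 0" using one_minus_zero_at_mult(2)[of z k] True by (simp add: a_def)
      have "series_fun ?X z k = (1 - a * z) * y"
        using True by (simp add: series_fun_diff Y m series_fun_diag series_fun_shift a_def y_def
            algebra_simps)
      moreover have "series_fun (shift Y - diag Y) z k = (z - a) * y"
        using True by (simp add: series_fun_diff Y m series_fun_diag series_fun_shift a_def y_def
            algebra_simps)
      moreover have "T (series_fun ?X) z k = blaschke_factor a z * series_fun ?X z k"
        using True X bergman_value_mem[OF alpha' series_fun_mem[OF X] True]
        by (simp add: mult_op_def diag_blaschke_def a_def)
      moreover have "blaschke_factor a z = (z - a) / (1 - a * z)"
        by (simp add: a_def blaschke_factor_zero_at)
      ultimately show ?thesis using \<open>1 - a * z \<noteq> 0\<close> by simp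
    next
      case False
      then show ?thesis using X by (simp add: mult_op_def series_fun_def)
    qed
  qed
qed

lemma T_bounded: "T \<in> bounded_ops A2 A2"
  and T_contraction: "f \<in> hcarrier A2 \<Longrightarrow> hnorm A2 (T f) \<le> hnorm A2 f"
proof -
  have Tf: "T f \<in> hcarrier A2 \<and> hnorm A2 (T f) \<le> hnorm A2 f" if "f \<in> hcarrier A2" for f
  proof -
    obtain X where X: "X \<in> carr_w" "f = series_fun X"
      using \<open>f \<in> hcarrier A2\<close> A2_carrier by blast
    obtain Y where Y: "Y \<in> carr_w" "Y - diag (shift Y) = X"
      and le: "norm_w (shift Y - diag Y) \<le> norm_w X"
      using comparable_defect_onto[OF comparable_defect_shift X(1)] by blast
    have m: "shift Y - diag Y \<in> carr_w" using Y shift_defect(1) by simp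
    have eq: "T (series_fun X) = series_fun (shift Y - diag Y)"
      using T_series_fun[OF Y(1)] by (simp add: Y(2))
    show ?thesis using m le X(1) by (simp add: X(2) eq A2_norm)
  qed
  then show "f \<in> hcarrier A2 \<Longrightarrow> hnorm A2 (T f) \<le> hnorm A2 f" by blast
  have val: "f z \<in> hcarrier l2" if "f \<in> hcarrier A2" "z \<in> ball 0 1" for f z
    by (rule bergman_value_mem[OF alpha' that])
  show "T \<in> bounded_ops A2 A2"
    unfolding bounded_ops_def
  proof (intro CollectI conjI ballI allI)
    show "T \<in> hcarrier A2 \<rightarrow>\<^sub>E hcarrier A2" using Tf by (auto simp: mult_op_def)
    show "T (f + g) = T f + T g" if fg: "f \<in> hcarrier A2" "g \<in> hcarrier A2" for f g
      using A2.mem_add[OF fg] val fg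
      by (auto simp: mult_op_def fun_eq_iff diag_blaschke_def distrib_left)
    show "T (hscale A2 c f) = hscale A2 c (T f)" if f: "f \<in> hcarrier A2" for c f
      using A2.mem_scale[OF f, of c] val f l2.scale_mem
      by (auto simp: mult_op_def fun_eq_iff diag_blaschke_def bergman_scale)
    show "\<exists>C. \<forall>f\<in>hcarrier A2. hnorm A2 (T f) \<le> C * hnorm A2 f"
      using Tf by (intro exI[of _ 1]) simp
  qed
qed

text \<open>The identity \<open>T\<^sup>* (1 - A S\<^sup>*) = S\<^sup>* - A\<close>. It is checked on the vectors \<open>(1 - A S) G\<close>,
  which exhaust the space.\<close>

lemma T_adjoint_series_fun:
  assumes Y: "Y \<in> carr_w"
  shows "adjoint_op A2 A2 T (series_fun (Y - diag (bshift \<alpha> Y))) = series_fun (bshift \<alpha> Y - diag Y)"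
proof (rule A2.adjoint_op_eqI[OF T_bounded])
  have m: "bshift \<alpha> Y \<in> carr_w" "diag Y \<in> carr_w"
    "diag (bshift \<alpha> Y) \<in> carr_w"
    using Y bshift_defect(1) by auto
  show "series_fun (Y - diag (bshift \<alpha> Y)) \<in> hcarrier A2"
    "series_fun (bshift \<alpha> Y - diag Y) \<in> hcarrier A2" using Y m by auto
  fix f assume "f \<in> hcarrier A2"
  then obtain X where X: "X \<in> carr_w" "f = series_fun X" using A2_carrier by blast
  obtain G where G: "G \<in> carr_w" "G - diag (shift G) = X"
    using comparable_defect_onto[OF comparable_defect_shift X(1)] by blast
  have g: "shift G \<in> carr_w" "diag G \<in> carr_w" "diag (shift G) \<in> carr_w"
    using G shift_defect(1) by auto
  let ?ip = "hinner (wl2 w)"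
  have "?ip (diag G) (diag (bshift \<alpha> Y)) = ?ip (diag (shift G)) (diag Y)"
    by (simp add: diag_bshift shift_adjoint[symmetric] diag_shift)
  moreover have "?ip (shift G) (diag (bshift \<alpha> Y)) = ?ip (diag (shift G)) (bshift \<alpha> Y)"
    by (simp add: diag_self_adjoint)
  ultimately have "?ip (shift G - diag G) (Y - diag (bshift \<alpha> Y))
      = ?ip (G - diag (shift G)) (bshift \<alpha> Y - diag Y)"
    using G(1) g Y m
    by (simp add: W.wl2.inner_diff W.wl2.inner_diff_right shift_adjoint[of G Y] diag_self_adjoint[of G Y])
  then show "hinner A2 (T f) (series_fun (Y - diag (bshift \<alpha> Y)))
      = hinner A2 f (series_fun (bshift \<alpha> Y - diag Y))"
    using G(1) g Y m T_series_fun[OF G(1)] by (simp add: X(2) A2_inner flip: G(2))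
qed

text \<open>Applied with \<open>R\<close> the operator \<open>T\<close> and its adjoint: the left side is the range of the square root of
  \<open>1 - R\<^sup>* R\<close> by Douglas' criterion.\<close>

lemma bounded_functionals_carrier:
  fixes R :: "(complex \<Rightarrow> nat \<Rightarrow> complex) \<Rightarrow> complex \<Rightarrow> nat \<Rightarrow> complex"
  assumes S: "comparable_defect S"
    and R: "\<And>Y. Y \<in> carr_w \<Longrightarrow>
      hnorm A2 (R (series_fun (Y - diag (S Y)))) = norm_w (S Y - diag Y)"
  shows "{u \<in> hcarrier A2. \<exists>c. \<forall>x\<in>hcarrier A2.
      (cmod (hinner A2 u x))\<^sup>2 \<le> c * ((hnorm A2 x)\<^sup>2 - (hnorm A2 (R x))\<^sup>2)}
    = hcarrier (bergman_space (\<alpha> - 1) l2)"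
proof -
  obtain c1 c2 where c1: "0 < c1" and b: "\<And>X. X \<in> carr_w \<Longrightarrow>
      c1 * (norm_v X)\<^sup>2 \<le> (norm_w X)\<^sup>2 - (hnorm A2 (R (series_fun X)))\<^sup>2 \<and>
      (norm_w X)\<^sup>2 - (hnorm A2 (R (series_fun X)))\<^sup>2 \<le> c2 * (norm_v X)\<^sup>2"
    using S R unfolding comparable_defect_def by metis
  let ?Q = "\<lambda>X. (norm_w X)\<^sup>2 - (hnorm A2 (R (series_fun X)))\<^sup>2"
  have iff: "(\<exists>c. \<forall>x\<in>hcarrier A2. (cmod (hinner A2 (series_fun U) x))\<^sup>2
        \<le> c * ((hnorm A2 x)\<^sup>2 - (hnorm A2 (R x))\<^sup>2)) \<longleftrightarrow>
      U \<in> coeff_arrays (\<alpha> - 1)" if U: "U \<in> carr_w" for U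
  proof -
    have "(\<forall>x\<in>hcarrier A2. (cmod (hinner A2 (series_fun U) x))\<^sup>2
        \<le> c * ((hnorm A2 x)\<^sup>2 - (hnorm A2 (R x))\<^sup>2)) \<longleftrightarrow>
      (\<forall>X\<in>carr_w. (cmod (hinner (wl2 w) U X))\<^sup>2 \<le> c * ?Q X)" for c
      using U by (simp add: A2_carrier A2_inner A2_norm)
    then show ?thesis
      using bounded_against_form_iff[OF c1, of ?Q c2 U] b U by simp
  qed
  have "hcarrier (bergman_space (\<alpha> - 1) l2) = series_fun ` coeff_arrays (\<alpha> - 1)"
    using alpha by (intro bergman_carrier) simp
  moreover have "{u \<in> hcarrier A2. \<exists>c. \<forall>x\<in>hcarrier A2.
      (cmod (hinner A2 u x))\<^sup>2 \<le> c * ((hnorm A2 x)\<^sup>2 - (hnorm A2 (R x))\<^sup>2)}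
    = series_fun ` coeff_arrays (\<alpha> - 1)" (is "{u \<in> _. ?P u} = _")
  proof (intro equalityI subsetI)
    fix u assume "u \<in> {u \<in> hcarrier A2. ?P u}"
    then obtain U where "U \<in> carr_w" "u = series_fun U" "?P u"
      unfolding A2_carrier by blast
    then show "u \<in> series_fun ` coeff_arrays (\<alpha> - 1)" using iff by blast
  next
    fix u assume "u \<in> series_fun ` coeff_arrays (\<alpha> - 1)"
    then obtain U where U: "U \<in> coeff_arrays (\<alpha> - 1)" "u = series_fun U" by blast
    then show "u \<in> {u \<in> hcarrier A2. ?P u}"
      using iff[OF smaller_bergman_subset[OF U(1)]] smaller_bergman_subset[OF U(1)] by simp
  qed
  ultimately show ?thesis by simp
qed

theorem sub_bergman_spaces:
  "hcarrier (sub_bergman \<alpha> l2 diag_blaschke) = hcarrier (bergman_space (\<alpha> - 1) l2)"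
  "hcarrier (sub_bergman_star \<alpha> l2 diag_blaschke) = hcarrier (bergman_space (\<alpha> - 1) l2)"
proof -
  show "hcarrier (sub_bergman \<alpha> l2 diag_blaschke) = hcarrier (bergman_space (\<alpha> - 1) l2)"
    unfolding sub_bergman_def Let_def
  proof (subst A2.range_sqrt_complement(1)[OF T_bounded T_contraction], assumption,
      rule bounded_functionals_carrier[OF comparable_defect_bshift])
    show "hnorm A2 (adjoint_op A2 A2 T (series_fun (Y - diag (bshift \<alpha> Y))))
        = norm_w (bshift \<alpha> Y - diag Y)" if "Y \<in> carr_w" for Y
      using that bshift_defect(1) by (simp add: T_adjoint_series_fun A2_norm)
  qed
  show "hcarrier (sub_bergman_star \<alpha> l2 diag_blaschke) = hcarrier (bergman_space (\<alpha> - 1) l2)"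
    unfolding sub_bergman_star_def Let_def
  proof (subst A2.range_sqrt_complement(2)[OF T_bounded T_contraction], assumption,
      rule bounded_functionals_carrier[OF comparable_defect_shift])
    show "hnorm A2 (T (series_fun (Y - diag (shift Y)))) = norm_w (shift Y - diag Y)"
      if "Y \<in> carr_w" for Y
      using that shift_defect(1) by (simp add: T_series_fun A2_norm)
  qed
qed

end

theorem theorem1p2:
  shows "\<exists>E :: (nat \<Rightarrow> complex) hspace.
     complex_hilbert_space E \<and> infinite_dimensional E \<and> separable_space (htop E) \<and>
     (\<exists>B \<in> Hinf_unit_ball E.
        (\<forall>\<alpha>>-1. same_elements (sub_bergman \<alpha> E B) (sub_bergman_star \<alpha> E B) \<and>
                 same_elements (sub_bergman_star \<alpha> E B) (bergman_space (\<alpha> - 1) E)) \<and>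
        \<not> finite_blaschke_potapov E B)"
proof (intro exI[of _ l2] conjI bexI[of _ diag_blaschke] allI impI)
  show "complex_hilbert_space l2" by (rule l2.wl2.complex_hilbert_space_axioms)
  show "infinite_dimensional l2" by (rule l2_infinite_dimensional)
  show "separable_space (htop l2)" by (rule l2_separable)
  show "diag_blaschke \<in> Hinf_unit_ball l2" by (rule diag_blaschke_Hinf)
  show "\<not> finite_blaschke_potapov l2 diag_blaschke" by (rule diag_blaschke_not_bp)
  fix \<alpha> :: real assume "-1 < \<alpha>"
  then interpret bergman_pair \<alpha> by unfold_locales
  show "same_elements (sub_bergman \<alpha> l2 diag_blaschke) (sub_bergman_star \<alpha> l2 diag_blaschke)"
    "same_elements (sub_bergman_star \<alpha> l2 diag_blaschke) (bergman_space (\<alpha> - 1) l2)"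
    by (simp_all add: same_elements_def sub_bergman_spaces)
qed

end
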